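(* Fix $d\in\mathbb{N}$ and $n\ge d$. Let $\xi_1,\dots,\xi_n$ be (possibly dependent) random vectors in $\mathbb{R}^d$, let $S_0=0$ and $S_i=\xi_1+\dots+\xi_i$ for $1\le i\le n$, and let $\mathcal{Q}_{n,d}=\mathrm{conv}(S_0,S_1,\dots,S_n)$. Assume: (Ex) for every permutation $\pi$ of $\{1,\dots,n\}$, $(\xi_{\pi(1)},\dots,\xi_{\pi(n)})$ has the same distribution as $(\xi_1,\dots,\xi_n)$; (GP) for all $1\le i_1<\dots<i_d\le n$, the probability that $S_{i_1},\dots,S_{i_d}$ are linearly dependent is $0$. Then for every $j\in\{0,\dots,d-1\}$, $$\mathbb{E}\sum_{F\in\mathcal{F}_j(\mathcal{Q}_{n,d})}\alpha\big(T_F(\mathcal{Q}_{n,d})\big)=\frac{j!}{n!}\sum_{s=0}^{\infty}(-1)^s\genfrac{[}{]}{0pt}{}{n+1}{d-s}\genfrac{\{}{\}}{0pt}{}{d-s}{j+1}.$$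
   Context: $\mathbb{N}=\{1,2,\dots\}$. The solid angle of a polyhedral cone $C$ (the set of nonnegative linear combinations of finitely many vectors) is $\alpha(C)=\mathbb{P}[Z\in C]$ with $Z$ uniformly distributed on the unit sphere of the linear hull of $C$; $\alpha(C)=1$ if $C$ is a linear subspace (including $C=\{0\}$). For a polytope $P$, $\mathcal{F}_j(P)$ is the set of its $j$-dimensional faces ($P$ itself being a face). The tangent cone of $P\subset\mathbb{R}^d$ at a face $F$ is $T_F(P)=\{v\in\mathbb{R}^d: f_0+\varepsilon v\in P\text{ for some }\varepsilon>0\}$, where $f_0$ is any point of the relative interior of $F$. For a random polytope, angles are computed for each realization. $\genfrac{[}{]}{0pt}{}{n}{m}$ is the (signless) Stirling number of the first kind (number of permutations of an $n$-element set with exactly $m$ cycles) and $\genfrac{\{}{\}}{0pt}{}{n}{m}$ the Stirling number of the second kind (number of partitions of an $n$-element set into $m$ non-empty subsets), for $n\in\mathbb{N}$, $m\in\{1,\dots,n\}$; both are $0$ for $n\in\mathbb{N}$ and $m\notin\{1,\dots,n\}$. A product $\genfrac{[}{]}{0pt}{}{n+1}{m}\genfrac{\{}{\}}{0pt}{}{m}{i}$ with $m\le 0$ is $0$, so the sum is finite. *)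

theory Defs
  imports "HOL-Probability.Probability" "HOL-Combinatorics.Stirling"
begin

section \<open>Convex hulls of random walks\<close>

definition walk :: "(nat \<Rightarrow> 'w \<Rightarrow> 'a::real_vector) \<Rightarrow> nat \<Rightarrow> 'w \<Rightarrow> 'a" where
  "walk \<xi> i \<omega> = (\<Sum>k=1..i. \<xi> k \<omega>)"

definition walk_hull :: "(nat \<Rightarrow> 'w \<Rightarrow> 'a::real_vector) \<Rightarrow> nat \<Rightarrow> 'w \<Rightarrow> 'a set" where
  "walk_hull \<xi> n \<omega> = convex hull ((\<lambda>i. walk \<xi> i \<omega>) ` {0..n})"

text \<open>Linear dependence of an indexed family. Unlike \<open>dependent (v ` I)\<close>, it counts a repeated
  vector as a dependence.\<close>

definition family_dependent :: "'i set \<Rightarrow> ('i \<Rightarrow> 'a::real_vector) \<Rightarrow> bool" where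
  "family_dependent I v \<longleftrightarrow> (\<exists>c. (\<exists>i\<in>I. c i \<noteq> 0) \<and> (\<Sum>i\<in>I. c i *\<^sub>R v i) = 0)"

definition faces_of_dim :: "nat \<Rightarrow> 'a::euclidean_space set \<Rightarrow> 'a set set" where
  "faces_of_dim j P = {F. F face_of P \<and> aff_dim F = int j}"


section \<open>Tangent cones\<close>

definition tangent_cone :: "'a::euclidean_space set \<Rightarrow> 'a set \<Rightarrow> 'a set" where
  "tangent_cone P F = {v. \<exists>\<epsilon>>0. (SOME f. f \<in> rel_interior F) + \<epsilon> *\<^sub>R v \<in> P}"

lemma tangent_cone_aux:
  fixes P F :: "'a::euclidean_space set"
  assumes "convex P" "F face_of P" "f \<in> rel_interior F" "g \<in> rel_interior F"
    and "\<epsilon> > 0" "f + \<epsilon> *\<^sub>R v \<in> P"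
  shows "\<exists>\<delta>>0. g + \<delta> *\<^sub>R v \<in> P"
proof -
  have "convex F" "F \<subseteq> P" using assms(2) face_of_imp_convex face_of_imp_subset by blast+
  moreover have "f \<in> F" "g \<in> F" using assms(3,4) rel_interior_subset by blast+
  ultimately obtain e where e: "e > 1" "(1 - e) *\<^sub>R f + e *\<^sub>R g \<in> P"
    using convex_rel_interior_iff[of F g] assms(4) by blast
  define t where "t = 1 / e"
  have t: "0 < t" "t < 1" "t * e = 1" using e by (auto simp: t_def)
  have "t *\<^sub>R ((1 - e) *\<^sub>R f + e *\<^sub>R g) + (1 - t) *\<^sub>R (f + \<epsilon> *\<^sub>R v) \<in> P"
    by (rule convexD[OF assms(1) e(2) assms(6)]) (use t in auto)
  also have "t *\<^sub>R ((1 - e) *\<^sub>R f + e *\<^sub>R g) + (1 - t) *\<^sub>R (f + \<epsilon> *\<^sub>R v)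
      = (t * (1 - e) + (1 - t)) *\<^sub>R f + (t * e) *\<^sub>R g + ((1 - t) * \<epsilon>) *\<^sub>R v"
    by (simp add: algebra_simps)
  also have "t * (1 - e) + (1 - t) = 0" using t by (simp add: algebra_simps)
  finally show ?thesis using t assms(5) by (intro exI[of _ "(1 - t) * \<epsilon>"]) auto
qed

text \<open>The choice of the relatively interior point is immaterial.\<close>

lemma tangent_cone_eq:
  fixes P F :: "'a::euclidean_space set"
  assumes "convex P" "F face_of P" "f \<in> rel_interior F"
  shows "tangent_cone P F = {v. \<exists>\<epsilon>>0. f + \<epsilon> *\<^sub>R v \<in> P}"
  using tangent_cone_aux[OF assms(1,2) someI[of "\<lambda>f. f \<in> rel_interior F", OF assms(3)] assms(3)]
    tangent_cone_aux[OF assms(1,2,3) someI[of "\<lambda>f. f \<in> rel_interior F", OF assms(3)]]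
  unfolding tangent_cone_def by blast


section \<open>Solid angles\<close>

text \<open>Projecting a standard Gaussian vector orthogonally to a linear subspace \<open>L \<noteq> {0}\<close> and then
  normalising gives the uniform distribution on the unit sphere of \<open>L\<close>. The lemmas below confirm
  that the resulting measure is a probability measure on \<open>L \<inter> sphere 0 1\<close> that is invariant under
  all orthogonal transformations preserving \<open>L\<close>.\<close>

definition std_gaussian :: "'a::euclidean_space measure" where
  "std_gaussian = density lborel (\<lambda>x. ennreal (\<Prod>b\<in>Basis. std_normal_density (x \<bullet> b)))"

definition uniform_sphere :: "'a::euclidean_space set \<Rightarrow> 'a measure" where
  "uniform_sphere L = distr std_gaussian borel (\<lambda>x. sgn (closest_point L x))"

definition solid_angle :: "'a::euclidean_space set \<Rightarrow> real" where
  "solid_angle C = (if subspace C then 1 else measure (uniform_sphere (span C)) C)"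

lemma sets_std_gaussian [simp, measurable_cong]: "sets std_gaussian = sets borel"
  by (simp add: std_gaussian_def)

lemma space_std_gaussian [simp]: "space std_gaussian = UNIV"
  by (simp add: std_gaussian_def)

lemma prob_space_std_gaussian: "prob_space (std_gaussian :: 'a::euclidean_space measure)"
proof
  have one: "(\<integral>\<^sup>+x. ennreal (std_normal_density x) \<partial>lborel) = 1"
    using prob_space.emeasure_space_1[OF prob_space_normal_density[of 1 0]]
    by (simp add: emeasure_density)
  have "emeasure (std_gaussian :: 'a measure) (space std_gaussian) =
      (\<integral>\<^sup>+x. (\<Prod>b\<in>(Basis::'a set). ennreal (std_normal_density (x \<bullet> b))) \<partial>lborel)"
    by (simp add: std_gaussian_def emeasure_density prod_ennreal)
  also have "\<dots> = 1"
    by (subst nn_integral_lborel_prod) (simp_all add: one)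
  finally show "emeasure (std_gaussian :: 'a measure) (space std_gaussian) = 1" .
qed

lemma std_gaussian_density_norm:
  "(\<Prod>b\<in>(Basis::'a::euclidean_space set). std_normal_density (x \<bullet> b))
    = (1 / sqrt (2 * pi)) ^ DIM('a) * exp (- (norm x)\<^sup>2 / 2)"
proof -
  have "(\<Prod>b\<in>(Basis::'a set). std_normal_density (x \<bullet> b))
      = (1 / sqrt (2 * pi)) ^ DIM('a) * (\<Prod>b\<in>(Basis::'a set). exp (- (x \<bullet> b)\<^sup>2 / 2))"
    by (simp only: std_normal_density_def prod.distrib prod_constant)
  also have "(\<Prod>b\<in>(Basis::'a set). exp (- (x \<bullet> b)\<^sup>2 / 2)) = exp (\<Sum>b\<in>(Basis::'a set). - (x \<bullet> b)\<^sup>2 / 2)"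
    by (simp add: exp_sum)
  also have "(\<Sum>b\<in>(Basis::'a set). - (x \<bullet> b)\<^sup>2 / 2) = - (norm x)\<^sup>2 / 2"
    unfolding power2_norm_eq_inner
    by (subst euclidean_inner) (simp add: sum_negf sum_divide_distrib power2_eq_square)
  finally show ?thesis .
qed

lemma lborel_distr_orthogonal:
  fixes T :: "'a::euclidean_space \<Rightarrow> 'a"
  assumes T: "orthogonal_transformation T"
  shows "distr lborel borel T = lborel"
proof -
  have lin: "linear T" using T by (rule orthogonal_transformation_linear)
  have bij: "bij T" using T by (rule orthogonal_transformation_bij)
  have [measurable]: "T \<in> borel_measurable borel"
    using lin by (intro borel_measurable_continuous_onI linear_continuous_on linear_conv_bounded_linear[THEN iffD1])
  define N where "N = distr lborel borel T"
  have [simp, measurable_cong]: "sets N = sets borel" and [simp]: "space N = UNIV"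
    by (simp_all add: N_def)
  have Tinv: "(\<lambda>x. T (x + inv T y)) = (\<lambda>x. T x + y)" for y
    using bij by (simp add: linear_add[OF lin] surj_f_inv_f bij_is_surj)
  have transl: "(\<integral>\<^sup>+x. f (x + y) \<partial>N) = (\<integral>\<^sup>+x. f x \<partial>N)"
    if [measurable]: "f \<in> borel_measurable borel" for f :: "'a \<Rightarrow> ennreal" and y
  proof -
    have "(\<integral>\<^sup>+x. f (x + y) \<partial>N) = (\<integral>\<^sup>+x. f (T (x + inv T y)) \<partial>lborel)"
      unfolding N_def by (subst nn_integral_distr) (simp_all add: fun_cong[OF Tinv])
    also have "\<dots> = (\<integral>\<^sup>+x. f (T x) \<partial>distr lborel borel (\<lambda>x. inv T y + x))"
      by (subst nn_integral_distr) (simp_all add: add.commute)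
    also have "\<dots> = (\<integral>\<^sup>+x. f x \<partial>N)"
      unfolding lborel_distr_plus N_def by (subst nn_integral_distr) simp_all
    finally show ?thesis .
  qed
  have transl_lborel: "(\<integral>\<^sup>+x. f (x + y) \<partial>lborel) = (\<integral>\<^sup>+x. f x \<partial>lborel)"
    if [measurable]: "f \<in> borel_measurable borel" for f :: "'a \<Rightarrow> ennreal" and y
  proof -
    have "(\<integral>\<^sup>+x. f x \<partial>lborel) = (\<integral>\<^sup>+x. f x \<partial>distr lborel borel (\<lambda>x. y + x))"
      by (simp add: lborel_distr_plus)
    also have "\<dots> = (\<integral>\<^sup>+x. f (x + y) \<partial>lborel)"
      by (subst nn_integral_distr) (simp_all add: add.commute)
    finally show ?thesis ..
  qed
  have ballT: "T -` ball 0 r = ball 0 r" for r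
    by (auto simp: orthogonal_transformation_norm[OF T])
  have Nball: "emeasure N (ball 0 r) = emeasure lborel (ball (0::'a) r)" for r
    unfolding N_def by (subst emeasure_distr) (simp_all add: ballT)
  have fin: "emeasure lborel (ball (0::'a) r) \<noteq> top" for r
    using emeasure_bounded_finite[OF bounded_ball, of "0::'a" r] by simp
  have "sigma_finite_measure N"
  proof
    have "(\<Union>k. ball (0::'a) (real k)) = UNIV"
      by (auto simp: reals_Archimedean2)
    with fin
    show "\<exists>A. countable A \<and> A \<subseteq> sets N \<and> \<Union>A = space N \<and> (\<forall>a\<in>A. emeasure N a \<noteq> \<infinity>)"
      by (intro exI[of _ "range (\<lambda>k. ball (0::'a) (real k))"])
        (auto simp: Nball)
  qed
  then interpret N: sigma_finite_measure N .
  interpret P: pair_sigma_finite N lborel ..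
  define B where "B = ball (0::'a) 1"
  have [measurable]: "B \<in> sets borel" by (simp add: B_def)
  have B_uminus: "- x \<in> B \<longleftrightarrow> x \<in> B" for x by (simp add: B_def)
  have NB: "emeasure N B = emeasure lborel B" by (simp add: B_def Nball)
  have "emeasure N A = emeasure lborel A" if [measurable]: "A \<in> sets borel" for A
  proof -
    have "emeasure N A * emeasure lborel B
        = (\<integral>\<^sup>+x. indicator A x * (\<integral>\<^sup>+y. indicator B y \<partial>lborel) \<partial>N)"
      by (simp add: nn_integral_multc)
    also have "\<dots> = (\<integral>\<^sup>+x. (\<integral>\<^sup>+y. indicator A x * indicator B (y - x) \<partial>lborel) \<partial>N)"
    proof (rule nn_integral_cong)
      fix x :: 'a
      have [simp]: "(\<lambda>y. indicator B (y - x) :: ennreal) \<in> borel_measurable borel" by measurable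
      have h: "(\<integral>\<^sup>+y. indicator B (y - x) \<partial>lborel) = (\<integral>\<^sup>+y. indicator B y \<partial>lborel)"
        using transl_lborel[of "indicator B" "- x", OF borel_measurable_indicator] by simp
      then show "indicator A x * (\<integral>\<^sup>+y. indicator B y \<partial>lborel)
          = (\<integral>\<^sup>+y. indicator A x * indicator B (y - x) \<partial>lborel)"
        unfolding h[symmetric] by (subst nn_integral_cmult) simp_all
    qed
    also have "\<dots> = (\<integral>\<^sup>+y. (\<integral>\<^sup>+x. indicator A x * indicator B (y - x) \<partial>N) \<partial>lborel)"
      by (rule P.Fubini'[symmetric]) measurable
    also have "\<dots> = (\<integral>\<^sup>+y. (\<integral>\<^sup>+x. indicator A (x + y) * indicator B x \<partial>N) \<partial>lborel)"
    proof (rule nn_integral_cong)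
      fix y :: 'a
      show "(\<integral>\<^sup>+x. indicator A x * indicator B (y - x) \<partial>N)
          = (\<integral>\<^sup>+x. indicator A (x + y) * indicator B x \<partial>N)"
        by (subst transl[of "\<lambda>x. indicator A x * indicator B (y - x)" y, symmetric])
          (auto intro!: nn_integral_cong simp: indicator_def B_uminus)
    qed
    also have "\<dots> = (\<integral>\<^sup>+x. (\<integral>\<^sup>+y. indicator A (x + y) * indicator B x \<partial>lborel) \<partial>N)"
      by (rule P.Fubini') measurable
    also have "\<dots> = (\<integral>\<^sup>+x. emeasure lborel A * indicator B x \<partial>N)"
    proof (rule nn_integral_cong)
      fix x :: 'a
      have [simp]: "(\<lambda>y. indicator A (x + y) :: ennreal) \<in> borel_measurable borel" by measurable
      have h: "(\<integral>\<^sup>+y. indicator A (x + y) \<partial>lborel) = (\<integral>\<^sup>+y. indicator A y \<partial>lborel)"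
        using transl_lborel[of "indicator A" x, OF borel_measurable_indicator] by (simp add: add.commute)
      then show "(\<integral>\<^sup>+y. indicator A (x + y) * indicator B x \<partial>lborel) = emeasure lborel A * indicator B x"
        using h by (subst nn_integral_multc) simp_all
    qed
    also have "\<dots> = emeasure lborel A * emeasure lborel B"
      by (simp add: nn_integral_cmult NB)
    finally have "emeasure N A * emeasure lborel B = emeasure lborel A * emeasure lborel B" .
    moreover have "emeasure lborel B \<noteq> 0"
      using content_ball_pos[of 1 "0::'a"] by (auto simp: B_def measure_def)
    moreover have "emeasure lborel B \<noteq> top" by (simp add: B_def fin)
    ultimately show ?thesis by (metis mult_divide_eq_ennreal)
  qed
  then show ?thesis
    by (intro measure_eqI) (auto simp: N_def)
qed

lemma std_gaussian_orthogonal_invariant: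
  fixes T :: "'a::euclidean_space \<Rightarrow> 'a"
  assumes T: "orthogonal_transformation T"
  shows "distr std_gaussian borel T = std_gaussian"
proof -
  have [measurable]: "T \<in> borel_measurable borel"
    using orthogonal_transformation_linear[OF T]
    by (intro borel_measurable_continuous_onI linear_continuous_on linear_conv_bounded_linear[THEN iffD1])
  let ?g = "\<lambda>x::'a. ennreal (\<Prod>b\<in>Basis. std_normal_density (x \<bullet> b))"
  have g: "?g (T x) = ?g x" for x
    unfolding std_gaussian_density_norm orthogonal_transformation_norm[OF T] ..
  have "std_gaussian = density (distr lborel borel T) ?g"
    by (simp add: std_gaussian_def lborel_distr_orthogonal[OF T])
  also have "\<dots> = distr (density lborel (\<lambda>x. ?g (T x))) borel T"
    by (rule density_distr) measurable
  finally show ?thesis by (simp add: g std_gaussian_def)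
qed

lemma measurable_closest_point:
  fixes L :: "'a::euclidean_space set"
  assumes "subspace L"
  shows "closest_point L \<in> borel_measurable borel"
  using assms subspace_0[OF assms]
  by (intro borel_measurable_continuous_onI continuous_on_closest_point)
    (auto simp: subspace_imp_convex closed_subspace)

lemma measurable_sgn_closest_point:
  fixes L :: "'a::euclidean_space set"
  assumes "subspace L"
  shows "(\<lambda>x. sgn (closest_point L x)) \<in> borel_measurable borel"
proof -
  note [measurable] = measurable_closest_point[OF assms]
  show ?thesis unfolding sgn_div_norm by measurable
qed

lemma prob_space_uniform_sphere:
  assumes "subspace L"
  shows "prob_space (uniform_sphere L)"
  unfolding uniform_sphere_def using measurable_sgn_closest_point[OF assms]
  by (intro prob_space.prob_space_distr prob_space_std_gaussian) simp

lemma closest_point_subspace_orthogonal: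
  fixes L :: "'a::euclidean_space set"
  assumes "subspace L" "y \<in> L"
  shows "(x - closest_point L x) \<bullet> y = 0"
proof -
  have L: "convex L" "closed L" "L \<noteq> {}"
    using assms by (auto simp: subspace_imp_convex closed_subspace)
  let ?p = "closest_point L x"
  have p: "?p \<in> L" by (rule closest_point_in_set[OF L(2,3)])
  have "(x - ?p) \<bullet> ((?p + y) - ?p) \<le> 0" "(x - ?p) \<bullet> ((?p - y) - ?p) \<le> 0"
    using assms p by (intro closest_point_dot[OF L(1,2)] subspace_add subspace_diff; simp)+
  then show ?thesis by simp
qed

lemma emeasure_uniform_sphere:
  fixes L :: "'a::euclidean_space set"
  assumes L: "subspace L" "L \<noteq> {0}"
  shows "emeasure (uniform_sphere L) (L \<inter> sphere 0 1) = 1"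
proof -
  interpret prob_space "uniform_sphere L" by (rule prob_space_uniform_sphere[OF L(1)])
  have cl: "closed L" "L \<noteq> {}" using L subspace_0[OF L(1)] by (auto simp: closed_subspace)
  obtain a where a: "a \<in> L" "a \<noteq> 0" using L subspace_0 by blast
  have meas: "(\<lambda>x. sgn (closest_point L x)) \<in> std_gaussian \<rightarrow>\<^sub>M borel"
    using measurable_sgn_closest_point[OF L(1)] by simp
  have "{x. a \<bullet> x = 0} \<in> null_sets lborel"
    using negligible_hyperplane[of a 0] a
    by (simp add: negligible_iff_null_sets null_sets_completion_iff closed_hyperplane borel_closed)
  then have "AE x in lborel. a \<bullet> x \<noteq> 0"
    by (rule AE_I'[of _ _ ]) auto
  moreover have "a \<bullet> x = 0" if "closest_point L x = 0" for x
    using closest_point_subspace_orthogonal[OF L(1) a(1), of x] that by (simp add: inner_commute)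
  ultimately have ne: "AE x in lborel. closest_point L x \<noteq> 0"
    by (auto elim!: eventually_mono)
  have on: "sgn (closest_point L x) \<in> L \<inter> sphere 0 1" if "closest_point L x \<noteq> 0" for x
    using closest_point_in_set[OF cl] that
    by (simp add: norm_sgn) (simp add: sgn_div_norm subspace_scale[OF L(1)])
  have "AE x in std_gaussian. sgn (closest_point L x) \<in> L \<inter> sphere 0 1"
    unfolding std_gaussian_def
    by (subst AE_density, measurable) (use ne on in \<open>auto elim!: eventually_mono\<close>)
  then have "AE x in uniform_sphere L. x \<in> L \<inter> sphere 0 1"
    unfolding uniform_sphere_def using cl
    by (subst AE_distr_iff[OF meas]) (auto simp: borel_closed closed_Int)
  then show ?thesis
    using cl by (intro emeasure_eq_1_AE) (auto simp: uniform_sphere_def borel_closed closed_Int)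
qed

lemma uniform_sphere_orthogonal_invariant:
  fixes L :: "'a::euclidean_space set"
  assumes L: "subspace L" and T: "orthogonal_transformation T" "T ` L = L"
  shows "distr (uniform_sphere L) borel T = uniform_sphere L"
proof -
  have lin: "linear T" using T by (simp add: orthogonal_transformation_linear)
  have [measurable]: "T \<in> borel_measurable borel"
    using lin by (intro borel_measurable_continuous_onI linear_continuous_on linear_conv_bounded_linear[THEN iffD1])
  note [measurable] = measurable_sgn_closest_point[OF L]
  have cl: "convex L" "closed L" "L \<noteq> {}"
    using L subspace_0[OF L] by (auto simp: subspace_imp_convex closed_subspace)
  have cp: "T (closest_point L x) = closest_point L (T x)" for x
  proof (rule closest_point_unique[OF cl(1,2)])
    show "T (closest_point L x) \<in> L" using closest_point_in_set[OF cl(2,3)] T(2) by blast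
    show "\<forall>z\<in>L. dist (T x) (T (closest_point L x)) \<le> dist (T x) z"
    proof
      fix z assume "z \<in> L"
      then obtain w where "w \<in> L" "z = T w" using T(2) by blast
      then show "dist (T x) (T (closest_point L x)) \<le> dist (T x) z"
        using closest_point_le[OF cl(2), of w x] T(1)
        by (simp add: orthogonal_transformation_isometry)
    qed
  qed
  have "T (sgn (closest_point L x)) = sgn (closest_point L (T x))" for x
    unfolding sgn_div_norm cp[symmetric] orthogonal_transformation_norm[OF T(1)]
    by (simp add: linear_scale[OF lin])
  then have "distr (uniform_sphere L) borel T
      = distr (distr std_gaussian borel T) borel (\<lambda>x. sgn (closest_point L x))"
    unfolding uniform_sphere_def by (subst (1 2) distr_distr) (auto simp: comp_def)
  then show ?thesis
    by (simp add: std_gaussian_orthogonal_invariant[OF T(1)] uniform_sphere_def)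
qed

end

theory Submission
  imports Defs "HOL-Combinatorics.Multiset_Permutations"
begin

text \<open>
  The solid angle of a face is the probability that a standard Gaussian direction \<open>g\<close> lies in its
  tangent cone. By exchangeability the expected angle sum is the average of the angle sums over
  all orders of the steps, and for steps in general position this average is deterministic: for
  almost every fixed \<open>g\<close>, the number of pairs consisting of an order and a \<open>j\<close>-face whose tangent
  cone contains \<open>g\<close> is \<open>j!\<close> times the alternating sum
  (\<open>generic_steps.sum_permutations_face_angle_sum\<close>). General position holds almost surely
  (\<open>generic_steps_of_independence\<close>).

  To count these pairs, add the step \<open>x\<^sub>0 = - (x\<^sub>1 + \<dots> + x\<^sub>n)\<close>, which closes the walk. An order of the
  steps becomes a cyclic word on \<open>{0..n}\<close>, and the \<open>j + 1\<close> vertices of a face cut it into \<open>j + 1\<close>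
  words. By Abel summation the tangent cone consists of the combinations of the steps whose
  coefficients are antitone along each of these words (\<open>generic_steps.tcone_path\<close>), so it depends
  only on the set of words, here called a word system. Every word system arises from \<open>j!\<close> pairs
  of an order and a set of vertices (\<open>sum_cuts_of_permutations\<close>).

  It remains to count the word systems that come from a face and whose cone contains \<open>g\<close>. The
  count is done modulo a subspace \<open>K\<close> of codimension \<open>c\<close>, by induction on \<open>c\<close>
  (\<open>step_system.card_faces_containing\<close>). Follow a line with direction \<open>g2 = - g\<close> through a generic
  point \<open>g1\<close>, and call a word system an exit if the line meets its cone and leaves it for good. An
  exit is either a face modulo \<open>K\<close> whose cone contains \<open>g\<close>, or a face modulo \<open>K + \<real> g2\<close> whose
  cone modulo that larger space contains \<open>g1\<close> (\<open>exit_step.exits_iff\<close>). The number of exits is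
  \<open>[n + 1, c] {c, j + 1}\<close> (\<open>exit_step.card_exits\<close>): the point at which the line leaves the cone is
  a combination whose coefficients have \<open>c\<close> distinct values, and their level sets partition the
  steps into \<open>c\<close> blocks. The functional that supports the cone there vanishes on the block sums
  and is negative on the proper prefixes of the word on each block. By the cycle lemma, exactly
  \<open>(|B| - 1)!\<close> orders of a block \<open>B\<close> have this property, which yields the Stirling number of the
  first kind; the \<open>c\<close> words are then grouped and concatenated into \<open>j + 1\<close> words, which yields the
  one of the second kind. Subtracting the counts for successive \<open>c\<close> gives the alternating sum.

  The integral is taken over all walks, including a null set of degenerate ones. For its
  measurability, faces, tangent cones and angles are therefore described for arbitrary finite
  families of points, by conditions that involve only countably many coefficients
  (\<open>tcone_approximation\<close>).
\<close>

section \<open>Set partitions and Stirling numbers\<close>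

definition partitions :: "'a set \<Rightarrow> nat \<Rightarrow> 'a set set set" where
  "partitions A k = {P. partition_on A P \<and> card P = k}"

lemma finite_partitions: "finite A \<Longrightarrow> finite (partitions A k)"
  unfolding partitions_def using finitely_many_partition_on[of A] by (rule rev_finite_subset) auto

lemma partition_on_insert_singleton:
  assumes "a \<notin> A" "partition_on A P"
  shows "partition_on (insert a A) (insert {a} P)"
  using assms by (auto simp: partition_on_def disjoint_def pairwise_insert)

lemma partition_on_insert_into_block:
  assumes "a \<notin> A" "partition_on A P" "B \<in> P"
  shows "partition_on (insert a A) (insert (insert a B) (P - {B}))"
proof -
  have B: "B \<subseteq> A" "\<Union>P = A" using assms by (auto simp: partition_on_def)
  have P: "partition_on (A - B) (P - {B})"
    using assms partition_on_insert[of B "P - {B}" A]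
    by (auto simp: partition_on_def insert_absorb disjoint_def disjnt_def)
  have "insert a A - insert a B = A - B" using assms(1) B by auto
  moreover have "disjnt (insert a B) (\<Union> (P - {B}))"
    using P B assms(1) by (auto simp: partition_on_def disjnt_def)
  ultimately show ?thesis
    using partition_on_insert[of "insert a B" "P - {B}" "insert a A"] P B by auto
qed

text \<open>A new element either forms a block of its own or joins a block of a partition of the old
  elements. Stated for arbitrary summands, this one identity gives the recursions for both kinds
  of Stirling numbers.\<close>

lemma sum_partitions_insert:
  fixes f :: "'a set set \<Rightarrow> 'b::comm_monoid_add"
  assumes A: "finite A" "a \<notin> A"
  shows "(\<Sum>Q\<in>partitions (insert a A) (Suc k). f Q) =
    (\<Sum>P\<in>partitions A k. f (insert {a} P))
    + (\<Sum>P\<in>partitions A (Suc k). \<Sum>B\<in>P. f (insert (insert a B) (P - {B})))"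
proof -
  define X where "X = insert {a} ` partitions A k"
  define S where "S = Sigma (partitions A (Suc k)) (\<lambda>P. P)"
  define g where "g = (\<lambda>(P, B). insert (insert a B) (P - {B :: 'a set}))"
  have fin: "finite P" if "P \<in> partitions A m" for P m
    using that A finite_elements by (auto simp: partitions_def)
  have nin: "a \<notin> B" if "B \<in> P" "P \<in> partitions A m" for P B m
    using that A by (auto simp: partitions_def partition_on_def)
  have nin': "{a} \<notin> P" "insert a B \<notin> P" if "P \<in> partitions A m" for P B m
    using nin[OF _ that] by (metis singletonI, metis insertI1)
  have eq: "partitions (insert a A) (Suc k) = X \<union> g ` S"
  proof (intro equalityI subsetI)
    fix Q assume Q: "Q \<in> partitions (insert a A) (Suc k)"
    have Qp: "partition_on (insert a A) Q" "card Q = Suc k" using Q by (auto simp: partitions_def)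
    have Qf: "finite Q" using Qp card.infinite by fastforce
    obtain C where C: "C \<in> Q" "a \<in> C" using Qp by (auto simp: partition_on_def)
    have dj: "disjnt C (\<Union>(Q - {C}))"
      using Qp C by (auto simp: partition_on_def disjoint_def disjnt_def)
    have rest: "partition_on (insert a A - C) (Q - {C})" and CA: "C \<subseteq> insert a A"
      using partition_on_insert[OF dj, of "insert a A"] Qp C by (auto simp: insert_absorb)
    show "Q \<in> X \<union> g ` S"
    proof (cases "C = {a}")
      case True
      then have "Q - {C} \<in> partitions A k"
        using rest A Qp Qf C by (auto simp: partitions_def)
      moreover have "Q = insert {a} (Q - {C})" using C True by auto
      ultimately show ?thesis unfolding X_def by blast
    next
      case False
      define B where "B = C - {a}"
      have B: "B \<noteq> {}" "insert a B = C" "a \<notin> B" "B \<subseteq> A" using False C CA by (auto simp: B_def)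
      have dj2: "disjnt B (\<Union>(Q - {C}))" using dj B by (auto simp: disjnt_def)
      have "insert a A - C = A - B" using B A by auto
      then have P: "partition_on A (insert B (Q - {C}))"
        using partition_on_insert[OF dj2, of A] rest B by auto
      have "B \<notin> Q - {C}" using dj2 B(1) by (auto simp: disjnt_def)
      then have "insert B (Q - {C}) \<in> partitions A (Suc k)"
        using P Qp Qf C by (auto simp: partitions_def card_insert_if)
      moreover have "Q = g (insert B (Q - {C}), B)"
        using C B \<open>B \<notin> Q - {C}\<close> by (auto simp: g_def)
      ultimately show ?thesis by (auto simp: S_def)
    qed
  next
    fix Q assume "Q \<in> X \<union> g ` S"
    then show "Q \<in> partitions (insert a A) (Suc k)"
    proof
      assume "Q \<in> X"
      then obtain P where P: "P \<in> partitions A k" "Q = insert {a} P" by (auto simp: X_def)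
      moreover have "{a} \<notin> P" using nin' P by blast
      ultimately show ?thesis
        using partition_on_insert_singleton[OF A(2), of P] fin[OF P(1)] by (auto simp: partitions_def)
    next
      assume "Q \<in> g ` S"
      then obtain P B where P: "P \<in> partitions A (Suc k)" "B \<in> P" "Q = insert (insert a B) (P - {B})"
        by (auto simp: S_def g_def)
      moreover have "insert a B \<notin> P - {B}" using nin' P(1) by blast
      ultimately show ?thesis
        using partition_on_insert_into_block[OF A(2), of P] fin[OF P(1)] by (auto simp: partitions_def)
    qed
  qed
  have injX: "inj_on (insert {a}) (partitions A k)"
  proof (rule inj_onI)
    fix P Q assume "P \<in> partitions A k" "Q \<in> partitions A k" "insert {a} P = insert {a} Q"
    moreover from this have "{a} \<notin> P" "{a} \<notin> Q" using nin' by blast+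
    ultimately show "P = Q" by (metis insert_ident)
  qed
  have injg: "inj_on g S"
  proof (rule inj_onI)
    fix p q assume pq: "p \<in> S" "q \<in> S" "g p = g q"
    obtain P B where p: "p = (P, B)" "P \<in> partitions A (Suc k)" "B \<in> P" using pq by (auto simp: S_def)
    obtain Q C where q: "q = (Q, C)" "Q \<in> partitions A (Suc k)" "C \<in> Q" using pq by (auto simp: S_def)
    have e: "insert (insert a B) (P - {B}) = insert (insert a C) (Q - {C})" using pq p q by (simp add: g_def)
    have aB: "a \<notin> D" if "D \<in> P \<or> D \<in> Q" for D using nin[of D] p(2) q(2) that by blast
    have "insert a B \<in> insert (insert a C) (Q - {C})" using e by blast
    then have "insert a B = insert a C" using aB by blast
    then have BC: "B = C" using aB[of B] aB[of C] p(3) q(3) by (metis insert_ident)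
    have "insert a B \<notin> P - {B}" "insert a B \<notin> Q - {C}" using aB by auto
    then have "P - {B} = Q - {C}" using e BC by (metis insert_ident)
    then show "p = q" using p q BC by (auto)
  qed
  have disj: "X \<inter> g ` S = {}"
  proof (rule ccontr)
    assume "X \<inter> g ` S \<noteq> {}"
    then obtain P Q B where *: "P \<in> partitions A k" "Q \<in> partitions A (Suc k)" "B \<in> Q"
      "insert {a} P = insert (insert a B) (Q - {B})" by (auto simp: X_def S_def g_def)
    have "{a} \<in> insert (insert a B) (Q - {B})" using *(4) by blast
    moreover have "{a} \<notin> Q" using nin' *(2) by blast
    ultimately have "{a} = insert a B" by blast
    then have "B = {}" using nin[OF *(3,2)] by blast
    then show False using *(2,3) by (auto simp: partitions_def partition_on_def)
  qed
  have finS: "finite S" unfolding S_def using A fin finite_partitions by (intro finite_SigmaI) auto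
  have "(\<Sum>Q\<in>partitions (insert a A) (Suc k). f Q) = sum f X + sum f (g ` S)"
    unfolding eq using disj finS finite_partitions[OF A(1), of k] by (intro sum.union_disjoint) (auto simp: X_def)
  also have "sum f X = (\<Sum>P\<in>partitions A k. f (insert {a} P))"
    unfolding X_def by (subst sum.reindex[OF injX]) simp
  also have "sum f (g ` S) = (\<Sum>(P, B)\<in>S. f (insert (insert a B) (P - {B})))"
    by (subst sum.reindex[OF injg]) (auto simp: g_def intro!: sum.cong)
  also have "\<dots> = (\<Sum>P\<in>partitions A (Suc k). \<Sum>B\<in>P. f (insert (insert a B) (P - {B})))"
    unfolding S_def using fin finite_partitions[OF A(1), of "Suc k"] by (subst sum.Sigma) auto
  finally show ?thesis .
qed

lemma partitions_empty_set: "partitions {} k = (if k = 0 then {{}} else {})"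
  by (auto simp: partitions_def partition_on_empty)

lemma partitions_0: "A \<noteq> {} \<Longrightarrow> finite A \<Longrightarrow> partitions A 0 = {}"
  by (auto simp: partitions_def partition_on_def dest!: finite_UnionD)

lemma card_partitions:
  assumes "finite A"
  shows "card (partitions A k) = Stirling (card A) k"
  using assms
proof (induction A arbitrary: k rule: finite_induct)
  case empty
  then show ?case by (cases k) (auto simp: partitions_empty_set)
next
  case (insert a A)
  show ?case
  proof (cases k)
    case 0
    then show ?thesis using insert by (simp add: partitions_0)
  next
    case (Suc k')
    have "card (partitions (insert a A) (Suc k')) = (\<Sum>Q\<in>partitions (insert a A) (Suc k'). 1)" by simp
    also have "\<dots> = card (partitions A k') + (\<Sum>P\<in>partitions A (Suc k'). card P)"
      by (subst sum_partitions_insert[OF insert(1,2)]) simp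
    also have "(\<Sum>P\<in>partitions A (Suc k'). card P) = (\<Sum>P\<in>partitions A (Suc k'). Suc k')"
      by (rule sum.cong) (auto simp: partitions_def)
    finally show ?thesis using insert Suc by simp
  qed
qed

text \<open>The weight \<open>(|B| - 1)!\<close> counts the cyclic orders of the block \<open>B\<close>, so the sum counts permutations
  by their cycles. In the recursion a new element can enter a cycle of length \<open>m\<close> at \<open>m\<close> places,
  which is the quotient of the weights \<open>m!\<close> and \<open>(m - 1)!\<close>; the sum of these factors over the
  blocks is the number of old elements.\<close>

lemma sum_partitions_prod_fact:
  assumes "finite A"
  shows "(\<Sum>P\<in>partitions A k. \<Prod>B\<in>P. fact (card B - 1)) = stirling (card A) k"
  using assms
proof (induction A arbitrary: k rule: finite_induct)
  case empty
  then show ?case by (cases k) (auto simp: partitions_empty_set)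
next
  case (insert a A)
  let ?f = "\<lambda>P. \<Prod>B\<in>P. fact (card B - 1) :: nat"
  show ?case
  proof (cases k)
    case 0
    then show ?thesis using insert by (simp add: partitions_0)
  next
    case (Suc k')
    have fin: "finite P" "a \<notin> \<Union>P" "\<And>B. B \<in> P \<Longrightarrow> finite B \<and> B \<noteq> {}" if "P \<in> partitions A m" for P m
    proof -
      have P: "partition_on A P" using that by (simp add: partitions_def)
      show "finite P" using P insert(1) by (rule finite_elements[rotated])
      show "a \<notin> \<Union>P" using P insert(2) by (simp add: partition_on_def)
      fix B assume "B \<in> P"
      then show "finite B \<and> B \<noteq> {}"
        using P insert(1) by (metis Sup_upper finite_subset partition_onD1 partition_onD3)
    qed
    have 1: "?f (insert {a} P) = ?f P" if "P \<in> partitions A k'" for P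
    proof -
      have "{a} \<notin> P" using fin(2)[OF that] by auto
      then show ?thesis using fin(1)[OF that] by simp
    qed
    have 2: "?f (insert (insert a B) (P - {B})) = card B * ?f P" if "P \<in> partitions A (Suc k')" "B \<in> P" for P B
    proof -
      have B: "finite B" "a \<notin> B" "insert a B \<notin> P - {B}" "card B > 0"
        using fin(2,3)[OF that(1)] that by (auto simp: card_gt_0_iff)
      have "?f (insert (insert a B) (P - {B})) = fact (card B) * ?f (P - {B})"
        using B fin(1)[OF that(1)] by simp
      also have "fact (card B) = card B * (fact (card B - 1) :: nat)"
        using B(4) by (simp add: fact_reduce)
      also have "\<dots> * ?f (P - {B}) = card B * ?f P"
        using prod.remove[OF fin(1)[OF that(1)] that(2), of "\<lambda>B. fact (card B - 1) :: nat"] by simp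
      finally show ?thesis .
    qed
    have 3: "(\<Sum>B\<in>P. card B) = card A" if "P \<in> partitions A m" for P m
      using that insert(1) product_partition[of A P] fin(3)[OF that] by (auto simp: partitions_def)
    have "(\<Sum>P\<in>partitions (insert a A) (Suc k'). ?f P) =
      (\<Sum>P\<in>partitions A k'. ?f P) + (\<Sum>P\<in>partitions A (Suc k'). \<Sum>B\<in>P. card B * ?f P)"
      by (simp only: sum_partitions_insert[OF insert(1,2)] 1 2 cong: sum.cong)
    also have "(\<Sum>P\<in>partitions A (Suc k'). \<Sum>B\<in>P. card B * ?f P) = (\<Sum>P\<in>partitions A (Suc k'). card A * ?f P)"
      by (rule sum.cong[OF refl]) (simp add: sum_distrib_right[symmetric] 3)
    finally show ?thesis using insert Suc by (simp add: sum_distrib_left[symmetric])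
  qed
qed

section \<open>Cycle lemma\<close>

text \<open>A word of total weight \<open>0\<close> is a closed path of partial sums, a bridge; it is good if the path
  stays strictly below its endpoints.\<close>

definition good_word :: "('e \<Rightarrow> real) \<Rightarrow> 'e list \<Rightarrow> bool" where
  "good_word r w \<longleftrightarrow> (\<forall>k. 0 < k \<and> k < length w \<longrightarrow> sum_list (map r (take k w)) < 0)"

lemma rotate_back: "rotate (length w * i - i) (rotate i w) = w"
proof (cases "length w = 0")
  case False
  then have "length w * i - i + i = length w * i" by (cases "length w") auto
  then show ?thesis by (simp add: rotate_rotate)
qed simp

lemma rotate_bij_permutations_of_set: "bij_betw (rotate i) (permutations_of_set B) (permutations_of_set B)"
proof (rule bij_betwI')
  show "(rotate i v = rotate i w) = (v = w)" for v w :: "'a list"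
  proof
    assume "rotate i v = rotate i w"
    moreover from this have "length v = length w" by (metis length_rotate)
    ultimately show "v = w" by (metis rotate_back)
  qed simp
  show "rotate i w \<in> permutations_of_set B" if "w \<in> permutations_of_set B" for w
    using that by (auto simp: permutations_of_set_def)
  show "\<exists>v\<in>permutations_of_set B. w = rotate i v" if "w \<in> permutations_of_set B" for w
  proof (rule bexI)
    show "w = rotate i (rotate (length w * i - i) w)"
      using rotate_back[of w i] by (simp add: rotate_rotate add.commute)
    show "rotate (length w * i - i) w \<in> permutations_of_set B"
      using that by (auto simp: permutations_of_set_def)
  qed
qed

text \<open>Rotating a closed path moves its starting point, so the rotated path lies below its endpoints
  exactly if the new starting point is the strict maximum of the old path.\<close>

lemma good_word_rotate_iff:
  fixes r :: "'e \<Rightarrow> real"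
  assumes i: "i < length w" and tot: "sum_list (map r w) = 0"
  defines "p \<equiv> \<lambda>k. sum_list (map r (take k w))"
  shows "good_word r (rotate i w) \<longleftrightarrow> (\<forall>l<length w. l \<noteq> i \<longrightarrow> p l < p i)"
proof -
  define m where "m = length w"
  have rot: "rotate i w = drop i w @ take i w" using i by (simp add: rotate_drop_take)
  have split: "p i + sum_list (map r (take k (drop i w))) = p (i + k)" for k
    unfolding p_def by (simp add: take_add)
  have pm: "p m = 0" by (simp add: p_def m_def tot)
  have tk: "sum_list (map r (take k (rotate i w))) = (if k < m - i then p (i + k) else p (k - (m - i))) - p i"
    if "k < m" for k
  proof (cases "k < m - i")
    case True
    then have "take k (rotate i w) = take k (drop i w)" by (simp add: rot m_def)
    then show ?thesis using split[of k] True by simp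
  next
    case False
    then have "take k (rotate i w) = drop i w @ take (k - (m - i)) w"
      using that i by (auto simp: rot m_def min_def)
    moreover have "p i + sum_list (map r (drop i w)) = p m"
      using split[of "m - i"] i by (simp add: m_def)
    ultimately show ?thesis using False pm by (simp add: p_def)
  qed
  show ?thesis
  proof
    assume g: "good_word r (rotate i w)"
    show "\<forall>l<length w. l \<noteq> i \<longrightarrow> p l < p i"
    proof (intro allI impI)
      fix l assume l: "l < length w" "l \<noteq> i"
      define k where "k = (if i < l then l - i else l + (m - i))"
      have "0 < k" "k < m" using l i by (auto simp: k_def m_def)
      then have "sum_list (map r (take k (rotate i w))) < 0"
        using g by (auto simp: good_word_def m_def)
      then show "p l < p i" using tk[OF \<open>k < m\<close>] l i by (auto simp: k_def m_def split: if_splits)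
    qed
  next
    assume mx: "\<forall>l<length w. l \<noteq> i \<longrightarrow> p l < p i"
    show "good_word r (rotate i w)" unfolding good_word_def
    proof (intro allI impI)
      fix k assume k: "0 < k \<and> k < length (rotate i w)"
      then have km: "k < m" by (simp add: m_def)
      show "sum_list (map r (take k (rotate i w))) < 0"
        unfolding tk[OF km] using mx k i by (auto simp: m_def)
    qed
  qed
qed

text \<open>If no proper part of \<open>B\<close> has weight \<open>0\<close>, the partial sums of an order of \<open>B\<close> are distinct and
  exactly one of its \<open>|B|\<close> rotations starts at the maximum. Summing over all orders and all
  rotations gives \<open>|B|\<close> times the number of good orders on the one hand and \<open>|B|!\<close> on the other.\<close>

lemma cycle_lemma:
  fixes r :: "'e \<Rightarrow> real"
  assumes B: "finite B" "B \<noteq> {}" and tot: "sum r B = 0"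
    and ne: "\<And>A. A \<subset> B \<Longrightarrow> A \<noteq> {} \<Longrightarrow> sum r A \<noteq> 0"
  shows "card {w \<in> permutations_of_set B. good_word r w} = fact (card B - 1)"
proof -
  define m where "m = card B"
  have m: "m > 0" using B by (simp add: m_def card_gt_0_iff)
  let ?P = "permutations_of_set B"
  \<comment> \<open>exactly one rotation of each order is good\<close>
  have uniq: "card {i. i < m \<and> good_word r (rotate i w)} = 1" if w: "w \<in> ?P" for w
  proof -
    have len: "length w = m" and sw: "set w = B" and dw: "distinct w"
      using w by (auto simp: permutations_of_set_def m_def distinct_card)
    have tot': "sum_list (map r w) = 0" using sw dw tot by (simp add: sum_list_distinct_conv_sum_set)
    define p where "p k = sum_list (map r (take k w))" for k
    have pne: "p i \<noteq> p j" if ij: "i < j" "j < m" for i j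
    proof -
      let ?v = "take (j - i) (drop i w)"
      have "p j = p i + sum_list (map r ?v)"
        using ij take_add[of i "j - i" w] by (simp add: p_def)
      moreover have "sum_list (map r ?v) = sum r (set ?v)"
        using dw by (simp add: sum_list_distinct_conv_sum_set)
      moreover have "set ?v \<subset> B"
      proof -
        have "card (set ?v) = length ?v" using dw by (intro distinct_card) simp
        also have "\<dots> < card B" using ij len by (auto simp: m_def)
        finally have "set ?v \<noteq> B" by auto
        moreover have "set ?v \<subseteq> B" using sw by (meson in_set_dropD in_set_takeD subsetI)
        ultimately show ?thesis by blast
      qed
      moreover have "set ?v \<noteq> {}" using ij len by auto
      ultimately show ?thesis using ne[of "set ?v"] by auto
    qed
    have inj: "inj_on p {..<m}"
      by (rule inj_onI) (metis lessThan_iff linorder_neqE_nat pne)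
    have iff: "good_word r (rotate i w) \<longleftrightarrow> (\<forall>l<m. l \<noteq> i \<longrightarrow> p l < p i)" if "i < m" for i
      using good_word_rotate_iff[of i w r] that len tot' by (simp add: p_def)
    have fne: "finite (p ` {..<m})" "p ` {..<m} \<noteq> {}" using m by auto
    obtain i where i: "i < m" "p i = Max (p ` {..<m})" using Max_in[OF fne] by auto
    have mx: "p l < p i" if "l < m" "l \<noteq> i" for l
    proof -
      have "p l \<le> p i" using that i fne by simp
      moreover have "p l \<noteq> p i" using inj that i(1) by (auto dest: inj_onD)
      ultimately show ?thesis by simp
    qed
    have "{i. i < m \<and> good_word r (rotate i w)} = {i}"
      using iff mx i(1) by (auto) (metis less_asym)
    then show ?thesis by simp
  qed
  have "m * card {w \<in> ?P. good_word r w} = (\<Sum>i<m. card {w \<in> ?P. good_word r (rotate i w)})"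
  proof -
    have "card {w \<in> ?P. good_word r (rotate i w)} = card {w \<in> ?P. good_word r w}" for i
    proof -
      have "(\<Sum>w\<in>?P. of_bool (good_word r (rotate i w))) = (\<Sum>w\<in>?P. of_bool (good_word r w) :: nat)"
        by (rule sum.reindex_bij_betw[OF rotate_bij_permutations_of_set])
      then show ?thesis by (simp add: sum.If_cases Int_def of_bool_def)
    qed
    then show ?thesis by simp
  qed
  also have "\<dots> = (\<Sum>i<m. \<Sum>w\<in>?P. of_bool (good_word r (rotate i w)))"
    by (simp add: of_bool_def sum.If_cases Int_def)
  also have "\<dots> = (\<Sum>w\<in>?P. \<Sum>i<m. of_bool (good_word r (rotate i w)))"
    by (rule sum.swap)
  also have "\<dots> = (\<Sum>w\<in>?P. 1)"
    using uniq by (intro sum.cong refl) (simp add: of_bool_def sum.If_cases Int_def lessThan_def)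
  also have "\<dots> = fact m" using B by (simp add: m_def)
  also have "\<dots> = m * fact (m - 1)" using m by (simp add: fact_reduce)
  finally show ?thesis using m by (simp add: m_def)
qed

section \<open>Closed systems of steps in general position\<close>

lemma constant_onI: "(\<And>e. e \<in> B \<Longrightarrow> f e = t) \<Longrightarrow> f constant_on B"
  by (auto simp: constant_on_def)

lemma constant_onD: "f constant_on B \<Longrightarrow> e \<in> B \<Longrightarrow> e' \<in> B \<Longrightarrow> f e = f e'"
  by (auto simp: constant_on_def)

lemma constant_on_const [simp]: "(\<lambda>_. t) constant_on B"
  by (auto simp: constant_on_def)

lemma constant_on_add: "f constant_on B \<Longrightarrow> g constant_on B \<Longrightarrow> (\<lambda>e. f e + g e :: real) constant_on B"
  and constant_on_diff: "f constant_on B \<Longrightarrow> g constant_on B \<Longrightarrow> (\<lambda>e. f e - g e :: real) constant_on B"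
  and constant_on_scale: "f constant_on B \<Longrightarrow> (\<lambda>e. t * f e :: real) constant_on B"
  by (auto simp: constant_on_def)

lemma constant_on_indicator_partition:
  assumes "disjoint P" "B \<in> P" "C \<in> P"
  shows "indicat_real B constant_on C"
proof (cases "C = B")
  case True
  then show ?thesis by (intro constant_onI[of _ _ 1]) auto
next
  case False
  then show ?thesis using assms by (intro constant_onI[of _ _ 0]) (auto simp: disjoint_def indicator_def)
qed

text \<open>Because the steps sum to \<open>0\<close>, a combination of them does not change if a constant is added to
  all coefficients. Only differences of coefficients matter.\<close>

locale step_system =
  fixes E :: "'e set" and x :: "'e \<Rightarrow> 'a::euclidean_space"
  assumes finE: "finite E" and neE: "E \<noteq> {}" and sum_steps: "sum x E = 0"
begin

definition comb :: "('e \<Rightarrow> real) \<Rightarrow> 'a" where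
  "comb a = (\<Sum>e\<in>E. a e *\<^sub>R x e)"

lemma comb_add: "comb (\<lambda>e. a e + b e) = comb a + comb b"
  by (simp add: comb_def scaleR_add_left sum.distrib)

lemma comb_diff: "comb (\<lambda>e. a e - b e) = comb a - comb b"
  by (simp add: comb_def scaleR_diff_left sum_subtractf)

lemma comb_scale: "comb (\<lambda>e. t * a e) = t *\<^sub>R comb a"
  by (simp add: comb_def scaleR_sum_right)

lemma comb_const: "(\<And>e. e \<in> E \<Longrightarrow> a e = t) \<Longrightarrow> comb a = 0"
  using sum_steps by (simp add: comb_def flip: scaleR_sum_right)

lemma comb_indicator: "A \<subseteq> E \<Longrightarrow> comb (indicat_real A) = sum x A"
  unfolding comb_def using finE
  by (simp add: indicator_def of_bool_def if_distrib[of "\<lambda>t. t *\<^sub>R _"] sum.If_cases Int_absorb1 cong: if_cong)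

text \<open>General position modulo a subspace \<open>K\<close> of codimension \<open>c\<close>. A combination with coefficients in at
  most \<open>c + 1\<close> classes is a combination of at most \<open>c + 1\<close> block sums, which satisfy the relation
  that their total is \<open>0\<close>; the condition says that this is their only relation modulo \<open>K\<close>. It
  survives the passage to a quotient by a generic direction, which allows the induction on \<open>c\<close>.\<close>

definition generic :: "'a set \<Rightarrow> nat \<Rightarrow> bool" where
  "generic K c \<longleftrightarrow> subspace K \<and> dim K + c = DIM('a) \<and>
    (\<forall>a. card (a ` E) \<le> Suc c \<longrightarrow> comb a \<in> K \<longrightarrow> (a constant_on E))"

text \<open>The span, modulo \<open>K\<close>, of the sums of the blocks of \<open>P\<close>.\<close>

definition flat :: "'a set \<Rightarrow> 'e set set \<Rightarrow> 'a set" where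
  "flat K P = {v. \<exists>a. (\<forall>B\<in>P. a constant_on B) \<and> v - comb a \<in> K}"

lemma genericD:
  assumes "generic K c"
  shows "subspace K" "dim K + c = DIM('a)"
    "card (a ` E) \<le> Suc c \<Longrightarrow> comb a \<in> K \<Longrightarrow> a constant_on E"
  using assms unfolding generic_def by blast+

lemma card_image_blocks:
  assumes "finite P" "E \<subseteq> \<Union>P" "\<forall>B\<in>P. a constant_on B"
  shows "card (a ` E) \<le> card P"
proof -
  obtain t where t: "\<forall>B\<in>P. \<forall>e\<in>B. a e = t B" using assms(3) unfolding constant_on_def by metis
  have "a ` E \<subseteq> t ` P" using assms(2) t by blast
  then have "card (a ` E) \<le> card (t ` P)" using assms(1) by (intro card_mono) auto
  also have "\<dots> \<le> card P" by (rule card_image_le[OF assms(1)])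
  finally show ?thesis .
qed

lemma subspace_flat:
  assumes K: "subspace K"
  shows "subspace (flat K P)"
proof (rule subspaceI)
  show "0 \<in> flat K P"
    unfolding flat_def using subspace_0[OF K] comb_const[of "\<lambda>_. 0" 0] by (auto intro!: exI[of _ "\<lambda>_. 0"])
next
  fix v w assume "v \<in> flat K P" "w \<in> flat K P"
  then obtain a b where ab: "\<forall>B\<in>P. a constant_on B" "v - comb a \<in> K"
      "\<forall>B\<in>P. b constant_on B" "w - comb b \<in> K"
    unfolding flat_def by blast
  have "(v + w) - comb (\<lambda>e. a e + b e) \<in> K"
    using subspace_add[OF K ab(2,4)] by (simp add: comb_add algebra_simps)
  moreover have "\<forall>B\<in>P. (\<lambda>e. a e + b e) constant_on B" using ab(1,3) by (auto intro: constant_on_add)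
  ultimately show "v + w \<in> flat K P" unfolding flat_def by blast
next
  fix r v assume "v \<in> flat K P"
  then obtain a where a: "\<forall>B\<in>P. a constant_on B" "v - comb a \<in> K" unfolding flat_def by blast
  have "r *\<^sub>R v - comb (\<lambda>e. r * a e) \<in> K"
    using subspace_scale[OF K a(2), of r] by (simp add: comb_scale algebra_simps)
  moreover have "\<forall>B\<in>P. (\<lambda>e. r * a e) constant_on B" using a(1) by (auto intro: constant_on_scale)
  ultimately show "r *\<^sub>R v \<in> flat K P" unfolding flat_def by blast
qed

lemma subset_flat: "K \<subseteq> flat K P"
  unfolding flat_def using comb_const[of "\<lambda>_. 0" 0] by (auto intro!: exI[of _ "\<lambda>_. 0"])

lemma block_in_flat:
  assumes P: "partition_on E P" and "subspace K" "B \<in> P"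
  shows "sum x B \<in> flat K P"
proof -
  have "B \<subseteq> E" using P assms(3) by (auto simp: partition_on_def)
  moreover have "indicat_real B constant_on C" if "C \<in> P" for C
    using P assms(3) that by (intro constant_on_indicator_partition) (auto simp: partition_on_def)
  ultimately show ?thesis
    unfolding flat_def using subspace_0[OF assms(2)]
    by (auto intro!: exI[of _ "indicat_real B"] simp: comb_indicator)
qed

text \<open>If the sum of a new block depended on the old ones, then subtracting this combination from the
  indicator of the block would give coefficients with few values whose combination lies in \<open>K\<close>.
  By genericity they are constant. But the block and the rest of the uncovered part differ in the
  indicator, while the old combination has the same coefficient on both.\<close>

lemma dim_blocks:
  assumes gen: "generic K c"
    and Q: "finite Q" "disjoint Q" "{} \<notin> Q" "\<Union>Q \<subset> E" "card Q \<le> c"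
  shows "dim (K \<union> sum x ` Q) = dim K + card Q"
  using Q
proof (induction Q rule: finite_induct)
  case empty
  then show ?case by simp
next
  case (insert B Q)
  note K = genericD[OF gen]
  have IH: "dim (K \<union> sum x ` Q) = dim K + card Q"
    using insert by (intro insert.IH) (auto simp: pairwise_insert)
  have BE: "B \<subseteq> E" "B \<noteq> {}" using insert(5,6) by auto
  have dj: "B \<inter> C = {}" if "C \<in> Q" for C
    using insert(2,4) that by (auto simp: disjoint_def)
  define R where "R = E - \<Union>Q"
  have P0: "partition_on E (insert R Q)"
  proof -
    have "disjnt R (\<Union>Q)" "E - R = \<Union>Q" "R \<noteq> {}" using insert(6) by (auto simp: R_def disjnt_def)
    moreover have "partition_on (\<Union>Q) Q" using insert(4,5) by (auto simp: partition_on_def pairwise_insert)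
    ultimately show ?thesis using partition_on_insert[of R Q E] by (auto simp: R_def)
  qed
  have span_S: "span (K \<union> sum x ` Q) \<subseteq> flat K (insert R Q)"
    using subset_flat block_in_flat[OF P0 K(1)] by (intro span_minimal subspace_flat K(1)) auto
  have "sum x B \<notin> span (K \<union> sum x ` Q)"
  proof
    assume "sum x B \<in> span (K \<union> sum x ` Q)"
    then obtain a where a: "\<forall>C\<in>insert R Q. a constant_on C" "sum x B - comb a \<in> K"
      using span_S unfolding flat_def by blast
    define b where "b e = indicat_real B e - a e" for e
    have "comb b \<in> K" unfolding b_def using a(2) BE by (simp add: comb_diff comb_indicator)
    moreover have "card (b ` E) \<le> Suc c"
    proof -
      let ?P = "insert (R - B) (insert B Q)"
      have ind: "indicat_real B constant_on C" if "C \<in> ?P" for C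
      proof (cases "C = B")
        case True
        then show ?thesis by (intro constant_onI[of _ _ 1]) simp
      next
        case False
        then show ?thesis using that dj by (intro constant_onI[of _ _ 0]) (auto simp: indicator_def)
      qed
      have BR: "B \<subseteq> R" using BE dj by (auto simp: R_def)
      have "a constant_on C" if "C \<in> ?P" for C
        using that a(1) BR by (auto intro: constant_on_subset[of a R])
      then have "\<forall>C\<in>?P. b constant_on C" unfolding b_def using ind by (auto intro: constant_on_diff)
      then have "card (b ` E) \<le> card ?P" using insert(1) by (intro card_image_blocks) (auto simp: R_def)
      also have "\<dots> \<le> Suc (card (insert B Q))" using insert(1) by (simp add: card_insert_if)
      finally show ?thesis using insert(7) by simp
    qed
    ultimately have b: "b constant_on E" using K(3)[of b] by blast
    obtain e0 where e0: "e0 \<in> R" "e0 \<notin> B" using insert(6) by (auto simp: R_def)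
    obtain f where f: "f \<in> B" using BE by blast
    have "a e0 = a f" using a(1) e0 f BE dj by (intro constant_onD[of a R]) (auto simp: R_def)
    moreover have "b e0 = b f" using b e0 f BE by (intro constant_onD[of b E]) (auto simp: R_def)
    ultimately show False using e0 f by (simp add: b_def indicator_def)
  qed
  then have "dim (K \<union> sum x ` insert B Q) = dim (K \<union> sum x ` Q) + 1"
    by (simp add: dim_insert)
  then show ?case using IH insert(1,2) by simp
qed

lemma flat_eq_span:
  assumes P: "partition_on E P" and K: "subspace K" and B0: "B0 \<in> P"
  shows "flat K P = span (K \<union> sum x ` (P - {B0}))"
proof
  show "span (K \<union> sum x ` (P - {B0})) \<subseteq> flat K P"
    using subset_flat block_in_flat[OF P K] by (intro span_minimal subspace_flat K) auto
  show "flat K P \<subseteq> span (K \<union> sum x ` (P - {B0}))"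
  proof
    fix v assume "v \<in> flat K P"
    then obtain a where a: "\<forall>B\<in>P. a constant_on B" "v - comb a \<in> K" unfolding flat_def by blast
    obtain t where t: "\<forall>B\<in>P. \<forall>e\<in>B. a e = t B" using a(1) unfolding constant_on_def by metis
    have finP: "finite P" using finE P by (rule finite_elements)
    have fB: "finite B" if "B \<in> P" for B
      using that P finE by (metis Sup_upper finite_subset partition_onD1)
    have blocks: "sum f E = (\<Sum>B\<in>P. sum f B)" for f :: "'e \<Rightarrow> 'a"
      using sum.Union_disjoint[of P f] fB P by (auto simp: partition_on_def disjoint_def)
    have "comb a = (\<Sum>B\<in>P. \<Sum>e\<in>B. a e *\<^sub>R x e)" unfolding comb_def by (rule blocks)
    also have "\<dots> = (\<Sum>B\<in>P. t B *\<^sub>R sum x B)"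
      using t by (intro sum.cong refl) (simp add: scaleR_sum_right)
    also have "\<dots> = (\<Sum>B\<in>P. (t B - t B0) *\<^sub>R sum x B) + t B0 *\<^sub>R (\<Sum>B\<in>P. sum x B)"
      by (simp add: scaleR_sum_right algebra_simps flip: sum.distrib)
    also have "(\<Sum>B\<in>P. sum x B) = 0" using blocks[of x] sum_steps by simp
    also have "(\<Sum>B\<in>P. (t B - t B0) *\<^sub>R sum x B) = (\<Sum>B\<in>P - {B0}. (t B - t B0) *\<^sub>R sum x B)"
      using finP B0 by (simp add: sum.remove)
    finally have "comb a = (\<Sum>B\<in>P - {B0}. (t B - t B0) *\<^sub>R sum x B)" by simp
    moreover have "\<dots> \<in> span (K \<union> sum x ` (P - {B0}))"
      by (intro span_sum span_scale span_base) auto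
    ultimately have "comb a \<in> span (K \<union> sum x ` (P - {B0}))" by simp
    moreover have "v - comb a \<in> span (K \<union> sum x ` (P - {B0}))" using a(2) by (intro span_base) simp
    ultimately show "v \<in> span (K \<union> sum x ` (P - {B0}))"
      using span_add by fastforce
  qed
qed

lemma partition_nonempty: "partition_on E P \<Longrightarrow> P \<noteq> {}"
  using neE by (auto simp: partition_on_def)

lemma proper_part_of_partition:
  assumes "partition_on E P" "Q \<subseteq> P - {B0}" "B0 \<in> P"
  shows "finite Q" "disjoint Q" "{} \<notin> Q" "\<Union>Q \<subset> E"
proof -
  show "finite Q" using assms(2) finite_elements[OF finE assms(1)] by (meson finite_Diff finite_subset)
  show "disjoint Q" using assms(1,2) by (auto simp: partition_on_def intro: pairwise_subset)
  show "{} \<notin> Q" using assms(1,2) by (auto simp: partition_on_def)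
  have "\<Union>Q \<subseteq> E" using assms(1,2) by (auto simp: partition_on_def)
  moreover have "B0 \<inter> \<Union>Q = {}" "B0 \<noteq> {}" "B0 \<subseteq> E"
    using assms by (auto simp: partition_on_def disjoint_def)
  ultimately show "\<Union>Q \<subset> E" by blast
qed

text \<open>One block sum is minus the sum of the others; the others are independent modulo \<open>K\<close>.\<close>

lemma dim_flat:
  assumes gen: "generic K c" and P: "partition_on E P" "card P \<le> Suc c"
  shows "Suc (dim (flat K P)) = dim K + card P"
proof -
  obtain B0 where B0: "B0 \<in> P" using partition_nonempty[OF P(1)] by blast
  have finP: "finite P" using finE P(1) by (rule finite_elements)
  have "card (P - {B0}) \<le> c" using P(2) B0 finP by simp
  then have "dim (K \<union> sum x ` (P - {B0})) = dim K + card (P - {B0})"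
    using proper_part_of_partition[OF P(1) order_refl B0] by (intro dim_blocks[OF gen])
  moreover have "card P = Suc (card (P - {B0}))" using B0 finP by (rule card.remove[rotated])
  ultimately show ?thesis using flat_eq_span[OF P(1) genericD(1)[OF gen] B0] by simp
qed

lemma flat_UNIV:
  assumes gen: "generic K c" and P: "partition_on E P" "c < card P"
  shows "flat K P = UNIV"
proof -
  obtain B0 where B0: "B0 \<in> P" using partition_nonempty[OF P(1)] by blast
  have finP: "finite P" using finE P(1) by (rule finite_elements)
  have "c \<le> card (P - {B0})" using P(2) B0 finP by simp
  then obtain Q where Q: "Q \<subseteq> P - {B0}" "card Q = c" by (metis obtain_subset_with_card_n)
  have "dim (K \<union> sum x ` Q) = dim K + card Q"
    using proper_part_of_partition[OF P(1) Q(1) B0] Q(2) by (intro dim_blocks[OF gen]) auto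
  then have "span (K \<union> sum x ` Q) = UNIV" using genericD(2)[OF gen] Q by (simp flip: dim_eq_full)
  moreover have "span (K \<union> sum x ` Q) \<subseteq> flat K P"
    unfolding flat_eq_span[OF P(1) genericD(1)[OF gen] B0] using Q(1) by (intro span_mono) blast
  ultimately show ?thesis by blast
qed

definition levels :: "('e \<Rightarrow> real) \<Rightarrow> 'e set set" where
  "levels a = (\<lambda>t. {e \<in> E. a e = t}) ` (a ` E)"

lemma levels: "partition_on E (levels a)" "card (levels a) = card (a ` E)"
  "B \<in> levels a \<Longrightarrow> a constant_on B"
proof -
  show "partition_on E (levels a)" by (rule partition_onI) (auto simp: levels_def disjnt_def)
  show "card (levels a) = card (a ` E)"
    unfolding levels_def by (rule card_image) (rule inj_onI, blast)
  show "B \<in> levels a \<Longrightarrow> a constant_on B" by (auto simp: levels_def constant_on_def)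
qed

lemma generic_direction_notin:
  assumes gen: "generic K (Suc c)" "generic (span (insert g K)) c"
  shows "g \<notin> K"
proof
  assume "g \<in> K"
  then have "span (insert g K) = K" using genericD(1)[OF gen(1)] by (metis insert_absorb span_eq_iff)
  then show False using genericD(2)[OF gen(1)] genericD(2)[OF gen(2)] by simp
qed

lemma generic_direction_notin_flat:
  assumes gen: "generic K (Suc c)" "generic (span (insert g K)) c"
    and P: "partition_on E P" "card P \<le> Suc c"
  shows "g \<notin> flat K P"
proof
  assume "g \<in> flat K P"
  then obtain a where a: "\<forall>B\<in>P. a constant_on B" "g - comb a \<in> K" unfolding flat_def by blast
  have "comb a \<in> span (insert g K)"
    using span_diff[of g "insert g K" "g - comb a"] a(2) by (auto intro: span_base)
  moreover have "card (a ` E) \<le> Suc c"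
    using card_image_blocks[of P a] a(1) P finite_elements[OF finE P(1)] by (auto simp: partition_on_def)
  ultimately have "a constant_on E" using genericD(3)[OF gen(2)] by blast
  then have "comb a = 0" unfolding constant_on_def using comb_const by blast
  then show False using a(2) generic_direction_notin[OF gen] by simp
qed

text \<open>A combination in \<open>K + \<real> g\<close> with few coefficient values is either in \<open>K\<close> already or shows that
  \<open>g\<close> lies in the flat of the level sets of its coefficients.\<close>

lemma generic_insert:
  assumes gen: "generic K (Suc c)" and g: "\<And>P. partition_on E P \<Longrightarrow> card P \<le> Suc c \<Longrightarrow> g \<notin> flat K P"
  shows "generic (span (insert g K)) c"
  unfolding generic_def
proof (intro conjI allI impI)
  note K = genericD[OF gen]
  show "subspace (span (insert g K))" by (rule subspace_span)
  have "g \<notin> K"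
    using g[of "{E}"] subset_flat[of K "{E}"] partition_on_space[OF neE] by auto
  then have "g \<notin> span K" using K(1) by (metis span_eq_iff)
  then show "dim (span (insert g K)) + c = DIM('a)" using K(2) by (simp add: dim_insert)
  fix a assume a: "card (a ` E) \<le> Suc c" "comb a \<in> span (insert g K)"
  then obtain t where t: "comb a - t *\<^sub>R g \<in> K" using K(1) by (auto simp: span_breakdown_eq)
      (metis span_eq_iff)
  have "t = 0"
  proof (rule ccontr)
    assume nz: "t \<noteq> 0"
    have "(- 1 / t) *\<^sub>R (comb a - t *\<^sub>R g) \<in> K" using t K(1) by (rule subspace_scale[rotated])
    then have "g - comb (\<lambda>e. (1 / t) * a e) \<in> K" using nz unfolding comb_scale by (simp add: algebra_simps)
    then have "g \<in> flat K (levels a)"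
      unfolding flat_def using levels(3)[of _ a] constant_on_scale by blast
    then show False using g[of "levels a"] levels(1,2) a(1) by simp
  qed
  then show "a constant_on E" using t K(3)[of a] a(1) by simp
qed

text \<open>The flats that have to be avoided are finitely many proper subspaces.\<close>

lemma generic_insert_negligible:
  assumes gen: "generic K (Suc c)"
  obtains X where "negligible X" "\<And>g. g \<notin> X \<Longrightarrow> generic (span (insert g K)) c"
proof
  let ?P = "{P. partition_on E P \<and> card P \<le> Suc c}"
  show "negligible (\<Union>(flat K ` ?P))"
  proof (rule negligible_Union)
    show "finite (flat K ` ?P)" using finitely_many_partition_on[OF finE]
      by (intro finite_imageI) (rule finite_subset[rotated], auto)
    fix S assume "S \<in> flat K ` ?P"
    then obtain P where P: "partition_on E P" "card P \<le> Suc c" "S = flat K P" by blast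
    have "Suc (dim S) = dim K + card P" using dim_flat[OF gen P(1)] P by simp
    then have "dim S < DIM('a)" using genericD(2)[OF gen] P(2) by simp
    then show "negligible S" by (rule negligible_lowdim)
  qed
  show "generic (span (insert g K)) c" if "g \<notin> \<Union>(flat K ` ?P)" for g
    using that by (intro generic_insert[OF gen]) blast
qed

lemma functional_zero:
  assumes "subspace H" "span (insert g H) = UNIV" "\<And>v. v \<in> H \<Longrightarrow> \<phi> \<bullet> v = 0" "\<phi> \<bullet> g = 0"
  shows "\<phi> = 0"
proof -
  have "span (insert g H) \<subseteq> {v. \<phi> \<bullet> v = 0}"
    using assms(3,4) by (intro span_minimal subspace_hyperplane) auto
  then have "\<phi> \<in> {v. \<phi> \<bullet> v = 0}" using assms(2) by blast
  then show ?thesis by simp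
qed

text \<open>For \<open>c\<close> blocks the flat is a hyperplane that does not contain \<open>g\<close>; its normal is scaled such
  that \<open>g\<close> lies on the positive side.\<close>

definition normal :: "'a set \<Rightarrow> 'e set set \<Rightarrow> 'a \<Rightarrow> 'a" where
  "normal K P g = (THE \<phi>. (\<forall>v\<in>flat K P. \<phi> \<bullet> v = 0) \<and> \<phi> \<bullet> g = 1)"

lemma span_insert_flat:
  assumes gen: "generic K (Suc c)" and P: "partition_on E P" "card P = Suc c" and g: "g \<notin> flat K P"
  shows "span (insert g (flat K P)) = UNIV"
proof -
  have sp: "span (flat K P) = flat K P" using subspace_flat[OF genericD(1)[OF gen]] by simp
  have "dim (insert g (flat K P)) = DIM('a)"
    using dim_flat[OF gen P(1)] P g genericD(2)[OF gen] by (simp add: dim_insert sp)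
  then show ?thesis by (simp add: dim_eq_full)
qed

lemma normal:
  assumes gen: "generic K (Suc c)" and P: "partition_on E P" "card P = Suc c" and g: "g \<notin> flat K P"
  shows "v \<in> flat K P \<Longrightarrow> normal K P g \<bullet> v = 0" "normal K P g \<bullet> g = 1"
    "normal K P g \<bullet> v = 0 \<Longrightarrow> v \<in> flat K P"
    "(\<And>v. v \<in> flat K P \<Longrightarrow> \<phi> \<bullet> v = 0) \<Longrightarrow> \<phi> \<bullet> g = 1 \<Longrightarrow> \<phi> = normal K P g"
proof -
  let ?H = "flat K P"
  note H = subspace_flat[OF genericD(1)[OF gen], of P]
  note sp = span_insert_flat[OF gen P g]
  have spH: "span ?H = ?H" using H by simp
  obtain y z where yz: "y \<in> span ?H" "\<And>w. w \<in> span ?H \<Longrightarrow> orthogonal z w" "g = y + z"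
    using orthogonal_subspace_decomp_exists[of ?H g] by metis
  have z: "z \<noteq> 0" using yz g spH by auto
  define \<phi> where "\<phi> = (1 / (z \<bullet> z)) *\<^sub>R z"
  have "\<forall>v\<in>?H. \<phi> \<bullet> v = 0" using yz(2) spH by (simp add: \<phi>_def orthogonal_def)
  moreover have "\<phi> \<bullet> g = 1"
    using yz z spH by (simp add: \<phi>_def inner_add_right orthogonal_def)
  ultimately have ex: "(\<forall>v\<in>?H. \<phi> \<bullet> v = 0) \<and> \<phi> \<bullet> g = 1" by blast
  have uniq: "\<psi> = \<psi>'" if "(\<forall>v\<in>?H. \<psi> \<bullet> v = 0) \<and> \<psi> \<bullet> g = 1" "(\<forall>v\<in>?H. \<psi>' \<bullet> v = 0) \<and> \<psi>' \<bullet> g = 1" for \<psi> \<psi>'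
    using functional_zero[OF H sp, of "\<psi> - \<psi>'"] that by (simp add: inner_diff_left)
  have n: "(\<forall>v\<in>?H. normal K P g \<bullet> v = 0) \<and> normal K P g \<bullet> g = 1"
    unfolding normal_def by (rule theI[of _ \<phi>]) (use ex uniq in blast)+
  then show "v \<in> ?H \<Longrightarrow> normal K P g \<bullet> v = 0" "normal K P g \<bullet> g = 1" by blast+
  show "(\<And>v. v \<in> flat K P \<Longrightarrow> \<phi> \<bullet> v = 0) \<Longrightarrow> \<phi> \<bullet> g = 1 \<Longrightarrow> \<phi> = normal K P g" for \<phi>
    using uniq[of \<phi> "normal K P g"] n by blast
  assume v: "normal K P g \<bullet> v = 0"
  have "v \<in> span (insert g ?H)" using sp by simp
  then obtain t where t: "v - t *\<^sub>R g \<in> ?H" using spH by (auto simp: span_breakdown_eq)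
  then have "normal K P g \<bullet> (v - t *\<^sub>R g) = 0" using n by blast
  then have "t = 0" using v n by (simp add: inner_diff_right)
  then show "v \<in> ?H" using t by simp
qed

end

section \<open>Words, antitone functions and cones\<close>

definition antitone_along :: "('e \<Rightarrow> real) \<Rightarrow> 'e list \<Rightarrow> bool" where
  "antitone_along a w \<longleftrightarrow> sorted_wrt (\<lambda>e f. a f \<le> a e) w"

lemma antitone_along_simps [simp]:
  "antitone_along a []" "antitone_along a (e # w) \<longleftrightarrow> (\<forall>f\<in>set w. a f \<le> a e) \<and> antitone_along a w"
  "antitone_along a (v @ w) \<longleftrightarrow> antitone_along a v \<and> antitone_along a w \<and> (\<forall>e\<in>set v. \<forall>f\<in>set w. a f \<le> a e)"
  by (auto simp: antitone_along_def sorted_wrt_append)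

lemma antitone_along_add: "antitone_along a w \<Longrightarrow> antitone_along b w \<Longrightarrow> antitone_along (\<lambda>e. a e + b e) w"
  by (induction w) (auto intro: add_mono)

lemma antitone_along_scale: "antitone_along a w \<Longrightarrow> 0 \<le> t \<Longrightarrow> antitone_along (\<lambda>e. t * a e) w"
  by (induction w) (auto intro: mult_left_mono)

lemma antitone_along_constant: "a constant_on set w \<Longrightarrow> antitone_along a w"
  by (induction w) (auto simp: constant_on_def)

lemma sorted_wrt_concat_iff:
  "sorted_wrt R (concat ws) \<longleftrightarrow> (\<forall>w\<in>set ws. sorted_wrt R w) \<and>
    sorted_wrt (\<lambda>v w. \<forall>e\<in>set v. \<forall>f\<in>set w. R e f) ws"
  by (induction ws) (auto simp: sorted_wrt_append)

text \<open>Abel summation writes the weighted sum as a combination of prefix sums whose coefficients are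
  the successive decrements of \<open>b\<close>. The set \<open>S\<close> is kept abstract because the result is used for
  convex cones of vectors and for the half-line of nonpositive reals.\<close>

lemma abel_summation:
  fixes y :: "'e \<Rightarrow> 'a::real_vector"
  assumes S: "0 \<in> S" "\<And>v w. v \<in> S \<Longrightarrow> w \<in> S \<Longrightarrow> v + w \<in> S" "\<And>v t. v \<in> S \<Longrightarrow> 0 \<le> t \<Longrightarrow> t *\<^sub>R v \<in> S"
    and "\<And>k. k \<le> length w \<Longrightarrow> sum_list (map y (take k w)) \<in> S"
    and "antitone_along b w" "\<And>e. e \<in> set w \<Longrightarrow> 0 \<le> b e"
  shows "sum_list (map (\<lambda>e. b e *\<^sub>R y e) w) \<in> S"
  using assms(4-6)
proof (induction w arbitrary: b rule: rev_induct)
  case Nil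
  then show ?case using S(1) by simp
next
  case (snoc f w)
  have "sum_list (map y (take k w)) \<in> S" if "k \<le> length w" for k using snoc.prems(1)[of k] that by simp
  moreover have "antitone_along (\<lambda>e. b e - b f) w"
    using snoc.prems(2) antitone_along_add[of b w "\<lambda>_. - b f"] by (simp add: antitone_along_constant)
  ultimately have "sum_list (map (\<lambda>e. (b e - b f) *\<^sub>R y e) w) \<in> S"
    using snoc.prems(2) by (intro snoc.IH) auto
  moreover have "b f *\<^sub>R sum_list (map y (w @ [f])) \<in> S"
    using snoc.prems(1)[of "Suc (length w)"] snoc.prems(3)[of f] by (intro S(3)) auto
  moreover have "sum_list (map (\<lambda>e. b e *\<^sub>R y e) (w @ [f])) =
      sum_list (map (\<lambda>e. (b e - b f) *\<^sub>R y e) w) + b f *\<^sub>R sum_list (map y (w @ [f]))"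
    by (induction w) (auto simp: algebra_simps)
  ultimately show ?case using S(2) by metis
qed

text \<open>Subtracting the last value makes an antitone weight nonnegative.\<close>

lemma abel_shift:
  fixes y :: "'e \<Rightarrow> 'a::real_vector"
  shows "sum_list (map (\<lambda>e. b e *\<^sub>R y e) w) =
    sum_list (map (\<lambda>e. (b e - t) *\<^sub>R y e) w) + t *\<^sub>R sum_list (map y w)"
  by (induction w) (auto simp: algebra_simps)

text \<open>Each decrement of \<open>b\<close> multiplies a strictly negative prefix sum, so equality in
  \<open>abel_summation\<close> forces all decrements to vanish.\<close>

lemma abel_equality:
  fixes r :: "'e \<Rightarrow> real"
  assumes "\<And>k. 0 < k \<Longrightarrow> k \<le> length w \<Longrightarrow> sum_list (map r (take k w)) < 0"
    and "antitone_along b w" "\<And>e. e \<in> set w \<Longrightarrow> 0 \<le> b e"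
    and "0 \<le> sum_list (map (\<lambda>e. b e *\<^sub>R r e) w)" "e \<in> set w"
  shows "b e = 0"
  using assms
proof (induction w arbitrary: b e rule: rev_induct)
  case Nil
  then show ?case by simp
next
  case (snoc f w)
  have pre: "sum_list (map r (take k w)) < 0" if "0 < k" "k \<le> length w" for k
    using snoc.prems(1)[of k] that by simp
  have nn: "0 \<le> b e - b f" if "e \<in> set w" for e
    using snoc.prems(2) that by simp
  have anti: "antitone_along (\<lambda>e. b e - b f) w"
    using snoc.prems(2) antitone_along_add[of b w "\<lambda>_. - b f"] by (simp add: antitone_along_constant)
  have "sum_list (map (\<lambda>e. (b e - b f) *\<^sub>R r e) w) \<in> {..0}"
  proof (rule abel_summation[OF _ _ _ _ anti nn])
    show "sum_list (map r (take k w)) \<in> {..0}" if "k \<le> length w" for k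
      using pre[of k] that by (cases "k = 0") auto
  qed (auto simp: mult_nonneg_nonpos)
  moreover have tot: "sum_list (map r (w @ [f])) < 0" using snoc.prems(1)[of "Suc (length w)"] by simp
  moreover have "sum_list (map (\<lambda>e. b e *\<^sub>R r e) (w @ [f])) =
      sum_list (map (\<lambda>e. (b e - b f) *\<^sub>R r e) w) + b f * sum_list (map r (w @ [f]))"
    using abel_shift[of b r "w @ [f]" "b f"] by simp
  moreover have "b f * sum_list (map r (w @ [f])) \<le> 0"
    using snoc.prems(3)[of f] tot by (intro mult_nonneg_nonpos) auto
  ultimately have z: "b f * sum_list (map r (w @ [f])) = 0" "sum_list (map (\<lambda>e. (b e - b f) *\<^sub>R r e) w) = 0"
    using snoc.prems(4) unfolding atMost_iff by linarith+
  have bf: "b f = 0" using z(1) tot by simp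
  show ?case
  proof (cases "e \<in> set w")
    case True
    then have "b e - b f = 0" using z(2) pre anti nn by (intro snoc.IH[of "\<lambda>e. b e - b f"]) auto
    then show ?thesis using bf by simp
  next
    case False
    then show ?thesis using snoc.prems(5) bf by simp
  qed
qed

text \<open>The analytic meaning of a good word: summation against it is nonpositive on antitone weights,
  and vanishes on the constant ones only.\<close>

lemma good_word_abel:
  assumes good: "good_word r w" and tot: "sum_list (map r w) = 0" and anti: "antitone_along b w"
  shows "sum_list (map (\<lambda>e. b e *\<^sub>R r e) w) \<le> 0"
    and "0 \<le> sum_list (map (\<lambda>e. b e *\<^sub>R r e) w) \<Longrightarrow> b constant_on set w"
proof -
  have "sum_list (map (\<lambda>e. b e *\<^sub>R r e) w) \<le> 0 \<and>
    (0 \<le> sum_list (map (\<lambda>e. b e *\<^sub>R r e) w) \<longrightarrow> b constant_on set w)"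
  proof (cases w rule: rev_cases)
    case Nil
    then show ?thesis by (simp add: constant_on_def)
  next
    case (snoc v f)
    have pre: "sum_list (map r (take k v)) < 0" if "0 < k" "k \<le> length v" for k
      using good that unfolding good_word_def snoc by (auto dest!: spec[of _ k])
    have anti': "antitone_along (\<lambda>e. b e - b f) v"
      using anti antitone_along_add[of b v "\<lambda>_. - b f"] by (simp add: antitone_along_constant snoc)
    have nn: "0 \<le> b e - b f" if "e \<in> set v" for e using anti that by (simp add: snoc)
    have eq: "sum_list (map (\<lambda>e. b e *\<^sub>R r e) w) = sum_list (map (\<lambda>e. (b e - b f) *\<^sub>R r e) v)"
      unfolding abel_shift[of b r w "b f"] tot by (simp add: snoc)
    have "sum_list (map (\<lambda>e. (b e - b f) *\<^sub>R r e) v) \<in> {..0}"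
    proof (rule abel_summation[OF _ _ _ _ anti' nn])
      show "sum_list (map r (take k v)) \<in> {..0}" if "k \<le> length v" for k
        using pre[of k] that by (cases "k = 0") auto
    qed (auto simp: mult_nonneg_nonpos)
    moreover have "b constant_on set w" if "0 \<le> sum_list (map (\<lambda>e. b e *\<^sub>R r e) w)"
    proof (rule constant_onI)
      fix e assume "e \<in> set w"
      then show "b e = b f"
        using abel_equality[of v r "\<lambda>e. b e - b f" e] pre anti' nn that eq by (auto simp: snoc)
    qed
    ultimately show ?thesis using eq by simp
  qed
  then show "sum_list (map (\<lambda>e. b e *\<^sub>R r e) w) \<le> 0"
    "0 \<le> sum_list (map (\<lambda>e. b e *\<^sub>R r e) w) \<Longrightarrow> b constant_on set w" by blast+
qed

text \<open>A set of \<open>k\<close> words that uses every letter exactly once. The words themselves carry no order.\<close>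

definition word_systems :: "'e set \<Rightarrow> nat \<Rightarrow> 'e list set set" where
  "word_systems E k =
    {U. partition_on E (set ` U) \<and> inj_on set U \<and> (\<forall>u\<in>U. distinct u) \<and> card U = k}"

lemma word_systemsD:
  assumes "U \<in> word_systems E k"
  shows "partition_on E (set ` U)" "inj_on set U" "u \<in> U \<Longrightarrow> distinct u" "card U = k"
    "card (set ` U) = k" "u \<in> U \<Longrightarrow> set u \<subseteq> E" "u \<in> U \<Longrightarrow> u \<noteq> []"
    "u \<in> U \<Longrightarrow> v \<in> U \<Longrightarrow> e \<in> set u \<Longrightarrow> e \<in> set v \<Longrightarrow> u = v"
    "e \<in> E \<Longrightarrow> \<exists>u\<in>U. e \<in> set u"
proof -
  show P: "partition_on E (set ` U)" and I: "inj_on set U" and "u \<in> U \<Longrightarrow> distinct u" and C: "card U = k"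
    using assms by (auto simp: word_systems_def)
  show "card (set ` U) = k" using I C by (simp add: card_image)
  show "u \<in> U \<Longrightarrow> set u \<subseteq> E" "u \<in> U \<Longrightarrow> u \<noteq> []" "e \<in> E \<Longrightarrow> \<exists>u\<in>U. e \<in> set u"
    using P by (auto simp: partition_on_def)
  show "u \<in> U \<Longrightarrow> v \<in> U \<Longrightarrow> e \<in> set u \<Longrightarrow> e \<in> set v \<Longrightarrow> u = v"
  proof -
    assume uv: "u \<in> U" "v \<in> U" "e \<in> set u" "e \<in> set v"
    have "disjoint (set ` U)" using P by (simp add: partition_on_def)
    then have "set u = set v" using uv by (auto simp: disjoint_def)
    then show "u = v" using I uv by (auto dest: inj_onD)
  qed
qed

lemma finite_word_systems:
  assumes "finite E"
  shows "finite (word_systems E k)"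
proof -
  have "word_systems E k \<subseteq> Pow {u. set u \<subseteq> E \<and> length u \<le> card E}"
  proof (intro subsetI PowI CollectI)
    fix U u assume U: "U \<in> word_systems E k" "u \<in> U"
    have "length u = card (set u)" using word_systemsD(3)[OF U] by (simp add: distinct_card)
    also have "\<dots> \<le> card E" using word_systemsD(6)[OF U] assms by (rule card_mono[rotated])
    finally show "set u \<subseteq> E \<and> length u \<le> card E" using word_systemsD(6)[OF U] by simp
  qed
  then show ?thesis using finite_lists_length_le[OF assms] by (meson finite_Pow_iff finite_subset)
qed

lemma finite_word_system:
  assumes "finite E" "U \<in> word_systems E k"
  shows "finite U"
proof -
  have "finite (set ` U)" using word_systemsD(1)[OF assms(2)] assms(1) by (rule finite_elements[rotated])
  then show ?thesis using word_systemsD(2)[OF assms(2)] by (rule finite_imageD)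
qed

lemma word_systems_eq:
  assumes "U \<in> word_systems E k" "U' \<in> word_systems E k'" "U \<subseteq> U'"
  shows "U = U'"
proof (rule equalityI[OF assms(3)], rule subsetI)
  fix u assume u: "u \<in> U'"
  then obtain e where e: "e \<in> set u" using word_systemsD(7)[OF assms(2)] by fastforce
  then obtain v where "v \<in> U" "e \<in> set v"
    using word_systemsD(6)[OF assms(2) u] word_systemsD(9)[OF assms(1)] by blast
  then show "u \<in> U" using word_systemsD(8)[OF assms(2) u _ e] assms(3) by blast
qed

text \<open>A word system with given blocks is an independent choice of an order for each block.\<close>

lemma card_word_systems_over:
  assumes E: "finite E" and P: "partition_on E P" "card P = k"
  shows "card {W \<in> word_systems E k. set ` W = P \<and> (\<forall>w\<in>W. Q w)} =
    (\<Prod>B\<in>P. card {w \<in> permutations_of_set B. Q w})"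
proof -
  let ?F = "PiE P (\<lambda>B. {w \<in> permutations_of_set B. Q w})"
  have finP: "finite P" using E P(1) by (rule finite_elements)
  have set_f: "set (f B) = B" if "f \<in> ?F" "B \<in> P" for f B
    using PiE_mem[OF that] by (simp add: permutations_of_set_def)
  have "bij_betw (\<lambda>f. f ` P) ?F {W \<in> word_systems E k. set ` W = P \<and> (\<forall>w\<in>W. Q w)}"
    unfolding bij_betw_def
  proof
    show "inj_on (\<lambda>f. f ` P) ?F"
    proof (rule inj_onI)
      fix f g assume fg: "f \<in> ?F" "g \<in> ?F" "f ` P = g ` P"
      show "f = g"
      proof (rule PiE_ext[OF fg(1,2)])
        fix B assume B: "B \<in> P"
        then obtain C where C: "C \<in> P" "f B = g C" using fg(3) by blast
        then show "f B = g B" using set_f[OF fg(1) B] set_f[OF fg(2) C(1)] by simp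
      qed
    qed
    show "(\<lambda>f. f ` P) ` ?F = {W \<in> word_systems E k. set ` W = P \<and> (\<forall>w\<in>W. Q w)}"
    proof (intro equalityI subsetI)
      fix W assume "W \<in> (\<lambda>f. f ` P) ` ?F"
      then obtain f where f: "f \<in> ?F" "W = f ` P" by blast
      have "set ` W = P" using set_f[OF f(1)] f(2) by (auto simp: image_image)
      moreover have inj: "inj_on f P" by (rule inj_on_inverseI[of _ set]) (rule set_f[OF f(1)])
      moreover have "inj_on set W" unfolding f(2) using set_f[OF f(1)] by (auto intro!: inj_onI)
      moreover have "distinct w \<and> Q w" if "w \<in> W" for w
        using PiE_mem[OF f(1)] f(2) that by (auto simp: permutations_of_set_def)
      ultimately show "W \<in> {W \<in> word_systems E k. set ` W = P \<and> (\<forall>w\<in>W. Q w)}"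
        using P f(2) by (simp add: word_systems_def card_image)
    next
      fix W assume W: "W \<in> {W \<in> word_systems E k. set ` W = P \<and> (\<forall>w\<in>W. Q w)}"
      then have Ws: "W \<in> word_systems E k" by simp
      define f where "f = restrict (inv_into W set) P"
      have fw: "f (set w) = w" if "w \<in> W" for w
        using that W word_systemsD(2)[OF Ws] by (auto simp: f_def)
      have fW: "f ` P = W" using W fw by (force simp: image_iff)
      moreover have "f \<in> ?F"
      proof (rule PiE_I)
        fix B assume "B \<in> P"
        then obtain w where "w \<in> W" "B = set w" using W by blast
        then show "f B \<in> {w \<in> permutations_of_set B. Q w}"
          using fw W word_systemsD(3)[OF Ws] by (auto simp: permutations_of_set_def)
      qed (simp add: f_def)
      ultimately show "W \<in> (\<lambda>f. f ` P) ` ?F" by blast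
    qed
  qed
  then have "card ?F = card {W \<in> word_systems E k. set ` W = P \<and> (\<forall>w\<in>W. Q w)}" by (rule bij_betw_same_card)
  then show ?thesis using finP by (simp add: card_PiE)
qed

context step_system
begin

text \<open>The tangent cone of a face, projected along \<open>K\<close>: the words are the pieces into which the
  vertices of the face cut the cyclic sequence of steps.\<close>

definition cone :: "'a set \<Rightarrow> 'e list set \<Rightarrow> 'a set" where
  "cone K U = {v. \<exists>a. (\<forall>u\<in>U. antitone_along a u) \<and> v - comb a \<in> K}"

text \<open>An antitone combination that vanishes is an affine relation between the vertices at which the
  words are separated and the others, nonnegative on the latter. In general position these
  vertices span a face of the polytope projected along \<open>K\<close> if there is only the trivial one.\<close>

definition is_face :: "'a set \<Rightarrow> 'e list set \<Rightarrow> bool" where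
  "is_face K U \<longleftrightarrow> (\<forall>a. (\<forall>u\<in>U. antitone_along a u) \<longrightarrow> comb a \<in> K \<longrightarrow> a constant_on E)"

lemma coneI: "(\<And>u. u \<in> U \<Longrightarrow> antitone_along a u) \<Longrightarrow> v - comb a \<in> K \<Longrightarrow> v \<in> cone K U"
  unfolding cone_def by blast

lemma cone_add:
  assumes "subspace K" "v \<in> cone K U" "w \<in> cone K U"
  shows "v + w \<in> cone K U"
proof -
  obtain a b where ab: "\<forall>u\<in>U. antitone_along a u" "v - comb a \<in> K" "\<forall>u\<in>U. antitone_along b u" "w - comb b \<in> K"
    using assms(2,3) unfolding cone_def by blast
  show ?thesis
  proof (rule coneI)
    show "antitone_along (\<lambda>e. a e + b e) u" if "u \<in> U" for u using ab that by (auto intro: antitone_along_add)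
    show "v + w - comb (\<lambda>e. a e + b e) \<in> K"
      using subspace_add[OF assms(1) ab(2,4)] by (simp add: comb_add algebra_simps)
  qed
qed

lemma cone_scale:
  assumes "subspace K" "v \<in> cone K U" "0 \<le> t"
  shows "t *\<^sub>R v \<in> cone K U"
proof -
  obtain a where a: "\<forall>u\<in>U. antitone_along a u" "v - comb a \<in> K"
    using assms(2) unfolding cone_def by blast
  show ?thesis
  proof (rule coneI)
    show "antitone_along (\<lambda>e. t * a e) u" if "u \<in> U" for u using a that assms(3) by (auto intro: antitone_along_scale)
    show "t *\<^sub>R v - comb (\<lambda>e. t * a e) \<in> K"
      using subspace_scale[OF assms(1) a(2), of t] by (simp add: comb_scale algebra_simps)
  qed
qed

lemma subspace_subset_cone: "K \<subseteq> cone K U"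
  using comb_const[of "\<lambda>_. 0" 0] by (auto intro!: coneI[of _ "\<lambda>_. 0"] antitone_along_constant)

lemma comb_in_cone:
  assumes "subspace K" "\<And>u. u \<in> U \<Longrightarrow> antitone_along a u"
  shows "comb a \<in> cone K U"
  by (rule coneI[of _ a]) (use assms subspace_0 in auto)

lemma convex_cone_cone:
  assumes K: "subspace K"
  shows "convex_cone (cone K U)"
proof -
  have "0 \<in> cone K U" using subspace_subset_cone subspace_0[OF K] by blast
  then show ?thesis
    using cone_add[OF K] cone_scale[OF K]
    by (auto simp: convex_cone_def conic_def intro!: convexI)
qed

lemma comb_words:
  assumes U: "U \<in> word_systems E k"
  shows "comb a = (\<Sum>u\<in>U. sum_list (map (\<lambda>e. a e *\<^sub>R x e) u))"
proof -
  note W = word_systemsD[OF U]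
  have "comb a = (\<Sum>B\<in>set ` U. \<Sum>e\<in>B. a e *\<^sub>R x e)"
    unfolding comb_def using sum.Union_disjoint[of "set ` U" "\<lambda>e. a e *\<^sub>R x e"] W(1)
    by (auto simp: partition_on_def disjoint_def)
  also have "\<dots> = (\<Sum>u\<in>U. \<Sum>e\<in>set u. a e *\<^sub>R x e)" by (simp add: sum.reindex[OF W(2)])
  also have "\<dots> = (\<Sum>u\<in>U. sum_list (map (\<lambda>e. a e *\<^sub>R x e) u))"
    using W(3) by (intro sum.cong refl) (simp add: sum_list_distinct_conv_sum_set)
  finally show ?thesis .
qed

text \<open>Indicators of prefixes are the extreme antitone functions; together with the constants on
  blocks they generate the cone.\<close>

lemma indicator_prefix_antitone:
  assumes U: "U \<in> word_systems E k" "u \<in> U" "v \<in> U"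
  shows "antitone_along (indicat_real (set (take i u))) v"
proof (cases "u = v")
  case True
  have "distinct (take i u @ drop i u)" using word_systemsD(3)[OF U(1,2)] by simp
  then have "antitone_along (indicat_real (set (take i u))) (take i u @ drop i u)"
    unfolding antitone_along_simps(3)
    using set_take_disj_set_drop_if_distinct[of u i i] word_systemsD(3)[OF U(1,2)]
    by (auto intro!: antitone_along_constant constant_onI[of "set (take i u)" _ 1] constant_onI[of "set (drop i u)" _ 0]
        simp: indicator_def)
  then show ?thesis using True by simp
next
  case False
  then have "set v \<inter> set (take i u) = {}"
    using word_systemsD(8)[OF U] set_take_subset[of i u] by blast
  then show ?thesis by (intro antitone_along_constant constant_onI[of _ _ 0]) (auto simp: indicator_def)
qed

text \<open>The cone is generated by finitely many vectors: a basis of \<open>K\<close> with both signs, the prefix sums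
  of the words, and the negatives of the block sums.\<close>

lemma closed_cone:
  assumes K: "subspace K" and U: "U \<in> word_systems E k"
  shows "closed (cone K U)"
proof -
  note W = word_systemsD[OF U]
  obtain Bs where Bs: "finite Bs" "Bs \<subseteq> K" "span Bs = K"
    using basis_exists[of K] independent_bound K by (metis span_subspace)
  define G where "G = Bs \<union> uminus ` Bs \<union> (\<Union>u\<in>U. (\<lambda>i. sum_list (map x (take i u))) ` {..length u})
    \<union> (\<lambda>u. - sum_list (map x u)) ` U"
  have finG: "finite G" using Bs(1) finite_word_system[OF finE U] by (auto simp: G_def)
  let ?H = "convex_cone hull G"
  have H: "0 \<in> ?H" "\<And>v w. v \<in> ?H \<Longrightarrow> w \<in> ?H \<Longrightarrow> v + w \<in> ?H" "\<And>v t. v \<in> ?H \<Longrightarrow> 0 \<le> t \<Longrightarrow> t *\<^sub>R v \<in> ?H"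
    by (auto simp: convex_cone_hull_contains_0 convex_cone_hull_add convex_cone_hull_mul)
  have "cone K U = ?H"
  proof
    show "?H \<subseteq> cone K U"
    proof (rule hull_minimal)
      have s: "sum_list (map x (take i u)) = comb (indicat_real (set (take i u)))" if "u \<in> U" for u i
        using W(3,6)[OF that] set_take_subset[of i u]
        by (subst comb_indicator) (auto simp: sum_list_distinct_conv_sum_set)
      have "v \<in> cone K U" if v: "v \<in> G" for v
      proof -
        consider "v \<in> Bs \<union> uminus ` Bs" | u i where "u \<in> U" "v = sum_list (map x (take i u))"
          | u where "u \<in> U" "v = - sum_list (map x u)" using v unfolding G_def by blast
        then show ?thesis
        proof cases
          case 1
          then have "v \<in> K" using Bs(2) subspace_neg[OF K] by auto
          then show ?thesis using subspace_subset_cone by blast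
        next
          case 2
          then show ?thesis using s indicator_prefix_antitone[OF U] by (simp add: comb_in_cone[OF K])
        next
          case 3
          have "antitone_along (\<lambda>e. - 1 * indicat_real (set u) e) u'" if "u' \<in> U" for u'
            using constant_on_indicator_partition[of "set ` U" "set u" "set u'"] W(1) 3(1) that
            by (intro antitone_along_constant constant_on_scale) (auto simp: partition_on_def)
          then have "comb (\<lambda>e. - 1 * indicat_real (set u) e) \<in> cone K U" by (rule comb_in_cone[OF K])
          then show ?thesis unfolding comb_scale using s[OF 3(1), of "length u"] 3(2) by simp
        qed
      qed
      then show "G \<subseteq> cone K U" by blast
      show "convex_cone (cone K U)" by (rule convex_cone_cone[OF K])
    qed
    show "cone K U \<subseteq> ?H"
    proof
      fix v assume "v \<in> cone K U"
      then obtain a where a: "\<forall>u\<in>U. antitone_along a u" "v - comb a \<in> K" unfolding cone_def by blast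
      have gen: "g \<in> ?H" if "g \<in> G" for g using that by (rule hull_inc)
      have each: "sum_list (map (\<lambda>e. a e *\<^sub>R x e) u) \<in> ?H" if u: "u \<in> U" for u
      proof -
        let ?t = "a (last u)"
        have ne: "u \<noteq> []" using W(7)[OF u] .
        have pre: "sum_list (map x (take k u)) \<in> ?H" if "k \<le> length u" for k
          using u that by (intro gen) (auto simp: G_def)
        have "antitone_along (\<lambda>e. a e + (- ?t)) u"
          using a(1) u by (intro antitone_along_add) (auto intro: antitone_along_constant)
        then have anti: "antitone_along (\<lambda>e. a e - ?t) u" by simp
        have nn: "0 \<le> a e - ?t" if "e \<in> set u" for e
        proof -
          have "antitone_along a (butlast u @ [last u])" using a(1) u ne by simp
          moreover have "e \<in> set (butlast u) \<or> e = last u"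
            using that ne by (metis append_butlast_last_id in_set_conv_decomp rotate1.simps(2) set_ConsD set_rotate1)
          ultimately show ?thesis by (auto simp del: append_butlast_last_id)
        qed
        have 1: "sum_list (map (\<lambda>e. (a e - ?t) *\<^sub>R x e) u) \<in> ?H"
          by (rule abel_summation[OF H pre anti nn])
        have full: "sum_list (map x u) \<in> ?H" using pre[of "length u"] by simp
        have neg: "- sum_list (map x u) \<in> ?H" using u by (intro gen) (auto simp: G_def)
        have "?t *\<^sub>R sum_list (map x u) \<in> ?H"
        proof (cases "0 \<le> ?t")
          case True
          then show ?thesis using H(3)[OF full] by simp
        next
          case False
          then show ?thesis using H(3)[OF neg, of "- ?t"] by simp
        qed
        then show ?thesis unfolding abel_shift[of a x u ?t] using 1 by (intro H(2))
      qed
      have sums: "sum f A \<in> ?H" if "finite A" "\<And>u. u \<in> A \<Longrightarrow> f u \<in> ?H" for f and A :: "'e list set"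
        using that by (induction A rule: finite_induct) (simp_all add: H(1,2))
      have "comb a \<in> ?H" unfolding comb_words[OF U]
        by (rule sums[OF finite_word_system[OF finE U] each])
      moreover have "K \<subseteq> ?H"
      proof -
        have sp: "y \<in> ?H \<and> - y \<in> ?H" if "y \<in> span Bs" for y
          using that
        proof (induction rule: span_induct_alt)
          case base
          then show ?case using H(1) by simp
        next
          case (step t b y)
          have "b \<in> G" "- b \<in> G" using step(1) by (auto simp: G_def)
          then have b: "b \<in> ?H" "- b \<in> ?H" by (simp_all add: gen)
          have "t *\<^sub>R b \<in> ?H \<and> - (t *\<^sub>R b) \<in> ?H"
          proof (cases "0 \<le> t")
            case True
            then show ?thesis using H(3)[OF b(1)] H(3)[OF b(2)] by (metis scaleR_minus_right)
          next
            case False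
            then have "0 \<le> - t" by simp
            then show ?thesis using H(3)[OF b(1), of "-t"] H(3)[OF b(2), of "-t"] by simp
          qed
          then show ?case using step(2) H(2) by (metis minus_add_distrib)
        qed
        then show ?thesis using Bs(3) by blast
      qed
      ultimately have "(v - comb a) + comb a \<in> ?H" using a(2) by (intro H(2)) auto
      then show "v \<in> ?H" by simp
    qed
  qed
  then show ?thesis using closed_convex_cone_hull[OF finG] by simp
qed

lemma functional_zero_on_subspace:
  assumes "subspace K" "\<And>v. v \<in> cone K U \<Longrightarrow> \<psi> \<bullet> v \<le> 0" "v \<in> K"
  shows "\<psi> \<bullet> v = 0"
proof -
  have "v \<in> cone K U" "- v \<in> cone K U"
    using assms(3) subspace_neg[OF assms(1,3)] subspace_subset_cone by blast+
  then show ?thesis using assms(2)[of v] assms(2)[of "- v"] by simp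
qed

text \<open>A functional bounded above on a cone is nonpositive there, and its bound can be taken to be
  \<open>0\<close>.\<close>

lemma separate_from_cone:
  assumes K: "subspace K" and L: "convex L" "L \<noteq> {}" "cone K U \<inter> L = {}"
  obtains \<psi> where "\<psi> \<noteq> 0" "\<And>v. v \<in> cone K U \<Longrightarrow> \<psi> \<bullet> v \<le> 0" "\<And>v. v \<in> L \<Longrightarrow> 0 \<le> \<psi> \<bullet> v"
proof -
  have zero: "0 \<in> cone K U" using subspace_subset_cone subspace_0[OF K] by blast
  then have ne: "cone K U \<noteq> {}" by blast
  have cc: "convex (cone K U)" using convex_cone_cone[OF K] by (simp add: convex_cone_def)
  obtain \<psi> b where \<psi>: "\<psi> \<noteq> 0" "\<forall>v\<in>cone K U. \<psi> \<bullet> v \<le> b" "\<forall>v\<in>L. b \<le> \<psi> \<bullet> v"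
    using separating_hyperplane_sets[OF cc L(1) ne L(2,3)] by blast
  have b0: "0 \<le> b" using \<psi>(2) zero by force
  have neg: "\<psi> \<bullet> v \<le> 0" if v: "v \<in> cone K U" for v
  proof (rule ccontr)
    assume "\<not> \<psi> \<bullet> v \<le> 0"
    then have pos: "\<psi> \<bullet> v > 0" by simp
    have "((b + 1) / (\<psi> \<bullet> v)) *\<^sub>R v \<in> cone K U" using pos b0 by (intro cone_scale[OF K v]) simp
    then have "((b + 1) / (\<psi> \<bullet> v)) * (\<psi> \<bullet> v) \<le> b" using \<psi>(2) by fastforce
    then show False using pos by simp
  qed
  have pos: "0 \<le> \<psi> \<bullet> v" if "v \<in> L" for v using order_trans[OF b0 bspec[OF \<psi>(3) that]] .
  show ?thesis by (rule that[OF \<psi>(1) neg pos])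
qed

end

section \<open>Merging and splitting words\<close>

text \<open>The function \<open>h\<close> is meant to be constant on each word, with distinct values on the words of
  \<open>G\<close>; its value on a word is read off at the first letter.\<close>

definition decreasing_enum :: "('e \<Rightarrow> real) \<Rightarrow> 'e list set \<Rightarrow> 'e list list" where
  "decreasing_enum h G = (SOME ws. set ws = G \<and> sorted_wrt (\<lambda>v w. h (hd w) < h (hd v)) ws)"

definition merge_words :: "('e \<Rightarrow> real) \<Rightarrow> 'e list set \<Rightarrow> 'e list" where
  "merge_words h G = concat (decreasing_enum h G)"

lemma decreasing_enum:
  assumes "finite G" "inj_on (\<lambda>w. h (hd w)) G"
  shows "set (decreasing_enum h G) = G"
    and "sorted_wrt (\<lambda>v w. h (hd w) < h (hd v)) (decreasing_enum h G)"
proof -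
  interpret folding_insort_key "(\<le>) :: real \<Rightarrow> real \<Rightarrow> bool" "(<)" G "\<lambda>w. - h (hd w)"
    by unfold_locales (use assms(2) in \<open>auto simp: inj_on_def\<close>)
  obtain ws where "sorted_wrt (<) (map (\<lambda>w. - h (hd w)) ws)" "set ws = G"
    using finite_set_strict_sorted[OF order_refl assms(1)] by blast
  then have "set ws = G \<and> sorted_wrt (\<lambda>v w. h (hd w) < h (hd v)) ws" by (simp add: sorted_wrt_map)
  then have "set (decreasing_enum h G) = G \<and> sorted_wrt (\<lambda>v w. h (hd w) < h (hd v)) (decreasing_enum h G)"
    unfolding decreasing_enum_def by (rule someI)
  then show "set (decreasing_enum h G) = G"
    "sorted_wrt (\<lambda>v w. h (hd w) < h (hd v)) (decreasing_enum h G)" by blast+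
qed

lemma strictly_decreasing_unique:
  fixes h :: "'e \<Rightarrow> real"
  assumes "sorted_wrt (\<lambda>v w. h (hd w) < h (hd v)) vs" "sorted_wrt (\<lambda>v w. h (hd w) < h (hd v)) ws"
    and "set vs = set ws"
  shows "vs = ws"
proof -
  let ?f = "\<lambda>w. - h (hd w)"
  have s: "sorted_wrt (<) (map ?f vs)" "sorted_wrt (<) (map ?f ws)"
    using assms(1,2) by (simp_all add: sorted_wrt_map)
  then have m: "map ?f vs = map ?f ws" using assms(3) by (intro strict_sorted_equal) auto
  have "inj_on ?f (set ws)" using s(2) by (simp add: strict_sorted_iff distinct_map)
  then show ?thesis using m assms(3) by (intro map_inj_on[OF m]) simp
qed

lemma decreasing_enum_eq:
  assumes "sorted_wrt (\<lambda>v w. h (hd w) < h (hd v)) ws"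
  shows "decreasing_enum h (set ws) = ws"
  unfolding decreasing_enum_def
  by (rule some_equality) (use assms strictly_decreasing_unique in blast)+

lemma sorted_wrt_weaken:
  "sorted_wrt R ws \<Longrightarrow> (\<And>v w. v \<in> set ws \<Longrightarrow> w \<in> set ws \<Longrightarrow> R v w \<Longrightarrow> Q v w) \<Longrightarrow> sorted_wrt Q ws"
  by (rule sorted_wrt_mono_rel)

lemma hd_constant: "h constant_on set w \<Longrightarrow> e \<in> set w \<Longrightarrow> h e = h (hd w)"
  by (cases w) (auto intro: constant_onD)

lemma merge_antitone:
  assumes "finite G" "inj_on (\<lambda>w. h (hd w)) G" "\<And>w. w \<in> G \<Longrightarrow> h constant_on set w"
  shows "antitone_along h (merge_words h G)"
  unfolding antitone_along_def merge_words_def sorted_wrt_concat_iff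
proof
  note d = decreasing_enum[OF assms(1,2)]
  show "\<forall>w\<in>set (decreasing_enum h G). sorted_wrt (\<lambda>e f. h f \<le> h e) w"
    using assms(3) antitone_along_constant unfolding d(1) antitone_along_def by blast
  show "sorted_wrt (\<lambda>v w. \<forall>e\<in>set v. \<forall>f\<in>set w. h f \<le> h e) (decreasing_enum h G)"
    using d(2) by (rule sorted_wrt_weaken) (use assms(3) d(1) hd_constant in \<open>metis less_imp_le\<close>)
qed

lemma antitone_along_mergeD:
  assumes "finite G" "inj_on (\<lambda>w. h (hd w)) G" "antitone_along b (merge_words h G)" "w \<in> G"
  shows "antitone_along b w"
  using assms(3,4) decreasing_enum(1)[OF assms(1,2)]
  unfolding antitone_along_def merge_words_def sorted_wrt_concat_iff by blast

lemma set_merge: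
  assumes "finite G" "inj_on (\<lambda>w. h (hd w)) G"
  shows "set (merge_words h G) = \<Union>(set ` G)"
  unfolding merge_words_def using decreasing_enum(1)[OF assms] by simp

lemma filter_concat_member:
  assumes "sorted_wrt (\<lambda>v w. set v \<inter> set w = {}) ws" "w \<in> set ws"
  shows "filter (\<lambda>e. e \<in> set w) (concat ws) = w"
  using assms
proof (induction ws)
  case Nil
  then show ?case by simp
next
  case (Cons v ws)
  show ?case
  proof (cases "w = v")
    case True
    have "filter (\<lambda>e. e \<in> set v) (concat ws) = []"
      using Cons.prems by (auto simp: filter_empty_conv)
    then show ?thesis using True by simp
  next
    case False
    then have "filter (\<lambda>e. e \<in> set w) v = []"
      using Cons.prems by (auto simp: filter_empty_conv)
    then show ?thesis using Cons False by simp
  qed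
qed

text \<open>Grouping the words of \<open>W\<close> and concatenating each group in decreasing order of \<open>h\<close> coarsens a
  word system such that \<open>h\<close> is antitone along the longer words. Nothing is lost: the words are
  recovered as the restrictions of the merged words to the blocks of \<open>W\<close>.\<close>

locale merging =
  fixes E :: "'e set" and W :: "'e list set" and k m :: nat and h :: "'e \<Rightarrow> real" and \<G> :: "'e list set set"
  assumes finE': "finite E" and W: "W \<in> word_systems E k" and inj: "inj_on (\<lambda>w. h (hd w)) W"
    and \<G>: "\<G> \<in> partitions W m"
begin

lemma part: "partition_on W \<G>" "card \<G> = m" using \<G> by (auto simp: partitions_def)

lemma group: assumes "G \<in> \<G>" shows "G \<subseteq> W" "finite G" "inj_on (\<lambda>w. h (hd w)) G" "G \<noteq> {}"
proof -
  show s: "G \<subseteq> W" and "G \<noteq> {}" using part(1) assms by (auto simp: partition_on_def)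
  show "finite G" using finite_word_system[OF finE' W] s by (rule rev_finite_subset)
  show "inj_on (\<lambda>w. h (hd w)) G" using inj s by (rule inj_on_subset)
qed

lemma set_merge_group: "G \<in> \<G> \<Longrightarrow> set (merge_words h G) = \<Union>(set ` G)"
  by (rule set_merge[OF group(2,3)])

lemma same_group:
  assumes "G \<in> \<G>" "G' \<in> \<G>" "e \<in> set (merge_words h G)" "e \<in> set (merge_words h G')"
  shows "G = G'"
proof -
  obtain w w' where w: "w \<in> G" "e \<in> set w" "w' \<in> G'" "e \<in> set w'"
    using assms set_merge_group by blast
  then have "w = w'" using group(1)[OF assms(1)] group(1)[OF assms(2)] word_systemsD(8)[OF W] by blast
  then show ?thesis using w part(1) assms(1,2) by (auto simp: partition_on_def disjoint_def)
qed

lemma merge_nonempty: assumes "G \<in> \<G>" shows "set (merge_words h G) \<noteq> {}"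
proof -
  obtain w where "w \<in> G" using group(4)[OF assms] by blast
  then have "w \<noteq> []" "set w \<subseteq> set (merge_words h G)"
    using set_merge_group[OF assms] word_systemsD(7)[OF W] group(1)[OF assms] by auto
  then show ?thesis by auto
qed

lemma pieces_disjoint:
  assumes "G \<in> \<G>"
  shows "sorted_wrt (\<lambda>v w. set v \<inter> set w = {}) (decreasing_enum h G)"
proof -
  note d = decreasing_enum[OF group(2,3)[OF assms]]
  show ?thesis using d(2)
    by (rule sorted_wrt_weaken) (use d(1) group(1)[OF assms] word_systemsD(8)[OF W] in blast)
qed

lemma merged_word_system: "merge_words h ` \<G> \<in> word_systems E m"
proof -
  have inj1: "inj_on (\<lambda>G. set (merge_words h G)) \<G>"
  proof (rule inj_onI)
    fix G G' assume G: "G \<in> \<G>" "G' \<in> \<G>" "set (merge_words h G) = set (merge_words h G')"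
    obtain e where "e \<in> set (merge_words h G)" using merge_nonempty[OF G(1)] by (metis ex_in_conv)
    then show "G = G'" using same_group[OF G(1,2)] G(3) by blast
  qed
  then have inj2: "inj_on (merge_words h) \<G>" by (auto simp: inj_on_def)
  have "partition_on E (set ` merge_words h ` \<G>)"
  proof (rule partition_onI)
    show "\<Union>(set ` merge_words h ` \<G>) = E"
    proof -
      have "\<Union>(set ` merge_words h ` \<G>) = \<Union>(set ` \<Union>\<G>)" by (simp add: set_merge_group)
      also have "\<Union>\<G> = W" using part(1) by (simp add: partition_on_def)
      also have "\<Union>(set ` W) = E" using word_systemsD(1)[OF W] by (simp add: partition_on_def)
      finally show ?thesis .
    qed
    show "disjnt p q" if pq: "p \<in> set ` merge_words h ` \<G>" "q \<in> set ` merge_words h ` \<G>" "p \<noteq> q" for p q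
    proof -
      obtain G G' where G: "G \<in> \<G>" "p = set (merge_words h G)" "G' \<in> \<G>" "q = set (merge_words h G')"
        using pq(1,2) by blast
      then show ?thesis using same_group[OF G(1,3)] pq(3) unfolding disjnt_def by blast
    qed
    show "{} \<notin> set ` merge_words h ` \<G>" using merge_nonempty by (metis (no_types, lifting) image_iff)
  qed
  moreover have "inj_on set (merge_words h ` \<G>)" using inj1 by (auto simp: inj_on_def)
  moreover have "distinct (merge_words h G)" if G: "G \<in> \<G>" for G
  proof -
    note d = decreasing_enum[OF group(2,3)[OF G]]
    have "distinct (concat ws)" if "sorted_wrt (\<lambda>v w. set v \<inter> set w = {}) ws" "\<forall>w\<in>set ws. distinct w"
      for ws :: "'e list list"
      using that by (induction ws) auto
    then show ?thesis
      unfolding merge_words_def using pieces_disjoint[OF G] d(1) group(1)[OF G] word_systemsD(3)[OF W] by blast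
  qed
  ultimately show ?thesis using part(2) inj2 by (auto simp: word_systems_def card_image)
qed

lemma filter_merge: "G \<in> \<G> \<Longrightarrow> w \<in> G \<Longrightarrow> filter (\<lambda>e. e \<in> set w) (merge_words h G) = w"
  unfolding merge_words_def
  using filter_concat_member[OF pieces_disjoint] decreasing_enum(1)[OF group(2,3)] by blast

lemma word_in_group: "w \<in> W \<Longrightarrow> \<exists>G\<in>\<G>. w \<in> G"
  using part(1) by (auto simp: partition_on_def)

lemma antitone_along_words:
  assumes "\<forall>u\<in>merge_words h ` \<G>. antitone_along b u" "w \<in> W"
  shows "antitone_along b w"
  using word_in_group[OF assms(2)] assms(1) antitone_along_mergeD[OF group(2,3)] by blast

lemma groups_eq: "\<G> = (\<lambda>u. {w \<in> W. set w \<subseteq> set u}) ` merge_words h ` \<G>"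
proof -
  have "{w \<in> W. set w \<subseteq> set (merge_words h G)} = G" if G: "G \<in> \<G>" for G
  proof (intro equalityI subsetI)
    fix w assume w: "w \<in> {w \<in> W. set w \<subseteq> set (merge_words h G)}"
    then obtain e where e: "e \<in> set w" using word_systemsD(7)[OF W] by fastforce
    obtain G' where G': "G' \<in> \<G>" "w \<in> G'" using w word_in_group by blast
    then have "e \<in> set (merge_words h G')" using e set_merge_group[OF G'(1)] by blast
    then show "w \<in> G" using same_group[OF G G'(1)] e w G'(2) by blast
  next
    fix w assume "w \<in> G"
    then show "w \<in> {w \<in> W. set w \<subseteq> set (merge_words h G)}" using group(1)[OF G] set_merge_group[OF G] by blast
  qed
  then show ?thesis by (simp add: image_image)
qed

end

text \<open>The inverse of merging: a word is cut wherever an antitone function drops strictly.\<close>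

lemma split_levels:
  assumes "antitone_along a u"
  shows "\<exists>ws. concat ws = u \<and> [] \<notin> set ws \<and> (\<forall>w\<in>set ws. a constant_on set w) \<and>
    sorted_wrt (\<lambda>v w. a (hd w) < a (hd v)) ws"
  using assms
proof (induction u)
  case Nil
  show ?case by (rule exI[of _ "[]"]) simp
next
  case (Cons e u)
  then obtain ws where ws: "concat ws = u" "[] \<notin> set ws" "\<forall>w\<in>set ws. a constant_on set w"
    "sorted_wrt (\<lambda>v w. a (hd w) < a (hd v)) ws" by auto
  show ?case
  proof (cases ws)
    case Nil
    then have "concat [[e]] = e # u \<and> [] \<notin> set [[e]] \<and> (\<forall>w\<in>set [[e]]. a constant_on set w) \<and>
      sorted_wrt (\<lambda>v w. a (hd w) < a (hd v)) [[e]]"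
      using ws(1) by (auto simp: constant_on_def)
    then show ?thesis by blast
  next
    case (Cons w vs)
    have w: "w \<noteq> []" "a constant_on set w" using ws(2,3) Cons by auto
    have hdle: "a (hd w) \<le> a e" using Cons.prems ws(1) Cons w(1) by auto
    show ?thesis
    proof (cases "a (hd w) = a e")
      case True
      have "a constant_on set (e # w)"
        using hd_constant[OF w(2)] True by (intro constant_onI[of _ _ "a e"]) auto
      then have "concat ((e # w) # vs) = e # u \<and> [] \<notin> set ((e # w) # vs) \<and>
        (\<forall>w\<in>set ((e # w) # vs). a constant_on set w) \<and> sorted_wrt (\<lambda>v w. a (hd w) < a (hd v)) ((e # w) # vs)"
        using ws Cons True by auto
      then show ?thesis by blast
    next
      case False
      then have "concat ([e] # ws) = e # u \<and> [] \<notin> set ([e] # ws) \<and>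
        (\<forall>w\<in>set ([e] # ws). a constant_on set w) \<and> sorted_wrt (\<lambda>v w. a (hd w) < a (hd v)) ([e] # ws)"
        using ws Cons hdle by (auto simp: constant_on_def)
      then show ?thesis by blast
    qed
  qed
qed

text \<open>A perturbation smaller than the gaps of \<open>a\<close> cannot affect the order between different levels of
  \<open>a\<close>, so it only has to be antitone within each level.\<close>

lemma antitone_along_perturb:
  assumes anti: "antitone_along a u"
    and gap: "\<And>e f. e \<in> set u \<Longrightarrow> f \<in> set u \<Longrightarrow> a f < a e \<Longrightarrow> a f + \<epsilon> \<le> a e"
    and s: "\<And>e. e \<in> set u \<Longrightarrow> 0 \<le> s e \<and> s e \<le> \<epsilon>"
    and lev: "sorted_wrt (\<lambda>e f. a e = a f \<longrightarrow> s f \<le> s e) u"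
  shows "antitone_along (\<lambda>e. a e + s e) u"
proof -
  have "sorted_wrt (\<lambda>e f. a f \<le> a e \<and> (a e = a f \<longrightarrow> s f \<le> s e)) u"
    using anti lev unfolding antitone_along_def by (induction u) auto
  then show ?thesis
    unfolding antitone_along_def
  proof (rule sorted_wrt_weaken)
    fix e f assume ef: "e \<in> set u" "f \<in> set u" "a f \<le> a e \<and> (a e = a f \<longrightarrow> s f \<le> s e)"
    show "a f + s f \<le> a e + s e"
    proof (cases "a e = a f")
      case True
      then show ?thesis using ef by simp
    next
      case False
      then have "a f + \<epsilon> \<le> a e" using gap ef by simp
      then show ?thesis using s[OF ef(1)] s[OF ef(2)] by linarith
    qed
  qed
qed

lemma finite_gap:
  fixes a :: "'e \<Rightarrow> real"
  assumes "finite E"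
  obtains \<epsilon> where "\<epsilon> > 0" "\<And>e f. e \<in> E \<Longrightarrow> f \<in> E \<Longrightarrow> a f < a e \<Longrightarrow> a f + \<epsilon> \<le> a e"
proof -
  define D where "D = insert 1 {d \<in> (\<lambda>p. a (fst p) - a (snd p)) ` (E \<times> E). d > 0}"
  have fin: "finite D" using assms by (simp add: D_def)
  have "\<forall>d\<in>D. d > 0" by (simp add: D_def)
  moreover have "D \<noteq> {}" by (simp add: D_def)
  ultimately have "Min D > 0" using Min_in[OF fin] by blast
  moreover have "a f + Min D \<le> a e" if "e \<in> E" "f \<in> E" "a f < a e" for e f
  proof -
    have "a e - a f \<in> D"
      unfolding D_def using that by (intro insertI2 CollectI conjI image_eqI[of _ _ "(e, f)"]) auto
    then have "Min D \<le> a e - a f" by (rule Min_le[OF fin])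
    then show ?thesis by simp
  qed
  ultimately show ?thesis using that by blast
qed

context step_system
begin

lemma functional_annihilates_flat:
  assumes "subspace K" "\<And>v. v \<in> K \<Longrightarrow> \<psi> \<bullet> v = 0" "partition_on E P" "\<And>B. B \<in> P \<Longrightarrow> \<psi> \<bullet> sum x B = 0"
    and "v \<in> flat K P"
  shows "\<psi> \<bullet> v = 0"
proof -
  obtain B0 where B0: "B0 \<in> P" using partition_nonempty[OF assms(3)] by blast
  have "span (K \<union> sum x ` (P - {B0})) \<subseteq> {v. \<psi> \<bullet> v = 0}"
    using assms(2,4) by (intro span_minimal subspace_hyperplane) auto
  then show ?thesis using assms(5) flat_eq_span[OF assms(3,1) B0] by blast
qed

text \<open>In codimension \<open>c + 1\<close>, the sums of \<open>c + 2\<close> blocks span everything. Splitting one of \<open>c + 1\<close>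
  blocks into two parts on which the functional vanishes would put that many sums in its kernel.
  Applied to the normal of a flat, this provides the hypothesis of the cycle lemma.\<close>

lemma functional_nonzero_on_part:
  assumes gen: "generic K (Suc c)" and \<psi>: "\<psi> \<noteq> 0" "\<And>v. v \<in> K \<Longrightarrow> \<psi> \<bullet> v = 0"
    and P: "partition_on E P" "card P = Suc c" "\<And>B. B \<in> P \<Longrightarrow> \<psi> \<bullet> sum x B = 0"
    and A: "B \<in> P" "A \<subset> B" "A \<noteq> {}"
  shows "\<psi> \<bullet> sum x A \<noteq> 0"
proof
  assume z: "\<psi> \<bullet> sum x A = 0"
  have finP: "finite P" using finE P(1) by (rule finite_elements)
  have finB: "finite B" using A P(1) finE by (metis Sup_upper finite_subset partition_onD1)
  define P' where "P' = insert A (insert (B - A) (P - {B}))"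
  have nin: "C \<inter> B = {}" if "C \<in> P - {B}" for C using that P(1) A(1) by (auto simp: partition_on_def disjoint_def)
  have dj: "disjoint (P - {B})" using P(1) by (auto simp: partition_on_def intro: pairwise_subset)
  have 1: "disjnt A C \<and> disjnt C A \<and> disjnt (B - A) C \<and> disjnt C (B - A)" if "C \<in> P - {B}" for C
    using nin[OF that] A(2) unfolding disjnt_def by blast
  have 2: "disjnt A (B - A)" "disjnt (B - A) A" by (auto simp: disjnt_def)
  have "disjoint P'" unfolding P'_def pairwise_insert using 1 2 dj by auto
  moreover have "\<Union>P' = E" "{} \<notin> P'" using P(1) A by (auto simp: P'_def partition_on_def)
  ultimately have "partition_on E P'" by (simp add: partition_on_def)
  moreover have "card P' = Suc (Suc c)"
  proof -
    have "B - A \<notin> P - {B}" using nin[of "B - A"] A(2) by auto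
    moreover have "A \<notin> insert (B - A) (P - {B})" using nin[of A] A(2,3) by auto
    moreover have "card (P - {B}) = c" using P(2) A(1) finP by simp
    ultimately show ?thesis using finP by (simp add: P'_def)
  qed
  ultimately have U: "flat K P' = UNIV" and P': "partition_on E P'" using flat_UNIV[OF gen, of P'] by simp_all
  have "sum x B = sum x (B - A) + sum x A" using finB A(2) by (intro sum.subset_diff) auto
  then have "\<psi> \<bullet> sum x (B - A) = 0" using P(3)[OF A(1)] z by (simp add: inner_add_right)
  then have 3: "\<psi> \<bullet> sum x C = 0" if "C \<in> P'" for C
    using P(3)[of C] z that unfolding P'_def by blast
  have "\<psi> \<in> flat K P'" using U by simp
  from functional_annihilates_flat[OF genericD(1)[OF gen] \<psi>(2) P' 3 this]
  have "\<psi> \<bullet> \<psi> = 0" .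
  then show False using \<psi>(1) by simp
qed

lemma inner_sum_list: "\<phi> \<bullet> sum_list (map (\<lambda>e. b e *\<^sub>R y e) w) = sum_list (map (\<lambda>e. b e *\<^sub>R (\<phi> \<bullet> y e)) w)"
  by (induction w) (auto simp: inner_add_right)

end

section \<open>Where a line leaves a cone\<close>

text \<open>The line \<open>g1 + t g2\<close> moves through the quotient by \<open>K\<close>, of dimension \<open>c + 1\<close>. It is generic in
  two ways: its direction keeps the steps in general position, and no point on it is a combination
  with \<open>c\<close> or fewer coefficient values.\<close>

locale exit_step = step_system E x
  for E :: "'e set" and x :: "'e \<Rightarrow> 'a::euclidean_space" +
  fixes K :: "'a set" and c :: nat and g1 g2 :: 'a
  assumes genK: "generic K (Suc c)" and genK': "generic (span (insert g2 K)) c"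
    and many_values: "g1 + t *\<^sub>R g2 - comb a \<in> K \<Longrightarrow> Suc c \<le> card (a ` E)"
begin

definition nrm :: "'e list set \<Rightarrow> 'a" where
  "nrm W = normal K (set ` W) g2"

text \<open>A word system of \<open>c + 1\<close> words spans a hyperplane modulo \<open>K\<close>. The words are good exactly if the
  cone of the system lies in the half-space behind that hyperplane, as seen in the direction \<open>g2\<close>.\<close>

definition facets :: "'e list set set" where
  "facets = {W \<in> word_systems E (Suc c). \<forall>w\<in>W. good_word (\<lambda>e. nrm W \<bullet> x e) w}"

text \<open>The point in which the line meets the hyperplane of the facet. \<open>height\<close> gives its coordinates
  with respect to the blocks.\<close>

definition exit_point :: "'e list set \<Rightarrow> 'a" where
  "exit_point W = g1 - (nrm W \<bullet> g1) *\<^sub>R g2"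

definition height :: "'e list set \<Rightarrow> 'e \<Rightarrow> real" where
  "height W = (SOME a. (\<forall>w\<in>W. a constant_on set w) \<and> exit_point W - comb a \<in> K)"

lemma subspace_K: "subspace K" by (rule genericD(1)[OF genK])

lemma notin_flat: "partition_on E P \<Longrightarrow> card P \<le> Suc c \<Longrightarrow> g2 \<notin> flat K P"
  by (rule generic_direction_notin_flat[OF genK genK'])

lemma nrm:
  assumes W: "W \<in> word_systems E (Suc c)"
  shows "v \<in> flat K (set ` W) \<Longrightarrow> nrm W \<bullet> v = 0" "nrm W \<bullet> g2 = 1"
    "nrm W \<bullet> v = 0 \<Longrightarrow> v \<in> flat K (set ` W)" "v \<in> K \<Longrightarrow> nrm W \<bullet> v = 0"
    "w \<in> W \<Longrightarrow> nrm W \<bullet> sum x (set w) = 0"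
    "(\<And>v. v \<in> flat K (set ` W) \<Longrightarrow> \<phi> \<bullet> v = 0) \<Longrightarrow> \<phi> \<bullet> g2 = 1 \<Longrightarrow> \<phi> = nrm W"
proof -
  note P = word_systemsD(1,5)[OF W]
  note n = normal[OF genK P notin_flat[OF P(1) eq_refl[OF P(2)]]]
  show 1: "nrm W \<bullet> v = 0" if "v \<in> flat K (set ` W)" for v using n(1) that by (simp add: nrm_def)
  show "nrm W \<bullet> g2 = 1" "nrm W \<bullet> v = 0 \<Longrightarrow> v \<in> flat K (set ` W)" using n(2,3) by (simp_all add: nrm_def)
  show "v \<in> K \<Longrightarrow> nrm W \<bullet> v = 0" using 1 subset_flat by blast
  show "w \<in> W \<Longrightarrow> nrm W \<bullet> sum x (set w) = 0" using 1 block_in_flat[OF P(1) subspace_K] by blast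
  show "(\<And>v. v \<in> flat K (set ` W) \<Longrightarrow> \<phi> \<bullet> v = 0) \<Longrightarrow> \<phi> \<bullet> g2 = 1 \<Longrightarrow> \<phi> = nrm W"
    unfolding nrm_def by (rule n(4))
qed

lemma nrm_exit_point: "W \<in> word_systems E (Suc c) \<Longrightarrow> nrm W \<bullet> exit_point W = 0"
  using nrm(2)[of W] by (simp add: exit_point_def inner_diff_right)

lemma card_values_words:
  assumes "W \<in> word_systems E k" "\<forall>w\<in>W. a constant_on set w"
  shows "card (a ` E) \<le> k" "a ` E \<subseteq> (\<lambda>w. a (hd w)) ` W"
proof -
  note P = word_systemsD(1,5)[OF assms(1)]
  have "finite (set ` W)" using finE P(1) by (rule finite_elements)
  then have "card (a ` E) \<le> card (set ` W)"
    using P(1) assms(2) by (intro card_image_blocks) (auto simp: partition_on_def)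
  then show "card (a ` E) \<le> k" using P(2) by simp
  show "a ` E \<subseteq> (\<lambda>w. a (hd w)) ` W"
  proof
    fix y assume "y \<in> a ` E"
    then obtain e where e: "e \<in> E" "y = a e" by blast
    then obtain w where w: "w \<in> W" "e \<in> set w" using word_systemsD(9)[OF assms(1)] by blast
    then have "y = a (hd w)" using e assms(2) hd_constant by metis
    then show "y \<in> (\<lambda>w. a (hd w)) ` W" using w(1) by blast
  qed
qed

text \<open>By the genericity of the line the \<open>c + 1\<close> blocks carry \<open>c + 1\<close> distinct coordinates, so the
  words of the facet can be sorted by height.\<close>

lemma height:
  assumes W: "W \<in> word_systems E (Suc c)"
  shows "w \<in> W \<Longrightarrow> height W constant_on set w" "exit_point W - comb (height W) \<in> K"
    "inj_on (\<lambda>w. height W (hd w)) W"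
proof -
  have "exit_point W \<in> flat K (set ` W)" using nrm(3)[OF W] nrm_exit_point[OF W] by blast
  then have "\<exists>a. (\<forall>w\<in>W. a constant_on set w) \<and> exit_point W - comb a \<in> K"
    unfolding flat_def by auto
  then have h: "(\<forall>w\<in>W. height W constant_on set w) \<and> exit_point W - comb (height W) \<in> K"
    unfolding height_def by (rule someI_ex)
  then show "w \<in> W \<Longrightarrow> height W constant_on set w" "exit_point W - comb (height W) \<in> K" by blast+
  have "Suc c \<le> card (height W ` E)"
    by (rule many_values[of "- (nrm W \<bullet> g1)"]) (use h in \<open>simp add: exit_point_def\<close>)
  also have "\<dots> \<le> card ((\<lambda>w. height W (hd w)) ` W)"
    using card_values_words(2)[OF W] h finite_word_system[OF finE W] by (intro card_mono) auto
  finally have "card W \<le> card ((\<lambda>w. height W (hd w)) ` W)" using word_systemsD(4)[OF W] by simp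
  then show "inj_on (\<lambda>w. height W (hd w)) W"
    using finite_word_system[OF finE W] card_image_le[of W "\<lambda>w. height W (hd w)"]
    by (intro eq_card_imp_inj_on) auto
qed

lemma facetsD: "W \<in> facets \<Longrightarrow> W \<in> word_systems E (Suc c)"
  "W \<in> facets \<Longrightarrow> w \<in> W \<Longrightarrow> good_word (\<lambda>e. nrm W \<bullet> x e) w"
  by (auto simp: facets_def)

lemma inner_block:
  assumes "distinct w"
  shows "sum_list (map (\<lambda>e. \<phi> \<bullet> x e) w) = \<phi> \<bullet> sum x (set w)"
  using assms by (simp add: sum_list_distinct_conv_sum_set inner_sum_right)

text \<open>Summing \<open>good_word_abel\<close> over the words. Every system obtained by merging words of the facet has
  a smaller cone, hence is supported by the same hyperplane.\<close>

lemma facet_supports: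
  assumes W: "W \<in> facets" and b: "\<forall>w\<in>W. antitone_along b w"
  shows "nrm W \<bullet> comb b \<le> 0" "0 \<le> nrm W \<bullet> comb b \<Longrightarrow> w \<in> W \<Longrightarrow> b constant_on set w"
proof -
  note Ws = facetsD(1)[OF W]
  let ?s = "\<lambda>w. sum_list (map (\<lambda>e. b e *\<^sub>R (nrm W \<bullet> x e)) w)"
  have eq: "nrm W \<bullet> comb b = (\<Sum>w\<in>W. ?s w)"
    by (simp add: comb_words[OF Ws] inner_sum_right inner_sum_list)
  have tot: "sum_list (map (\<lambda>e. nrm W \<bullet> x e) w) = 0" if "w \<in> W" for w
    using nrm(5)[OF Ws that] inner_block[OF word_systemsD(3)[OF Ws that]] by simp
  have le: "?s w \<le> 0" if "w \<in> W" for w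
    using good_word_abel(1)[OF facetsD(2)[OF W that] tot[OF that]] b that by blast
  show "nrm W \<bullet> comb b \<le> 0" unfolding eq by (rule sum_nonpos) (rule le)
  assume nn: "0 \<le> nrm W \<bullet> comb b" and w: "w \<in> W"
  have "(\<Sum>v\<in>W. - ?s v) = 0" using nn le unfolding eq
    by (simp add: sum_negf order_antisym sum_nonpos)
  then have "- ?s w = 0"
    using le finite_word_system[OF finE Ws] w by (subst (asm) sum_nonneg_eq_0_iff) auto
  then show "b constant_on set w"
    using good_word_abel(2)[OF facetsD(2)[OF W w] tot[OF w]] b w by simp
qed

text \<open>For given blocks the normal is fixed and the cycle lemma counts the good orders of each block;
  the sum over all partitions is the Stirling number of the first kind.\<close>

lemma card_facets: "card facets = stirling (card E) (Suc c)"
proof -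
  let ?Q = "\<lambda>P w. good_word (\<lambda>e. normal K P g2 \<bullet> x e) w"
  let ?X = "\<lambda>P. {W \<in> word_systems E (Suc c). set ` W = P \<and> (\<forall>w\<in>W. ?Q P w)}"
  have fin: "finite (?X P)" for P using finite_word_systems[OF finE] by (rule rev_finite_subset) auto
  have eq: "facets = (\<Union>P\<in>partitions E (Suc c). ?X P)"
    using word_systemsD(1,5) by (auto simp: facets_def nrm_def partitions_def)
  have "card facets = (\<Sum>P\<in>partitions E (Suc c). card (?X P))"
    unfolding eq using finite_partitions[OF finE] fin by (intro card_UN_disjoint) auto
  also have "\<dots> = (\<Sum>P\<in>partitions E (Suc c). \<Prod>B\<in>P. fact (card B - 1))"
  proof (rule sum.cong[OF refl])
    fix P assume "P \<in> partitions E (Suc c)"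
    then have P: "partition_on E P" "card P = Suc c" by (auto simp: partitions_def)
    note n = normal[OF genK P notin_flat[OF P(1) eq_refl[OF P(2)]]]
    let ?\<phi> = "normal K P g2"
    have ne: "?\<phi> \<noteq> 0" using n(2) by auto
    have K0: "?\<phi> \<bullet> v = 0" if "v \<in> K" for v using n(1) subset_flat that by blast
    have B0: "?\<phi> \<bullet> sum x B = 0" if "B \<in> P" for B
      using n(1) block_in_flat[OF P(1) subspace_K that] by blast
    have "card {w \<in> permutations_of_set B. ?Q P w} = fact (card B - 1)" if B: "B \<in> P" for B
    proof (rule cycle_lemma)
      show "finite B" "B \<noteq> {}"
        using B P(1) finE by (metis Sup_upper finite_subset partition_onD1, metis partition_onD3)
      show "(\<Sum>e\<in>B. ?\<phi> \<bullet> x e) = 0" using B0[OF B] by (simp add: inner_sum_right)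
      show "(\<Sum>e\<in>A. ?\<phi> \<bullet> x e) \<noteq> 0" if "A \<subset> B" "A \<noteq> {}" for A
        using functional_nonzero_on_part[OF genK ne K0 P B0 B that] by (simp add: inner_sum_right)
    qed
    then show "card (?X P) = (\<Prod>B\<in>P. fact (card B - 1))"
      unfolding card_word_systems_over[OF finE P] by simp
  qed
  also have "\<dots> = stirling (card E) (Suc c)" by (rule sum_partitions_prod_fact[OF finE])
  finally show ?thesis .
qed

text \<open>The parameters for which a line is in a closed convex cone form an interval, which is bounded
  above unless the direction itself is in the cone.\<close>

definition exits :: "'e list set \<Rightarrow> bool" where
  "exits U \<longleftrightarrow> (\<exists>t. g1 + t *\<^sub>R g2 \<in> cone K U) \<and> g2 \<notin> cone K U"

text \<open>
  Sorting by height makes the exit point an element of every merged cone, while the hyperplane of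
  the facet supports that cone: the line leaves the merged cone exactly there.\<close>

context
  fixes W m \<G>
  assumes W: "W \<in> facets" and \<G>: "\<G> \<in> partitions W m"
begin

interpretation M: merging E W "Suc c" m "height W" \<G>
  using finE facetsD(1)[OF W] height(3)[OF facetsD(1)[OF W]] \<G> by unfold_locales

lemma merged_system: "merge_words (height W) ` \<G> \<in> word_systems E m"
  by (rule M.merged_word_system)

lemma merged_supports: "v \<in> cone K (merge_words (height W) ` \<G>) \<Longrightarrow> nrm W \<bullet> v \<le> 0"
proof -
  assume "v \<in> cone K (merge_words (height W) ` \<G>)"
  then obtain b where b: "\<forall>u\<in>merge_words (height W) ` \<G>. antitone_along b u" "v - comb b \<in> K"
    unfolding cone_def by blast
  have "nrm W \<bullet> comb b \<le> 0" using facet_supports(1)[OF W] M.antitone_along_words[OF b(1)] by blast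
  then show ?thesis using nrm(4)[OF facetsD(1)[OF W] b(2)] by (simp add: inner_diff_right)
qed

lemma exit_point_in_cone: "exit_point W \<in> cone K (merge_words (height W) ` \<G>)"
proof (rule coneI[OF _ height(2)[OF facetsD(1)[OF W]]])
  fix u assume "u \<in> merge_words (height W) ` \<G>"
  then obtain G where G: "G \<in> \<G>" "u = merge_words (height W) G" by blast
  show "antitone_along (height W) u"
    unfolding G(2) using M.group[OF G(1)] height(1)[OF facetsD(1)[OF W]]
    by (intro merge_antitone) auto
qed

lemma merged_constant:
  assumes b: "\<forall>u\<in>merge_words (height W) ` \<G>. antitone_along b u" "nrm W \<bullet> comb b = 0" and w: "w \<in> W"
  shows "b constant_on set w"
  using facet_supports(2)[OF W _ _ w] M.antitone_along_words[OF b(1)] b(2) by auto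

lemma merged_exits: "exits (merge_words (height W) ` \<G>)"
  unfolding exits_def
proof
  show "\<exists>t. g1 + t *\<^sub>R g2 \<in> cone K (merge_words (height W) ` \<G>)"
    using exit_point_in_cone by (intro exI[of _ "- (nrm W \<bullet> g1)"]) (simp add: exit_point_def)
  show "g2 \<notin> cone K (merge_words (height W) ` \<G>)"
    using merged_supports[of g2] nrm(2)[OF facetsD(1)[OF W]] by auto
qed

lemma merged_face: "is_face K (merge_words (height W) ` \<G>)"
  unfolding is_face_def
proof (intro allI impI)
  fix b assume b: "\<forall>u\<in>merge_words (height W) ` \<G>. antitone_along b u" "comb b \<in> K"
  have "\<forall>w\<in>W. b constant_on set w"
    using merged_constant[OF b(1)] nrm(4)[OF facetsD(1)[OF W] b(2)] by blast
  then have "card (b ` E) \<le> Suc c" using card_values_words(1)[OF facetsD(1)[OF W]] by blast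
  then show "b constant_on E" using genericD(3)[OF genK, of b] b(2) by simp
qed

end

text \<open>The exit point of a merged system is where the line leaves its cone, so it depends on the
  merged system only. The heights on the facet agree up to a constant because both describe this
  point; their level sets are the blocks, and restricting the merged words to the blocks returns
  the words and the groups.\<close>

lemma merged_inj:
  "inj_on (\<lambda>(W, \<G>). merge_words (height W) ` \<G>) (Sigma facets (\<lambda>W. partitions W m))"
proof (rule inj_onI)
  fix p p' assume p: "p \<in> Sigma facets (\<lambda>W. partitions W m)" "p' \<in> Sigma facets (\<lambda>W. partitions W m)"
    "(\<lambda>(W, \<G>). merge_words (height W) ` \<G>) p = (\<lambda>(W, \<G>). merge_words (height W) ` \<G>) p'"
  obtain W \<G> W' \<G>' where pe: "p = (W, \<G>)" "p' = (W', \<G>')" by (metis surj_pair)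
  have W: "W \<in> facets" "\<G> \<in> partitions W m" and W': "W' \<in> facets" "\<G>' \<in> partitions W' m"
    and eq: "merge_words (height W) ` \<G> = merge_words (height W') ` \<G>'"
    using p pe by auto
  note Ws = facetsD(1)[OF W(1)] and Ws' = facetsD(1)[OF W'(1)]
  interpret A: merging E W "Suc c" m "height W" \<G>
    using finE Ws height(3)[OF Ws] W(2) by unfold_locales
  interpret B: merging E W' "Suc c" m "height W'" \<G>'
    using finE Ws' height(3)[OF Ws'] W'(2) by unfold_locales
  define U where "U = merge_words (height W) ` \<G>"
  have U': "U = merge_words (height W') ` \<G>'" by (simp add: U_def eq)
  have in_cone: "exit_point W \<in> cone K U" "exit_point W' \<in> cone K U"
    using exit_point_in_cone[OF W] exit_point_in_cone[OF W'] by (simp_all add: U_def eq)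
  \<comment> \<open>each exit point lies in the common cone and thus behind the hyperplane of the other facet,
    which puts both at the same parameter of the line\<close>
  have "nrm W' \<bullet> exit_point W \<le> 0" "nrm W \<bullet> exit_point W' \<le> 0"
    using merged_supports[OF W'] merged_supports[OF W] in_cone eq by (simp_all add: U_def)
  then have t: "nrm W \<bullet> g1 = nrm W' \<bullet> g1"
    using nrm(2)[OF Ws] nrm(2)[OF Ws'] by (simp add: exit_point_def inner_diff_right)
  then have h: "exit_point W = exit_point W'" by (simp add: exit_point_def)
  let ?a = "height W" and ?b = "height W'"
  have antib: "\<forall>u\<in>merge_words ?a ` \<G>. antitone_along ?b u"
  proof
    fix u assume "u \<in> merge_words ?a ` \<G>"
    then obtain G where G: "G \<in> \<G>'" "u = merge_words ?b G" unfolding eq by blast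
    show "antitone_along ?b u" unfolding G(2)
      using B.group[OF G(1)] height(1)[OF Ws'] by (intro merge_antitone) auto
  qed
  have "nrm W \<bullet> (exit_point W' - comb ?b) = 0" by (rule nrm(4)[OF Ws height(2)[OF Ws']])
  then have "nrm W \<bullet> comb ?b = 0" using nrm_exit_point[OF Ws] h by (simp add: inner_diff_right)
  then have cb: "?b constant_on set w" if "w \<in> W" for w
    using merged_constant[OF W antib _ that] by blast
  \<comment> \<open>the difference is constant on the blocks of \<open>W\<close>, so it has few values and genericity applies\<close>
  define d where "d = (\<lambda>e. ?a e - ?b e)"
  have "\<forall>w\<in>W. d constant_on set w" using cb height(1)[OF Ws] by (auto simp: d_def intro: constant_on_diff)
  then have "card (d ` E) \<le> Suc c" by (rule card_values_words(1)[OF Ws])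
  moreover have "comb d \<in> K"
    unfolding d_def comb_diff using subspace_diff[OF subspace_K height(2)[OF Ws'] height(2)[OF Ws]] h by simp
  ultimately have d: "d constant_on E" using genericD(3)[OF genK, of d] by simp
  have lev: "?a e = ?a f \<longleftrightarrow> ?b e = ?b f" if "e \<in> E" "f \<in> E" for e f
    using constant_onD[OF d that] unfolding d_def by arith
  have same: "set w = set w'" if "w \<in> W" "w' \<in> W'" "e \<in> set w" "e \<in> set w'" for w w' e
  proof -
    have *: "set v = {f \<in> E. height V f = height V e}"
      if V: "V \<in> word_systems E (Suc c)" "v \<in> V" "e \<in> set v" for V v e
    proof (intro equalityI subsetI)
      fix f assume "f \<in> set v"
      then show "f \<in> {f \<in> E. height V f = height V e}"
        using word_systemsD(6)[OF V(1,2)] constant_onD[OF height(1)[OF V(1,2)]] V(3) by blast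
    next
      fix f assume f: "f \<in> {f \<in> E. height V f = height V e}"
      then obtain v' where v': "v' \<in> V" "f \<in> set v'" using word_systemsD(9)[OF V(1)] by blast
      have "height V (hd v') = height V (hd v)"
        using hd_constant[OF height(1)[OF V(1) v'(1)] v'(2)] hd_constant[OF height(1)[OF V(1,2)] V(3)] f by simp
      then have "v' = v" using height(3)[OF V(1)] v'(1) V(2) by (auto dest: inj_onD)
      then show "f \<in> set v" using v' by simp
    qed
    have "e \<in> E" using word_systemsD(6)[OF Ws that(1)] that(3) by blast
    then have "{f \<in> E. ?a f = ?a e} = {f \<in> E. ?b f = ?b e}" using lev by blast
    then show ?thesis using *[OF Ws that(1,3)] *[OF Ws' that(2,4)] by simp
  qed
  have "W \<subseteq> W'"
  proof
    fix w assume w: "w \<in> W"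
    then obtain e where e: "e \<in> set w" using word_systemsD(7)[OF Ws] by fastforce
    have eE: "e \<in> E" using word_systemsD(6)[OF Ws w] e by blast
    obtain w' where w': "w' \<in> W'" "e \<in> set w'" using word_systemsD(9)[OF Ws' eE] by blast
    note sw = same[OF w w'(1) e w'(2)]
    obtain G where G: "G \<in> \<G>" "w \<in> G" using A.word_in_group[OF w] by blast
    obtain G' where G': "G' \<in> \<G>'" "w' \<in> G'" using B.word_in_group[OF w'(1)] by blast
    have "e \<in> set (merge_words ?a G)" "e \<in> set (merge_words ?b G')"
      using e w'(2) G G' A.set_merge_group B.set_merge_group by auto
    moreover have "merge_words ?a G \<in> U" "merge_words ?b G' \<in> U" using G G' U' by (auto simp: U_def)
    ultimately have "merge_words ?a G = merge_words ?b G'"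
      using word_systemsD(8)[OF A.merged_word_system] unfolding U_def by blast
    then have "w = w'" using A.filter_merge[OF G] B.filter_merge[OF G'] sw by metis
    then show "w \<in> W'" using w' by simp
  qed
  then have WW: "W = W'" by (rule word_systems_eq[OF Ws Ws'])
  moreover have "\<G> = \<G>'" using A.groups_eq B.groups_eq eq WW by metis
  ultimately show "p = p'" by (simp add: pe)
qed

text \<open>For large parameters the rescaled point \<open>g1 / t + g2\<close> of the cone would come arbitrarily close
  to \<open>g2\<close>, but the cone is closed.\<close>

lemma exits_bdd:
  assumes U: "U \<in> word_systems E m" and out: "g2 \<notin> cone K U"
  shows "bdd_above {t. g1 + t *\<^sub>R g2 \<in> cone K U}"
proof -
  have "open (- cone K U)" using closed_cone[OF subspace_K U] by (rule open_Compl)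
  then obtain e where e: "e > 0" "ball g2 e \<subseteq> - cone K U" using out open_contains_ball by blast
  have "t \<le> norm g1 / e + 1" if t: "g1 + t *\<^sub>R g2 \<in> cone K U" for t
  proof (rule ccontr)
    assume "\<not> t \<le> norm g1 / e + 1"
    then have gt: "t > norm g1 / e" "t > 0"
      using e(1) by (auto intro: less_le_trans[of _ 1] simp: le_add_same_cancel2 not_le add_pos_nonneg order.strict_trans1[of 0 "norm g1 / e"])
    have "(1 / t) *\<^sub>R (g1 + t *\<^sub>R g2) \<in> cone K U" using gt by (intro cone_scale[OF subspace_K t]) simp
    then have "(1 / t) *\<^sub>R g1 + g2 \<in> cone K U" using gt by (simp add: algebra_simps)
    moreover have "(1 / t) *\<^sub>R g1 + g2 \<in> ball g2 e"
      using gt e(1) by (simp add: dist_norm field_simps)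
    ultimately show False using e(2) by blast
  qed
  then show ?thesis by (intro bdd_aboveI[of _ "norm g1 / e + 1"]) blast
qed

text \<open>At the largest parameter for which the line is in the cone, the rest of the line is a ray
  disjoint from the cone; a functional separating the two vanishes at the end point.\<close>

lemma exit_functional:
  assumes U: "U \<in> word_systems E m" and ex: "exits U"
  obtains \<psi> t a where "\<psi> \<noteq> 0" "\<And>v. v \<in> cone K U \<Longrightarrow> \<psi> \<bullet> v \<le> 0" "0 \<le> \<psi> \<bullet> g2"
    "\<psi> \<bullet> (g1 + t *\<^sub>R g2) = 0" "\<forall>u\<in>U. antitone_along a u" "g1 + t *\<^sub>R g2 - comb a \<in> K"
proof -
  let ?C = "cone K U" and ?A = "{t. g1 + t *\<^sub>R g2 \<in> cone K U}"
  have out: "g2 \<notin> ?C" and ne: "?A \<noteq> {}" using ex by (auto simp: exits_def)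
  note bdd = exits_bdd[OF U out]
  have clC: "closed ?C" by (rule closed_cone[OF subspace_K U])
  have "closed ((\<lambda>t. g1 + t *\<^sub>R g2) -` ?C)"
    by (rule continuous_closed_vimage[OF clC]) (auto intro!: continuous_intros)
  then have "closed ?A" by (simp add: vimage_def)
  define t where "t = Sup ?A"
  have tA: "t \<in> ?A" unfolding t_def by (rule closed_contains_Sup[OF ne bdd \<open>closed ?A\<close>])
  define h where "h = g1 + t *\<^sub>R g2"
  define R where "R = (\<lambda>\<epsilon>. h + \<epsilon> *\<^sub>R g2) ` {0<..}"
  have disj: "?C \<inter> R = {}"
  proof (rule ccontr)
    assume "?C \<inter> R \<noteq> {}"
    then obtain \<epsilon> where \<epsilon>: "\<epsilon> > 0" "h + \<epsilon> *\<^sub>R g2 \<in> ?C" by (auto simp: R_def)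
    then have "t + \<epsilon> \<in> ?A" by (simp add: h_def algebra_simps)
    then have "t + \<epsilon> \<le> t" unfolding t_def using bdd by (rule cSup_upper)
    then show False using \<epsilon>(1) by simp
  qed
  have convR: "convex R"
  proof -
    have "R = (+) h ` ((\<lambda>\<epsilon>. \<epsilon> *\<^sub>R g2) ` {0<..})" by (simp add: R_def image_image)
    moreover have "convex ((\<lambda>\<epsilon>. \<epsilon> *\<^sub>R g2) ` {0::real<..})"
      by (intro convex_linear_image convex_real_interval) (simp add: linear_iff algebra_simps)
    ultimately show ?thesis by (simp add: convex_translation)
  qed
  have Rne: "R \<noteq> {}" by (auto simp: R_def)
  obtain \<psi> where \<psi>: "\<psi> \<noteq> 0" "\<And>v. v \<in> ?C \<Longrightarrow> \<psi> \<bullet> v \<le> 0" "\<And>v. v \<in> R \<Longrightarrow> 0 \<le> \<psi> \<bullet> v"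
    by (rule separate_from_cone[OF subspace_K convR Rne disj]) blast
  have ray: "0 \<le> \<psi> \<bullet> h + \<epsilon> * (\<psi> \<bullet> g2)" if "\<epsilon> > 0" for \<epsilon>
  proof -
    have "h + \<epsilon> *\<^sub>R g2 \<in> R" using that by (auto simp: R_def)
    from \<psi>(3)[OF this] show ?thesis by (simp add: inner_add_right)
  qed
  have hle: "\<psi> \<bullet> h \<le> 0" using \<psi>(2) tA by (simp add: h_def)
  have h0: "\<psi> \<bullet> h = 0"
  proof (rule ccontr)
    assume "\<psi> \<bullet> h \<noteq> 0"
    then have lt: "\<psi> \<bullet> h < 0" using hle by simp
    define D where "D = \<bar>\<psi> \<bullet> g2\<bar> + 1"
    have D: "D > 0" by (simp add: D_def add_nonneg_pos)
    define \<epsilon> where "\<epsilon> = - (\<psi> \<bullet> h) / (2 * D)"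
    have ep: "\<epsilon> > 0" using lt D by (simp add: \<epsilon>_def divide_neg_pos)
    have "\<epsilon> * (\<psi> \<bullet> g2) \<le> \<epsilon> * D" using ep by (intro mult_left_mono) (auto simp: D_def)
    also have "\<dots> = - (\<psi> \<bullet> h) / 2" using D by (simp add: \<epsilon>_def)
    finally show False using ray[OF ep] lt by simp
  qed
  have g2: "0 \<le> \<psi> \<bullet> g2" using ray[of 1] h0 by simp
  obtain a where a: "\<forall>u\<in>U. antitone_along a u" "h - comb a \<in> K"
    using tA unfolding cone_def h_def by blast
  show ?thesis
    by (rule that[OF \<psi>(1,2) g2 h0[unfolded h_def] a(1) a(2)[unfolded h_def]])
qed

end

section \<open>Counting faces whose cone contains a direction\<close>

lemma strictly_decreasing_inj:
  fixes h :: "'e \<Rightarrow> real"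
  assumes "sorted_wrt (\<lambda>v w. h (hd w) < h (hd v)) ws"
  shows "inj_on (\<lambda>w. h (hd w)) (set ws)"
proof -
  have "sorted_wrt (<) (map (\<lambda>w. - h (hd w)) ws)" using assms by (simp add: sorted_wrt_map)
  then have "inj_on (\<lambda>w. - h (hd w)) (set ws)" by (simp add: strict_sorted_iff distinct_map)
  then show ?thesis by (auto simp: inj_on_def)
qed

context step_system
begin

text \<open>Let \<open>\<psi>\<close> support the cone of \<open>U\<close> at the combination with coefficients \<open>a\<close>. Cut every word of \<open>U\<close>
  into the segments on which \<open>a\<close> is constant. Small perturbations of \<open>a\<close> that are antitone within
  the segments stay in the cone, so \<open>\<psi>\<close> is nonpositive on them; for indicators of prefixes and
  for complements of blocks this says that \<open>\<psi>\<close> is nonpositive on prefixes and vanishes on the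
  segments. There are at most \<open>c + 1\<close> segments, as the sums of more would span everything and
  leave no room for \<open>\<psi>\<close>.\<close>

lemma supporting_pieces:
  assumes gen: "generic K (Suc c)" and U: "U \<in> word_systems E m"
    and \<psi>: "\<psi> \<noteq> 0" "\<And>v. v \<in> cone K U \<Longrightarrow> \<psi> \<bullet> v \<le> 0"
    and a: "\<And>u. u \<in> U \<Longrightarrow> antitone_along a u" "\<psi> \<bullet> comb a = 0"
  obtains ws where "\<And>u. u \<in> U \<Longrightarrow> concat (ws u) = u"
    "\<And>u. u \<in> U \<Longrightarrow> sorted_wrt (\<lambda>v w. a (hd w) < a (hd v)) (ws u)"
    "(\<Union>u\<in>U. set (ws u)) \<in> word_systems E (card (\<Union>u\<in>U. set (ws u)))"
    "card (\<Union>u\<in>U. set (ws u)) \<le> Suc c"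
    "\<And>w. w \<in> (\<Union>u\<in>U. set (ws u)) \<Longrightarrow> a constant_on set w"
    "\<And>w. w \<in> (\<Union>u\<in>U. set (ws u)) \<Longrightarrow> \<psi> \<bullet> sum x (set w) = 0"
    "\<And>w k. w \<in> (\<Union>u\<in>U. set (ws u)) \<Longrightarrow> \<psi> \<bullet> sum x (set (take k w)) \<le> 0"
proof -
  note K = genericD(1)[OF gen]
  note Us = word_systemsD[OF U]
  have K0: "\<psi> \<bullet> v = 0" if "v \<in> K" for v
    by (rule functional_zero_on_subspace[OF K _ that]) (rule \<psi>(2))
  obtain \<epsilon> where \<epsilon>: "\<epsilon> > 0" "\<And>e f. e \<in> E \<Longrightarrow> f \<in> E \<Longrightarrow> a f < a e \<Longrightarrow> a f + \<epsilon> \<le> a e"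
    using finite_gap[OF finE, of a] by blast
  have "\<forall>u\<in>U. \<exists>ws. concat ws = u \<and> [] \<notin> set ws \<and> (\<forall>w\<in>set ws. a constant_on set w) \<and>
      sorted_wrt (\<lambda>v w. a (hd w) < a (hd v)) ws"
    using split_levels[OF a(1)] by blast
  then obtain ws where "\<forall>u\<in>U. concat (ws u) = u \<and> [] \<notin> set (ws u) \<and> (\<forall>w\<in>set (ws u). a constant_on set w) \<and>
      sorted_wrt (\<lambda>v w. a (hd w) < a (hd v)) (ws u)"
    by (rule bchoice[THEN exE])
  then have ws: "concat (ws u) = u" "[] \<notin> set (ws u)" "\<forall>w\<in>set (ws u). a constant_on set w"
      "sorted_wrt (\<lambda>v w. a (hd w) < a (hd v)) (ws u)" if "u \<in> U" for u
    using that by blast+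
  define W where "W = (\<Union>u\<in>U. set (ws u))"
  have sub: "set w \<subseteq> set u" if "u \<in> U" "w \<in> set (ws u)" for u w
  proof -
    have "set u = \<Union>(set ` set (ws u))" using ws(1)[OF that(1)] by (metis set_concat)
    then show ?thesis using that(2) by blast
  qed
  have const: "a constant_on set w" if "w \<in> W" for w using that ws(3) by (auto simp: W_def)
  have same: "u = u' \<and> w = w'"
    if "u \<in> U" "w \<in> set (ws u)" "u' \<in> U" "w' \<in> set (ws u')" "e \<in> set w" "e \<in> set w'" for u w u' w' e
  proof
    have "e \<in> set u" "e \<in> set u'" using sub that by blast+
    then show u: "u = u'" by (rule Us(8)[OF that(1,3)])
    have "w \<in> W" "w' \<in> W" using that by (auto simp: W_def)
    then have "a (hd w) = a (hd w')" using hd_constant[OF const that(5)] hd_constant[OF const that(6)] by simp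
    then show "w = w'"
      using strictly_decreasing_inj[OF ws(4)[OF that(1)]] that(2,4) u by (auto dest: inj_onD)
  qed
  have Ws: "W \<in> word_systems E (card W)"
  proof -
    have "partition_on E (set ` W)"
    proof (rule partition_onI)
      have "\<Union>(set ` W) = (\<Union>u\<in>U. set (concat (ws u)))" by (auto simp: W_def)
      also have "\<dots> = (\<Union>u\<in>U. set u)" using ws(1) by simp
      also have "\<dots> = E" using Us(1) by (simp add: partition_on_def)
      finally show "\<Union>(set ` W) = E" .
      show "{} \<notin> set ` W" using ws(2) by (auto simp: W_def)
      show "disjnt p q" if pq: "p \<in> set ` W" "q \<in> set ` W" "p \<noteq> q" for p q
      proof -
        obtain u w u' w' where "u \<in> U" "w \<in> set (ws u)" "p = set w" "u' \<in> U" "w' \<in> set (ws u')" "q = set w'"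
          using pq(1,2) unfolding W_def by blast
        then show ?thesis using same[of u w u' w'] pq(3) unfolding disjnt_def by blast
      qed
    qed
    moreover have "inj_on set W"
    proof (rule inj_onI)
      fix w w' assume w: "w \<in> W" "w' \<in> W" "set w = set w'"
      obtain u u' where u: "u \<in> U" "w \<in> set (ws u)" "u' \<in> U" "w' \<in> set (ws u')"
        using w unfolding W_def by blast
      have "hd w \<in> set w" using ws(2)[OF u(1)] u(2) by (metis list.set_sel(1))
      then show "w = w'" using same[OF u, of "hd w"] w(3) by blast
    qed
    moreover have "distinct w" if "w \<in> W" for w
    proof -
      obtain u where u: "u \<in> U" "w \<in> set (ws u)" using \<open>w \<in> W\<close> unfolding W_def by blast
      have "distinct (concat (ws u))" using ws(1)[OF u(1)] Us(3)[OF u(1)] by simp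
      then show ?thesis using u(2) by (simp add: distinct_concat_iff)
    qed
    ultimately show ?thesis by (simp add: word_systems_def)
  qed
  have perturb: "\<psi> \<bullet> comb s \<le> 0"
    if s: "\<And>e. 0 \<le> s e \<and> s e \<le> \<epsilon>" "\<And>w. w \<in> W \<Longrightarrow> antitone_along s w" for s
  proof -
    have "antitone_along (\<lambda>e. a e + s e) u" if u: "u \<in> U" for u
    proof (rule antitone_along_perturb[OF a(1)[OF u]])
      show "a f + \<epsilon> \<le> a e" if "e \<in> set u" "f \<in> set u" "a f < a e" for e f
        using \<epsilon>(2)[of e f] that Us(6)[OF u] by blast
      have "sorted_wrt (\<lambda>e f. a e = a f \<longrightarrow> s f \<le> s e) (concat (ws u))"
        unfolding sorted_wrt_concat_iff
      proof
        show "\<forall>w\<in>set (ws u). sorted_wrt (\<lambda>e f. a e = a f \<longrightarrow> s f \<le> s e) w"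
        proof
          fix w assume "w \<in> set (ws u)"
          then have "sorted_wrt (\<lambda>e f. s f \<le> s e) w"
            using s(2)[of w] u unfolding antitone_along_def W_def by blast
          then show "sorted_wrt (\<lambda>e f. a e = a f \<longrightarrow> s f \<le> s e) w"
            by (rule sorted_wrt_weaken) simp
        qed
        show "sorted_wrt (\<lambda>v w. \<forall>e\<in>set v. \<forall>f\<in>set w. a e = a f \<longrightarrow> s f \<le> s e) (ws u)"
          using ws(4)[OF u]
        proof (rule sorted_wrt_weaken)
          fix v w assume vw: "v \<in> set (ws u)" "w \<in> set (ws u)" "a (hd w) < a (hd v)"
          have "a e = a (hd v)" if "e \<in> set v" for e using ws(3)[OF u] vw(1) that hd_constant by metis
          moreover have "a f = a (hd w)" if "f \<in> set w" for f using ws(3)[OF u] vw(2) that hd_constant by metis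
          ultimately show "\<forall>e\<in>set v. \<forall>f\<in>set w. a e = a f \<longrightarrow> s f \<le> s e" using vw(3) by simp
        qed
      qed
      then show "sorted_wrt (\<lambda>e f. a e = a f \<longrightarrow> s f \<le> s e) u" using ws(1)[OF u] by simp
    qed (rule s(1))
    then have "comb (\<lambda>e. a e + s e) \<in> cone K U" by (rule comb_in_cone[OF K])
    then show ?thesis using \<psi>(2) a(2) unfolding comb_add by (fastforce simp: inner_add_right)
  qed
  have WE: "set w \<subseteq> E" if "w \<in> W" for w by (rule word_systemsD(6)[OF Ws that])
  have prefix: "\<psi> \<bullet> sum x (set (take k w)) \<le> 0" if w: "w \<in> W" for w k
  proof -
    have "\<psi> \<bullet> comb (\<lambda>e. \<epsilon> * indicat_real (set (take k w)) e) \<le> 0"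
    proof (rule perturb)
      show "0 \<le> \<epsilon> * indicat_real (set (take k w)) e \<and> \<epsilon> * indicat_real (set (take k w)) e \<le> \<epsilon>" for e
        using \<epsilon>(1) by (simp add: indicator_def)
      show "antitone_along (\<lambda>e. \<epsilon> * indicat_real (set (take k w)) e) v" if "v \<in> W" for v
        using indicator_prefix_antitone[OF Ws w that] \<epsilon>(1) by (intro antitone_along_scale) auto
    qed
    moreover have "set (take k w) \<subseteq> E" using WE[OF w] set_take_subset[of k w] by blast
    ultimately show ?thesis using \<epsilon>(1) by (simp add: comb_scale comb_indicator mult_le_0_iff)
  qed
  have block: "\<psi> \<bullet> sum x (set w) = 0" if w: "w \<in> W" for w
  proof -
    \<comment> \<open>shifting by the constant \<open>\<epsilon>\<close>, which does not change the combination, turns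
      the negative of the indicator into a nonnegative perturbation\<close>
    let ?s = "\<lambda>e. \<epsilon> + (- \<epsilon>) * indicat_real (set w) e"
    have "\<psi> \<bullet> comb ?s \<le> 0"
    proof (rule perturb)
      show "0 \<le> ?s e \<and> ?s e \<le> \<epsilon>" for e using \<epsilon>(1) by (simp add: indicator_def)
      show "antitone_along ?s v" if "v \<in> W" for v
        using constant_on_indicator_partition[of "set ` W" "set w" "set v"] word_systemsD(1)[OF Ws] w that
        by (intro antitone_along_constant constant_on_add constant_on_scale) (auto simp: partition_on_def)
    qed
    then have "- (\<epsilon> * (\<psi> \<bullet> sum x (set w))) \<le> 0"
      using WE[OF w] comb_const[of "\<lambda>_. \<epsilon>" \<epsilon>]
      unfolding comb_add[of "\<lambda>_. \<epsilon>"] comb_scale by (simp add: comb_indicator)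
    moreover have "\<psi> \<bullet> sum x (set w) \<le> 0" using prefix[OF w, of "length w"] by simp
    ultimately show ?thesis using \<epsilon>(1) by (simp add: zero_le_mult_iff)
  qed
  have "card W \<le> Suc c"
  proof (rule ccontr)
    assume "\<not> card W \<le> Suc c"
    then have "Suc c < card (set ` W)" using word_systemsD(5)[OF Ws] by simp
    then have "\<psi> \<in> flat K (set ` W)" using flat_UNIV[OF gen word_systemsD(1)[OF Ws]] by simp
    moreover have "\<psi> \<bullet> sum x B = 0" if "B \<in> set ` W" for B using that block by blast
    ultimately have "\<psi> \<bullet> \<psi> = 0"
      using functional_annihilates_flat[OF K K0 word_systemsD(1)[OF Ws]] by blast
    then show False using \<psi>(1) by simp
  qed
  then show ?thesis
    using that[of ws] ws(1,4) Ws const block prefix unfolding W_def by blast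
qed

end

context exit_step
begin

text \<open>The segments at the exit point form the facet. Their number is exactly \<open>c + 1\<close>, because points
  of the line have no fewer coefficient values; prefix sums that are nonpositive and cannot vanish
  are negative, so the segments are good words.\<close>

lemma exits_obtain:
  assumes U: "U \<in> word_systems E m" and ex: "exits U"
  shows "U \<in> (\<lambda>(W, \<G>). merge_words (height W) ` \<G>) ` Sigma facets (\<lambda>W. partitions W m)"
proof -
  note Us = word_systemsD[OF U]
  obtain \<psi> t a where \<psi>: "\<psi> \<noteq> 0" "\<And>v. v \<in> cone K U \<Longrightarrow> \<psi> \<bullet> v \<le> 0" "0 \<le> \<psi> \<bullet> g2"
    and h0: "\<psi> \<bullet> (g1 + t *\<^sub>R g2) = 0" and a: "\<forall>u\<in>U. antitone_along a u" "g1 + t *\<^sub>R g2 - comb a \<in> K"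
    using exit_functional[OF U ex] by metis
  have K0: "\<psi> \<bullet> v = 0" if "v \<in> K" for v
    by (rule functional_zero_on_subspace[OF subspace_K _ that]) (rule \<psi>(2))
  have "\<psi> \<bullet> (g1 + t *\<^sub>R g2 - comb a) = 0" by (rule K0[OF a(2)])
  then have ca: "\<psi> \<bullet> comb a = 0" using h0 by (simp add: inner_diff_right)
  obtain ws where ws: "\<And>u. u \<in> U \<Longrightarrow> concat (ws u) = u"
    "\<And>u. u \<in> U \<Longrightarrow> sorted_wrt (\<lambda>v w. a (hd w) < a (hd v)) (ws u)"
    and sys: "(\<Union>u\<in>U. set (ws u)) \<in> word_systems E (card (\<Union>u\<in>U. set (ws u)))"
    and le: "card (\<Union>u\<in>U. set (ws u)) \<le> Suc c"
    and const: "\<And>w. w \<in> (\<Union>u\<in>U. set (ws u)) \<Longrightarrow> a constant_on set w"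
    and block: "\<And>w. w \<in> (\<Union>u\<in>U. set (ws u)) \<Longrightarrow> \<psi> \<bullet> sum x (set w) = 0"
    and prefix: "\<And>w k. w \<in> (\<Union>u\<in>U. set (ws u)) \<Longrightarrow> \<psi> \<bullet> sum x (set (take k w)) \<le> 0"
    using supporting_pieces[OF genK U \<psi>(1,2) bspec[OF a(1)] ca] by blast
  define W where "W = (\<Union>u\<in>U. set (ws u))"
  note sys = sys[folded W_def] and le = le[folded W_def] and const = const[folded W_def]
    and block = block[folded W_def] and prefix = prefix[folded W_def]
  have "Suc c \<le> card (a ` E)" by (rule many_values[OF a(2)])
  moreover have "card (a ` E) \<le> card W" using card_values_words(1)[OF sys] const by blast
  ultimately have cW: "card W = Suc c" using le by simp
  have Ws: "W \<in> word_systems E (Suc c)" using sys cW by simp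
  note P = word_systemsD(1,5)[OF Ws]
  have flat0: "\<psi> \<bullet> v = 0" if "v \<in> flat K (set ` W)" for v
    using functional_annihilates_flat[OF subspace_K K0 P(1) _ that] block by blast
  have "\<psi> \<bullet> g2 \<noteq> 0"
    using functional_zero[OF subspace_flat[OF subspace_K] span_insert_flat[OF genK P notin_flat[OF P(1) eq_refl[OF P(2)]]] flat0]
      \<psi>(1) by blast
  then have pos: "\<psi> \<bullet> g2 > 0" using \<psi>(3) by simp
  have nW: "nrm W = (1 / (\<psi> \<bullet> g2)) *\<^sub>R \<psi>"
    by (rule nrm(6)[OF Ws, symmetric]) (use flat0 pos in auto)
  have "good_word (\<lambda>e. nrm W \<bullet> x e) w" if w: "w \<in> W" for w
    unfolding good_word_def
  proof (intro allI impI)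
    fix k assume k: "0 < k \<and> k < length w"
    have dw: "distinct w" by (rule word_systemsD(3)[OF Ws w])
    have "card (set (take k w)) < card (set w)" using k dw by (simp add: distinct_card)
    then have psub: "set (take k w) \<subset> set w" using set_take_subset[of k w] by auto
    have ne: "set (take k w) \<noteq> {}" using k by auto
    have "\<psi> \<bullet> sum x (set (take k w)) \<noteq> 0"
      by (rule functional_nonzero_on_part[OF genK \<psi>(1) K0 P _ _ psub ne]) (use block w in auto)
    then have "\<psi> \<bullet> sum x (set (take k w)) < 0" using prefix[OF w, of k] by simp
    moreover have "sum_list (map (\<lambda>e. nrm W \<bullet> x e) (take k w)) = nrm W \<bullet> sum x (set (take k w))"
      using dw by (intro inner_block) simp
    ultimately show "sum_list (map (\<lambda>e. nrm W \<bullet> x e) (take k w)) < 0"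
      using pos by (simp add: nW divide_neg_pos)
  qed
  then have facet: "W \<in> facets" using Ws by (simp add: facets_def)
  have "nrm W \<bullet> (g1 + t *\<^sub>R g2) = 0" using h0 by (simp add: nW)
  then have "t = - (nrm W \<bullet> g1)" using nrm(2)[OF Ws] by (simp add: inner_add_right)
  then have h: "g1 + t *\<^sub>R g2 = exit_point W" by (simp add: exit_point_def)
  define d where "d = (\<lambda>e. height W e - a e)"
  have "\<forall>w\<in>W. d constant_on set w" using const height(1)[OF Ws] by (auto simp: d_def intro: constant_on_diff)
  then have "card (d ` E) \<le> Suc c" by (rule card_values_words(1)[OF Ws])
  moreover have "comb d \<in> K"
    unfolding d_def comb_diff using subspace_diff[OF subspace_K a(2) height(2)[OF Ws]] h by simp
  ultimately have d: "d constant_on E" using genericD(3)[OF genK, of d] by simp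
  define \<G> where "\<G> = (\<lambda>u. set (ws u)) ` U"
  have hdE: "hd w \<in> E" if "w \<in> W" for w
    using word_systemsD(6,7)[OF Ws that] by (meson hd_in_set subsetD)
  have merge: "merge_words (height W) (set (ws u)) = u" if u: "u \<in> U" for u
  proof -
    have "sorted_wrt (\<lambda>v w. height W (hd w) < height W (hd v)) (ws u)"
      using ws(2)[OF u]
    proof (rule sorted_wrt_weaken)
      fix v w assume vw: "v \<in> set (ws u)" "w \<in> set (ws u)" "a (hd w) < a (hd v)"
      then have "v \<in> W" "w \<in> W" using u by (auto simp: W_def)
      then have "d (hd w) = d (hd v)" using constant_onD[OF d] hdE by blast
      then show "height W (hd w) < height W (hd v)" using vw(3) by (simp add: d_def)
    qed
    then show ?thesis using ws(1)[OF u] by (simp add: merge_words_def decreasing_enum_eq)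
  qed
  have "\<G> \<in> partitions W m"
  proof -
    have dis: "u = u'" if "u \<in> U" "u' \<in> U" "w \<in> set (ws u)" "w \<in> set (ws u')" for u u' w
    proof -
      have "w \<in> W" using that by (auto simp: W_def)
      then have "hd w \<in> set w" using word_systemsD(7)[OF Ws] hd_in_set by blast
      moreover have "set w \<subseteq> set u" "set w \<subseteq> set u'"
        using ws(1)[OF that(1)] ws(1)[OF that(2)] that(3,4) by (metis UN_upper set_concat)+
      ultimately show ?thesis using Us(8)[OF that(1,2), of "hd w"] by blast
    qed
    have ne: "set (ws u) \<noteq> {}" if "u \<in> U" for u using ws(1)[OF that] Us(7)[OF that] by auto
    have "partition_on W \<G>"
    proof (rule partition_onI)
      show "\<Union>\<G> = W" by (auto simp: \<G>_def W_def)
      show "{} \<notin> \<G>" using ne by (auto simp: \<G>_def)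
      show "disjnt p q" if pq: "p \<in> \<G>" "q \<in> \<G>" "p \<noteq> q" for p q
      proof -
        obtain u u' where u: "u \<in> U" "p = set (ws u)" "u' \<in> U" "q = set (ws u')"
          using pq(1,2) unfolding \<G>_def by blast
        then show ?thesis using dis[OF u(1,3)] pq(3) unfolding disjnt_def by blast
      qed
    qed
    moreover have "inj_on (\<lambda>u. set (ws u)) U"
    proof (rule inj_onI)
      fix u u' assume u: "u \<in> U" "u' \<in> U" "set (ws u) = set (ws u')"
      obtain w where "w \<in> set (ws u)" using ne[OF u(1)] by (metis ex_in_conv)
      then show "u = u'" using dis[OF u(1,2)] u(3) by blast
    qed
    ultimately show ?thesis using Us(4) by (simp add: partitions_def \<G>_def card_image)
  qed
  moreover have "merge_words (height W) ` \<G> = U"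
    unfolding \<G>_def image_image using merge by simp
  ultimately show ?thesis using facet by (intro image_eqI[of _ _ "(W, \<G>)"]) auto
qed

lemma card_exits:
  "card {U \<in> word_systems E m. exits U} = stirling (card E) (Suc c) * Stirling (Suc c) m"
proof -
  let ?f = "\<lambda>(W, \<G>). merge_words (height W) ` \<G>" and ?S = "Sigma facets (\<lambda>W. partitions W m)"
  have "{U \<in> word_systems E m. exits U} = ?f ` ?S"
    using exits_obtain merged_system merged_exits by auto
  then have "card {U \<in> word_systems E m. exits U} = card ?S"
    using merged_inj by (simp add: card_image)
  also have "\<dots> = (\<Sum>W\<in>facets. card (partitions W m))"
  proof (rule card_SigmaI)
    show "finite facets" using finite_word_systems[OF finE] by (rule rev_finite_subset) (auto simp: facets_def)
    show "\<forall>W\<in>facets. finite (partitions W m)"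
      using finite_partitions finite_word_system[OF finE facetsD(1)] by blast
  qed
  also have "\<dots> = (\<Sum>W\<in>facets. Stirling (Suc c) m)"
  proof (rule sum.cong[OF refl])
    fix W assume "W \<in> facets"
    note Ws = facetsD(1)[OF this]
    show "card (partitions W m) = Stirling (Suc c) m"
      using card_partitions[OF finite_word_system[OF finE Ws]] word_systemsD(4)[OF Ws] by simp
  qed
  finally show ?thesis by (simp add: card_facets)
qed

lemma g2_notin: "g2 \<notin> K" by (rule generic_direction_notin[OF genK genK'])

lemma comb_in_extended:
  assumes "r *\<^sub>R g2 - comb a \<in> K"
  shows "comb a \<in> span (insert g2 K)"
proof -
  have "r *\<^sub>R g2 - (r *\<^sub>R g2 - comb a) \<in> span (insert g2 K)"
    using assms by (intro span_diff[of "r *\<^sub>R g2"] span_scale span_base) auto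
  then show ?thesis by simp
qed

lemma constant_not_direction: "r \<noteq> 0 \<Longrightarrow> a constant_on E \<Longrightarrow> r *\<^sub>R g2 - comb a \<notin> K"
proof
  assume r: "r \<noteq> 0" "a constant_on E" "r *\<^sub>R g2 - comb a \<in> K"
  then have "comb a = 0" using comb_const unfolding constant_on_def by blast
  then have "r *\<^sub>R g2 \<in> K" using r(3) by simp
  then have "(1 / r) *\<^sub>R (r *\<^sub>R g2) \<in> K" by (rule subspace_scale[OF subspace_K])
  then show False using r(1) g2_notin by simp
qed

text \<open>A line that misses the cone can be separated from it by a functional constant on the line. If
  the cone contained \<open>- g2\<close>, this functional would support the cone at \<open>- g2\<close>, which would then
  be a combination with few coefficient values, contrary to the genericity of \<open>g2\<close>.\<close>

lemma backward_meets:
  assumes U: "U \<in> word_systems E m" and bwd: "- g2 \<in> cone K U"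
  shows "\<exists>t. g1 + t *\<^sub>R g2 \<in> cone K U"
proof (rule ccontr)
  assume none: "\<not> (\<exists>t. g1 + t *\<^sub>R g2 \<in> cone K U)"
  let ?C = "cone K U"
  define L where "L = (\<lambda>t. g1 + t *\<^sub>R g2) ` UNIV"
  have convL: "convex L"
  proof -
    have "L = (+) g1 ` ((\<lambda>t. t *\<^sub>R g2) ` UNIV)" by (simp add: L_def image_image)
    moreover have "convex ((\<lambda>t::real. t *\<^sub>R g2) ` UNIV)"
      by (intro convex_linear_image convex_UNIV) (simp add: linear_iff algebra_simps)
    ultimately show ?thesis by (simp add: convex_translation)
  qed
  have Lne: "L \<noteq> {}" "?C \<inter> L = {}" using none by (auto simp: L_def)
  obtain \<psi> where \<psi>: "\<psi> \<noteq> 0" "\<And>v. v \<in> ?C \<Longrightarrow> \<psi> \<bullet> v \<le> 0" "\<And>v. v \<in> L \<Longrightarrow> 0 \<le> \<psi> \<bullet> v"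
    by (rule separate_from_cone[OF subspace_K convL Lne]) blast
  have line: "0 \<le> \<psi> \<bullet> g1 + t * (\<psi> \<bullet> g2)" for t
  proof -
    have "g1 + t *\<^sub>R g2 \<in> L" by (auto simp: L_def)
    from \<psi>(3)[OF this] show ?thesis by (simp add: inner_add_right)
  qed
  have g0: "\<psi> \<bullet> g2 = 0"
  proof (rule ccontr)
    assume nz: "\<psi> \<bullet> g2 \<noteq> 0"
    have "0 \<le> \<psi> \<bullet> g1 + ((- \<psi> \<bullet> g1 - 1) / (\<psi> \<bullet> g2)) * (\<psi> \<bullet> g2)" by (rule line)
    then show False using nz by simp
  qed
  obtain a where a: "\<forall>u\<in>U. antitone_along a u" "- g2 - comb a \<in> K" using bwd unfolding cone_def by blast
  have "\<psi> \<bullet> (- g2 - comb a) = 0" by (rule functional_zero_on_subspace[OF subspace_K \<psi>(2) a(2)])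
  then have ca: "\<psi> \<bullet> comb a = 0" using g0 by (simp add: inner_diff_right)
  have "card (a ` E) \<le> Suc c"
  proof (rule supporting_pieces[OF genK U \<psi>(1,2) bspec[OF a(1)] ca])
    fix ws assume ws: "(\<Union>u\<in>U. set (ws u)) \<in> word_systems E (card (\<Union>u\<in>U. set (ws u)))"
      "card (\<Union>u\<in>U. set (ws u)) \<le> Suc c"
      "\<And>w. w \<in> (\<Union>u\<in>U. set (ws u)) \<Longrightarrow> a constant_on set w"
    have "card (a ` E) \<le> card (\<Union>u\<in>U. set (ws u))" using card_values_words(1)[OF ws(1)] ws(3) by blast
    then show "card (a ` E) \<le> Suc c" using ws(2) by simp
  qed
  moreover have a': "(- 1) *\<^sub>R g2 - comb a \<in> K" using a(2) by simp
  ultimately have "a constant_on E" using genericD(3)[OF genK', of a] comb_in_extended[OF a'] by blast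
  then show False using constant_not_direction[of "- 1" a] a' by simp
qed

text \<open>A multiple of \<open>g2\<close> vanishes modulo \<open>K + \<real> g2\<close>, so in a face modulo that space it is trivial.\<close>

lemma face_not_backward:
  assumes "is_face (span (insert g2 K)) U"
  shows "- g2 \<notin> cone K U" "g2 \<notin> cone K U"
proof -
  have "r *\<^sub>R g2 \<notin> cone K U" if r: "r \<noteq> 0" for r
  proof
    assume "r *\<^sub>R g2 \<in> cone K U"
    then obtain a where a: "\<forall>u\<in>U. antitone_along a u" "r *\<^sub>R g2 - comb a \<in> K" unfolding cone_def by blast
    then have "a constant_on E" using assms comb_in_extended unfolding is_face_def by blast
    then show False using constant_not_direction[OF r] a(2) by blast
  qed
  from this[of "-1"] this[of 1] show "- g2 \<notin> cone K U" "g2 \<notin> cone K U" by simp_all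
qed

text \<open>If \<open>g2\<close> and \<open>- g2\<close> had antitone coefficients, their sum would vanish modulo \<open>K\<close> and be
  constant. Two antitone functions with constant sum are constant on each word, so the
  coefficients would have too few values for \<open>g2\<close>.\<close>

lemma face_not_both:
  assumes U: "U \<in> word_systems E m" "m \<le> Suc c" and face: "is_face K U" and bwd: "- g2 \<in> cone K U"
  shows "g2 \<notin> cone K U"
proof
  assume "g2 \<in> cone K U"
  then obtain a where a: "\<forall>u\<in>U. antitone_along a u" "1 *\<^sub>R g2 - comb a \<in> K" unfolding cone_def by auto
  obtain b where b: "\<forall>u\<in>U. antitone_along b u" "- g2 - comb b \<in> K" using bwd unfolding cone_def by blast
  have "- ((1 *\<^sub>R g2 - comb a) + (- g2 - comb b)) \<in> K"
    using subspace_neg[OF subspace_K subspace_add[OF subspace_K a(2) b(2)]] .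
  then have "comb (\<lambda>e. a e + b e) \<in> K" by (simp add: comb_add add.commute)
  moreover have "\<forall>u\<in>U. antitone_along (\<lambda>e. a e + b e) u" using a(1) b(1) by (auto intro: antitone_along_add)
  ultimately have "(\<lambda>e. a e + b e) constant_on E" using face unfolding is_face_def by blast
  then obtain s where s: "\<forall>e\<in>E. a e + b e = s" unfolding constant_on_def by blast
  have "a constant_on set u" if u: "u \<in> U" for u
  proof -
    have "antitone_along a v \<Longrightarrow> antitone_along b v \<Longrightarrow> set v \<subseteq> E \<Longrightarrow> a constant_on set v" for v
    proof (induction v)
      case Nil
      then show ?case by (simp add: constant_on_def)
    next
      case (Cons e v)
      have "a f = a e" if "f \<in> set v" for f
      proof -
        have "a f \<le> a e" "b f \<le> b e" "a e + b e = s" "a f + b f = s" using Cons.prems that s by auto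
        then show ?thesis by linarith
      qed
      then show ?case by (intro constant_onI[of _ _ "a e"]) auto
    qed
    then show ?thesis using a(1) b(1) u word_systemsD(6)[OF U(1) u] by blast
  qed
  then have "card (a ` E) \<le> m" by (intro card_values_words(1)[OF U(1)]) blast
  then have "a constant_on E" using genericD(3)[OF genK', of a] comb_in_extended[OF a(2)] U(2) by simp
  then show False using constant_not_direction[of 1 a] a(2) by simp
qed

text \<open>A line that leaves the cone of a face in direction \<open>g2\<close> either comes in from infinity, so that
  the cone contains \<open>- g2\<close>, or neither of the two directions is in the cone. In the latter case
  dividing out \<open>g2\<close> keeps the face a face, and the line becomes the point \<open>g1\<close>.\<close>

lemma exits_iff:
  assumes U: "U \<in> word_systems E m" "m \<le> Suc c"
  shows "exits U \<longleftrightarrow> is_face K U \<and> - g2 \<in> cone K U \<or>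
    is_face (span (insert g2 K)) U \<and> g1 \<in> cone (span (insert g2 K)) U"
proof
  assume ex: "exits U"
  then obtain t where t: "g1 + t *\<^sub>R g2 \<in> cone K U" and out: "g2 \<notin> cone K U" by (auto simp: exits_def)
  have face: "is_face K U" using exits_obtain[OF U(1) ex] merged_face by auto
  show "is_face K U \<and> - g2 \<in> cone K U \<or>
    is_face (span (insert g2 K)) U \<and> g1 \<in> cone (span (insert g2 K)) U"
  proof (cases "- g2 \<in> cone K U")
    case True
    then show ?thesis using face by blast
  next
    case False
    have "is_face (span (insert g2 K)) U"
      unfolding is_face_def
    proof (intro allI impI)
      fix a assume a: "\<forall>u\<in>U. antitone_along a u" "comb a \<in> span (insert g2 K)"
      then obtain r where r: "comb a - r *\<^sub>R g2 \<in> K"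
        using subspace_K by (auto simp: span_breakdown_eq) (metis span_eq_iff)
      \<comment> \<open>a nonzero \<open>r\<close> would put \<open>g2\<close> or \<open>- g2\<close> into the cone, according to its sign\<close>
      have *: "s *\<^sub>R g2 \<in> cone K U" if s: "0 < s * r" "\<bar>s\<bar> = 1" for s
      proof (rule coneI)
        have rs: "r = s * \<bar>r\<bar>" using s by (cases "0 < s") (auto simp: zero_less_mult_iff)
        have r0: "\<bar>r\<bar> > 0" using s by auto
        show "antitone_along (\<lambda>e. (1 / \<bar>r\<bar>) * a e) u" if "u \<in> U" for u
          using a(1) that by (intro antitone_along_scale) auto
        have "(- (1 / \<bar>r\<bar>)) *\<^sub>R (comb a - r *\<^sub>R g2) \<in> K" by (rule subspace_scale[OF subspace_K r])
        also have "(- (1 / \<bar>r\<bar>)) *\<^sub>R (comb a - r *\<^sub>R g2) = (r / \<bar>r\<bar>) *\<^sub>R g2 - comb (\<lambda>e. (1 / \<bar>r\<bar>) * a e)"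
          unfolding comb_scale by (simp add: algebra_simps)
        also have "r / \<bar>r\<bar> = s" using rs r0 by (metis nonzero_mult_div_cancel_right less_irrefl)
        finally show "s *\<^sub>R g2 - comb (\<lambda>e. (1 / \<bar>r\<bar>) * a e) \<in> K" .
      qed
      have "\<not> 0 < r" "\<not> r < 0" using *[of 1] *[of "-1"] out False by auto
      then have "comb a \<in> K" using r by simp
      then show "a constant_on E" using face a(1) unfolding is_face_def by blast
    qed
    moreover have "g1 \<in> cone (span (insert g2 K)) U"
    proof -
      obtain a where a: "\<forall>u\<in>U. antitone_along a u" "g1 + t *\<^sub>R g2 - comb a \<in> K"
        using t unfolding cone_def by blast
      have "(g1 + t *\<^sub>R g2 - comb a) - t *\<^sub>R g2 \<in> span (insert g2 K)"
        using a(2) by (intro span_diff[of "g1 + t *\<^sub>R g2 - comb a"] span_scale span_base) auto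
      then show ?thesis using a(1) by (intro coneI[of _ a]) auto
    qed
    ultimately show ?thesis by blast
  qed
next
  assume "is_face K U \<and> - g2 \<in> cone K U \<or>
    is_face (span (insert g2 K)) U \<and> g1 \<in> cone (span (insert g2 K)) U"
  then show "exits U"
  proof
    assume "is_face K U \<and> - g2 \<in> cone K U"
    then show ?thesis using backward_meets[OF U(1)] face_not_both[OF U] by (auto simp: exits_def)
  next
    assume f: "is_face (span (insert g2 K)) U \<and> g1 \<in> cone (span (insert g2 K)) U"
    then obtain a where a: "\<forall>u\<in>U. antitone_along a u" "g1 - comb a \<in> span (insert g2 K)"
      unfolding cone_def by blast
    then obtain r where "(g1 - comb a) - r *\<^sub>R g2 \<in> K"
      using subspace_K by (auto simp: span_breakdown_eq) (metis span_eq_iff)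
    then have "g1 + (- r) *\<^sub>R g2 \<in> cone K U" using a(1) by (intro coneI[of _ a]) (auto simp: algebra_simps)
    then show ?thesis using face_not_backward(2) f unfolding exits_def by blast
  qed
qed

text \<open>The two cases of \<open>exits_iff\<close> exclude each other.\<close>

lemma recursion:
  assumes "m \<le> Suc c"
  shows "card {U \<in> word_systems E m. is_face K U \<and> - g2 \<in> cone K U} +
    card {U \<in> word_systems E m. is_face (span (insert g2 K)) U \<and> g1 \<in> cone (span (insert g2 K)) U} =
    stirling (card E) (Suc c) * Stirling (Suc c) m"
proof -
  let ?A = "{U \<in> word_systems E m. is_face K U \<and> - g2 \<in> cone K U}"
  let ?B = "{U \<in> word_systems E m. is_face (span (insert g2 K)) U \<and> g1 \<in> cone (span (insert g2 K)) U}"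
  have "{U \<in> word_systems E m. exits U} = ?A \<union> ?B" using exits_iff[OF _ assms] by blast
  moreover have "?A \<inter> ?B = {}" using face_not_backward(1) by blast
  moreover have "finite ?A" "finite ?B"
    using finite_word_systems[OF finE] by (rule rev_finite_subset, blast)+
  ultimately show ?thesis using card_exits[of m] by (simp add: card_Un_disjoint)
qed

end

context step_system
begin

text \<open>With \<open>c + 1\<close> words the block sums span the whole quotient. Some word has two letters, and the
  sum of its first letter can be cancelled by coefficients that are constant on the blocks; the
  result is a nontrivial antitone combination in \<open>K\<close>.\<close>

lemma no_faces_of_full_dimension:
  assumes gen: "generic K c" and U: "U \<in> word_systems E (Suc c)" and c: "Suc c < card E"
  shows "\<not> is_face K U"
proof
  assume face: "is_face K U"
  note K = genericD(1)[OF gen]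
  note Us = word_systemsD[OF U]
  have "\<exists>u\<in>U. 1 < length u"
  proof (rule ccontr)
    assume "\<not> (\<exists>u\<in>U. 1 < length u)"
    then have "length u \<le> 1" if "u \<in> U" for u using that by (auto simp: not_less)
    then have 1: "card (set u) \<le> 1" if "u \<in> U" for u using that card_length[of u] by (meson le_trans)
    have "E = (\<Union>u\<in>U. set u)" using Us(1) by (auto simp: partition_on_def)
    then have "card E \<le> (\<Sum>u\<in>U. card (set u))" using card_UN_le[OF finite_word_system[OF finE U]] by metis
    also have "\<dots> \<le> (\<Sum>u\<in>U. 1)" using 1 by (intro sum_mono) auto
    finally show False using Us(4) c by simp
  qed
  then obtain u where u: "u \<in> U" "1 < length u" by blast
  have "flat K (set ` U) = UNIV" using Us(1,5) by (intro flat_UNIV[OF gen]) auto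
  then obtain b where b: "\<forall>v\<in>U. b constant_on set v" "comb (indicat_real (set (take 1 u))) - comb b \<in> K"
    unfolding flat_def by blast
  let ?a = "\<lambda>e. indicat_real (set (take 1 u)) e + (- 1) * b e"
  have "antitone_along ?a v" if "v \<in> U" for v
    using indicator_prefix_antitone[OF U u(1) that] b(1) that
    by (intro antitone_along_add antitone_along_constant[of "\<lambda>e. (- 1) * b e"] constant_on_scale) auto
  moreover have "comb ?a \<in> K" unfolding comb_add comb_scale using b(2) by simp
  ultimately have a: "?a constant_on E" using face unfolding is_face_def by blast
  obtain e f v where uv: "u = e # f # v" using u(2) by (cases u; cases "tl u") auto
  have "?a e = ?a f" using constant_onD[OF a] Us(6)[OF u(1)] uv by auto
  moreover have "b e = b f" using constant_onD[of b "set u" e f] b(1) u(1) uv by auto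
  ultimately show False using Us(3)[OF u(1)] uv by (simp add: indicator_def)
qed

text \<open>Induction on the codimension: dividing out \<open>g\<close> and choosing a new generic direction in the
  quotient, \<open>recursion\<close> expresses the count as one product of Stirling numbers minus the count in
  the quotient. It ends at \<open>c = j\<close>, where both sides vanish.\<close>

theorem card_faces_containing:
  assumes "j \<le> c" "generic K c" "c > j \<Longrightarrow> generic (span (insert g K)) (c - 1)" "Suc j < card E"
  shows "real (card {U \<in> word_systems E (Suc j). is_face K U \<and> g \<in> cone K U}) =
    (\<Sum>s\<le>c. (- 1) ^ s * real (stirling (card E) (c - s)) * real (Stirling (c - s) (Suc j)))"
  using assms
proof (induction c arbitrary: K g rule: dec_induct)
  case base
  then have "{U \<in> word_systems E (Suc j). is_face K U \<and> g \<in> cone K U} = {}"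
    using no_faces_of_full_dimension by blast
  then have "card {U \<in> word_systems E (Suc j). is_face K U \<and> g \<in> cone K U} = 0" by (simp only: card.empty)
  moreover have "Stirling (j - s) (Suc j) = 0" for s by simp
  ultimately show ?case by simp
next
  case (step c)
  \<comment> \<open>the recursion counts the faces whose cone contains the backward direction of the line\<close>
  define g2 where "g2 = - g"
  let ?K = "span (insert g2 K)"
  have spg: "span (insert (- g) K) = span (insert g K)"
  proof -
    have "- g \<in> span (insert g K)" by (intro span_neg span_base) simp
    moreover have "g \<in> span (insert (- g) K)"
      using span_neg[of "- g" "insert (- g) K"] by (auto intro: span_base)
    ultimately show ?thesis
      by (intro span_eq[THEN iffD2] conjI insert_subsetI) (auto intro: span_base)
  qed
  have genK': "generic ?K c" using step.prems(2) step.hyps spg by (simp add: g2_def)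
  \<comment> \<open>if \<open>g1\<close> keeps general position in the quotient by \<open>g2\<close>, no point of the line has few
    coefficient values; for \<open>c = 0\<close> every coefficient function has at least one value\<close>
  obtain g1 where g1: "\<And>t a. g1 + t *\<^sub>R g2 - comb a \<in> K \<Longrightarrow> Suc c \<le> card (a ` E)"
    "c > j \<Longrightarrow> generic (span (insert g1 ?K)) (c - 1)"
  proof (cases c)
    case 0
    have "0 < card (a ` E)" for a :: "'e \<Rightarrow> real" using finE neE by (simp add: card_gt_0_iff)
    then show ?thesis using that[of 0] 0 by (simp add: Suc_le_eq)
  next
    case (Suc c')
    obtain X where X: "negligible X" "\<And>g. g \<notin> X \<Longrightarrow> generic (span (insert g ?K)) c'"
      using generic_insert_negligible[of ?K c'] genK' Suc by blast
    have "X \<noteq> UNIV" using X(1) non_negligible_UNIV by auto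
    then obtain g1 where gen1: "generic (span (insert g1 ?K)) c'" using X(2) by blast
    have notin: "g1 \<notin> ?K" using generic_direction_notin[of ?K c' g1] genK' gen1 Suc by blast
    have "Suc c \<le> card (a ` E)" if a: "g1 + t *\<^sub>R g2 - comb a \<in> K" for t a
    proof (rule ccontr)
      assume "\<not> Suc c \<le> card (a ` E)"
      then have card: "card (a ` E) \<le> Suc c'" using Suc by simp
      have inK: "g1 + t *\<^sub>R g2 - comb a \<in> ?K" using a by (intro span_base) simp
      have g2K: "t *\<^sub>R g2 \<in> ?K" by (intro span_scale span_base) simp
      have "g1 + t *\<^sub>R g2 - (g1 + t *\<^sub>R g2 - comb a) \<in> span (insert g1 ?K)"
        using inK g2K by (intro span_diff[of "g1 + t *\<^sub>R g2"] span_add span_base) auto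
      then have "comb a \<in> span (insert g1 ?K)" by simp
      then have "a constant_on E" using genericD(3)[OF gen1 card] by blast
      then have "comb a = 0" using comb_const unfolding constant_on_def by blast
      then have "g1 + t *\<^sub>R g2 - t *\<^sub>R g2 \<in> ?K" using inK g2K by (intro span_diff) auto
      then show False using notin by simp
    qed
    then show ?thesis using that[of g1] gen1 Suc by simp
  qed
  interpret exit_step E x K c g1 g2
    by unfold_locales (use step.prems(1) genK' g1(1) in auto)
  let ?Z = "card {U \<in> word_systems E (Suc j). is_face K U \<and> g \<in> cone K U}"
  let ?Z' = "card {U \<in> word_systems E (Suc j). is_face ?K U \<and> g1 \<in> cone ?K U}"
  let ?f = "\<lambda>c s. (- 1) ^ s * real (stirling (card E) (c - s)) * real (Stirling (c - s) (Suc j))"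
  have "?Z + ?Z' = stirling (card E) (Suc c) * Stirling (Suc c) (Suc j)"
    using recursion[of "Suc j"] step.hyps by (simp add: g2_def)
  from arg_cong[OF this, of real]
  have "real ?Z + real ?Z' = real (stirling (card E) (Suc c)) * real (Stirling (Suc c) (Suc j))"
    by (simp only: of_nat_add of_nat_mult)
  moreover have "real ?Z' = (\<Sum>s\<le>c. ?f c s)"
    by (rule step.IH) (use genK' g1(2) step.prems in auto)
  moreover have "(\<Sum>s\<le>Suc c. ?f (Suc c) s) = ?f (Suc c) 0 + (\<Sum>s\<le>c. ?f (Suc c) (Suc s))"
    by (rule sum.atMost_Suc_shift)
  moreover have "(\<Sum>s\<le>c. ?f (Suc c) (Suc s)) = - (\<Sum>s\<le>c. ?f c s)"
    by (simp add: sum_negf[symmetric])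
  ultimately show ?case by simp
qed

end

section \<open>Cutting cyclic words\<close>

text \<open>The set \<open>C\<close> contains the last letters of the pieces into which the cyclic word is cut; the
  coefficients may increase only when passing a cut.\<close>

definition cyclically_antitone :: "('e \<Rightarrow> real) \<Rightarrow> 'e list \<Rightarrow> 'e set \<Rightarrow> bool" where
  "cyclically_antitone a q C \<longleftrightarrow>
    (\<forall>k<length q. q ! k \<notin> C \<longrightarrow> a (q ! (Suc k mod length q)) \<le> a (q ! k))"

lemma cyclically_antitone_rotate:
  "cyclically_antitone a (rotate r q) C \<longleftrightarrow> cyclically_antitone a q C"
proof -
  have one: "cyclically_antitone a (rotate r q) C" if "cyclically_antitone a q C" for r q
    unfolding cyclically_antitone_def
  proof (intro allI impI)
    fix k assume k: "k < length (rotate r q)" "rotate r q ! k \<notin> C"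
    let ?n = "length q"
    define l where "l = (r + k) mod ?n"
    have n: "0 < ?n" "k < ?n" using k(1) by auto
    have l: "l < ?n" using n(1) by (simp add: l_def)
    have 1: "rotate r q ! k = q ! l" using n by (simp add: nth_rotate l_def)
    have "rotate r q ! (Suc k mod ?n) = q ! ((r + Suc k mod ?n) mod ?n)" using n by (simp add: nth_rotate)
    also have "(r + Suc k mod ?n) mod ?n = Suc l mod ?n" by (simp add: l_def mod_simps)
    finally show "a (rotate r q ! (Suc k mod length (rotate r q))) \<le> a (rotate r q ! k)"
      using that l k(2) 1 unfolding cyclically_antitone_def by simp
  qed
  show ?thesis
  proof
    assume c: "cyclically_antitone a (rotate r q) C"
    show "cyclically_antitone a q C" using one[OF c, of "length q * r - r"] by (simp only: rotate_back)
  qed (rule one)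
qed

text \<open>Rotating all words moves a letter from any position to any other, and each letter is at one of
  the \<open>|E|\<close> positions.\<close>

lemma sum_fixed_position:
  fixes F :: "'e list \<Rightarrow> nat"
  assumes E: "finite E" and e: "e \<in> E" and i: "i < card E" and F: "\<And>r q. F (rotate r q) = F q"
  shows "card E * (\<Sum>q\<in>permutations_of_set E. of_bool (q ! i = e) * F q) = (\<Sum>q\<in>permutations_of_set E. F q)"
proof -
  let ?N = "card E" and ?P = "permutations_of_set E"
  have len: "length q = ?N" "distinct q" "set q = E" if "q \<in> ?P" for q
    using that by (auto simp: permutations_of_set_def distinct_card)
  have shift: "(\<Sum>q\<in>?P. of_bool (q ! k = e) * F q) = (\<Sum>q\<in>?P. of_bool (q ! i = e) * F q)" if k: "k < ?N" for k
  proof -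
    define r where "r = i + ?N - k"
    have rk: "(r + k) mod ?N = i" using i k by (simp add: r_def)
    have "(\<Sum>q\<in>?P. of_bool (q ! k = e) * F q) = (\<Sum>q\<in>?P. of_bool (rotate r q ! k = e) * F (rotate r q))"
      by (rule sum.reindex_bij_betw[OF rotate_bij_permutations_of_set, symmetric])
    also have "\<dots> = (\<Sum>q\<in>?P. of_bool (q ! i = e) * F q)"
      using len k rk F by (intro sum.cong refl) (simp add: nth_rotate)
    finally show ?thesis .
  qed
  have "(\<Sum>q\<in>?P. F q) = (\<Sum>q\<in>?P. (\<Sum>k<?N. of_bool (q ! k = e)) * F q)"
  proof (rule sum.cong[OF refl])
    fix q assume q: "q \<in> ?P"
    obtain k where k: "k < ?N" "q ! k = e" using len[OF q] e by (metis in_set_conv_nth)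
    have "{l. l < ?N \<and> q ! l = e} = {k}" using len[OF q] k by (auto simp: nth_eq_iff_index_eq)
    then have "(\<Sum>l<?N. of_bool (q ! l = e) :: nat) = 1"
      by (simp add: of_bool_def sum.If_cases Int_def lessThan_def)
    then show "F q = (\<Sum>k<?N. of_bool (q ! k = e)) * F q" by simp
  qed
  also have "\<dots> = (\<Sum>k<?N. \<Sum>q\<in>?P. of_bool (q ! k = e) * F q)"
    unfolding sum_distrib_right by (rule sum.swap)
  also have "\<dots> = ?N * (\<Sum>q\<in>?P. of_bool (q ! i = e) * F q)" using shift by simp
  finally show ?thesis ..
qed

text \<open>If the word ends with a letter of \<open>C\<close>, then so does every piece. Together with \<open>concat\<close> this
  gives a bijection between words with a set of cuts and lists of nonempty words.\<close>

fun cut_after :: "'e set \<Rightarrow> 'e list \<Rightarrow> 'e list list" where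
  "cut_after C [] = []"
| "cut_after C (e # q) = (if e \<in> C then [e] # cut_after C q
    else case cut_after C q of [] \<Rightarrow> [[e]] | u # us \<Rightarrow> (e # u) # us)"

lemma concat_cut: "concat (cut_after C q) = q"
  by (induction q) (auto split: list.split)

lemma Nil_notin_cut: "[] \<notin> set (cut_after C q)"
  by (induction q) (auto split: list.split)

lemma last_cut: "q = [] \<or> last q \<in> C \<Longrightarrow> last ` set (cut_after C q) = C \<inter> set q"
proof (induction q)
  case Nil
  then show ?case by simp
next
  case (Cons e q)
  show ?case
  proof (cases "q = []")
    case True
    then show ?thesis using Cons.prems by auto
  next
    case False
    then have IH: "last ` set (cut_after C q) = C \<inter> set q" using Cons by auto
    show ?thesis
    proof (cases "cut_after C q")
      case Nil
      then show ?thesis using concat_cut[of C q] False by simp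
    next
      case (Cons u us)
      then have "u \<noteq> []" using Nil_notin_cut[of C q] by auto
      then show ?thesis using IH Cons by auto
    qed
  qed
qed

lemma cut_cong: "C \<inter> set q = C' \<inter> set q \<Longrightarrow> cut_after C q = cut_after C' q"
proof (induction q)
  case Nil
  then show ?case by simp
next
  case (Cons e q)
  have "C \<inter> set q = C' \<inter> set q" "e \<in> C \<longleftrightarrow> e \<in> C'" using Cons.prems by auto
  then show ?case using Cons.IH by simp
qed

lemma cut_append: "u \<noteq> [] \<Longrightarrow> last u \<in> C \<Longrightarrow> set (butlast u) \<inter> C = {} \<Longrightarrow> cut_after C (u @ q) = u # cut_after C q"
proof (induction u)
  case (Cons e u)
  then show ?case by (cases "u = []") auto
qed simp

lemma last_notin_butlast: "distinct u \<Longrightarrow> u \<noteq> [] \<Longrightarrow> last u \<notin> set (butlast u)"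
  by (metis append_butlast_last_id distinct_append not_distinct_conv_prefix)

lemma lasts_subset: "[] \<notin> set us \<Longrightarrow> last ` set us \<subseteq> set (concat us)"
  by (auto, metis last_in_set)

lemma cut_concat: "[] \<notin> set us \<Longrightarrow> distinct (concat us) \<Longrightarrow> cut_after (last ` set us) (concat us) = us"
proof (induction us)
  case Nil
  then show ?case by simp
next
  case (Cons u us)
  have u: "u \<noteq> []" "distinct u" using Cons.prems by auto
  have lasts: "last ` set us \<subseteq> set (concat us)" using Cons.prems(1) by (intro lasts_subset) simp
  have "set (butlast u) \<inter> last ` set (u # us) = {}"
    using Cons.prems(2) lasts last_notin_butlast[OF u(2,1)] by (auto dest!: in_set_butlastD)
  then have "cut_after (last ` set (u # us)) (u @ concat us) = u # cut_after (last ` set (u # us)) (concat us)"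
    using u by (intro cut_append) auto
  also have "cut_after (last ` set (u # us)) (concat us) = cut_after (last ` set us) (concat us)"
  proof (rule cut_cong)
    have "set u \<inter> set (concat us) = {}" using Cons.prems(2) by auto
    then have "last u \<notin> set (concat us)" using last_in_set[OF u(1)] by blast
    then show "last ` set (u # us) \<inter> set (concat us) = last ` set us \<inter> set (concat us)" by auto
  qed
  finally show ?case using Cons by simp
qed

text \<open>Each word contains one cut, its last letter, and the step back to the beginning of the cyclic
  word passes a cut as well. The remaining comparisons are those of neighbours within a word.\<close>

lemma antitone_along_concat:
  assumes "[] \<notin> set us" "distinct (concat us)" "us \<noteq> []"
  shows "cyclically_antitone a (concat us) (last ` set us) \<longleftrightarrow> (\<forall>u\<in>set us. antitone_along a u)"
proof -
  define R where "R = (\<lambda>C e f. e \<notin> C \<longrightarrow> a f \<le> a e)"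
  have cyc: "cyclically_antitone a q C \<longleftrightarrow> successively (R C) q" if "q \<noteq> []" "last q \<in> C" for q C
  proof -
    have "cyclically_antitone a q C \<longleftrightarrow> (\<forall>k. Suc k < length q \<longrightarrow> R C (q ! k) (q ! Suc k))"
    proof
      assume c: "cyclically_antitone a q C"
      show "\<forall>k. Suc k < length q \<longrightarrow> R C (q ! k) (q ! Suc k)"
        using c unfolding cyclically_antitone_def R_def by (metis Suc_lessD mod_less)
    next
      assume c: "\<forall>k. Suc k < length q \<longrightarrow> R C (q ! k) (q ! Suc k)"
      show "cyclically_antitone a q C"
        unfolding cyclically_antitone_def
      proof (intro allI impI)
        fix k assume k: "k < length q" "q ! k \<notin> C"
        have "Suc k \<noteq> length q" using that k by (metis diff_Suc_1 last_conv_nth)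
        then have "Suc k < length q" using k(1) by simp
        then show "a (q ! (Suc k mod length q)) \<le> a (q ! k)" using c k(2) by (simp add: R_def)
      qed
    qed
    then show ?thesis by (simp add: successively_conv_nth)
  qed
  have word: "successively (R C) u \<longleftrightarrow> antitone_along a u" if "distinct u" "C \<inter> set u = {last u}" "u \<noteq> []" for u C
  proof -
    have "antitone_along a u \<longleftrightarrow> successively (\<lambda>e f. a f \<le> a e) u"
      unfolding antitone_along_def by (intro successively_conv_sorted_wrt[symmetric]) (auto simp: transp_def)
    also have "\<dots> \<longleftrightarrow> successively (R C) u"
    proof -
      have "u ! k \<notin> C" if k: "Suc k < length u" for k
      proof
        assume "u ! k \<in> C"
        then have "u ! k = last u" using that(1) \<open>C \<inter> set u = {last u}\<close> k by (metis IntI Suc_lessD nth_mem singletonD)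
        then have "u ! k = u ! (length u - 1)" using \<open>u \<noteq> []\<close> by (simp add: last_conv_nth)
        then show False using \<open>distinct u\<close> k by (simp add: nth_eq_iff_index_eq)
      qed
      then show ?thesis by (auto simp: successively_conv_nth R_def)
    qed
    finally show ?thesis ..
  qed
  have main: "successively (R C) (concat us) \<longleftrightarrow> (\<forall>u\<in>set us. antitone_along a u)"
    if "[] \<notin> set us" "distinct (concat us)" "C \<inter> set (concat us) = last ` set us" for us C
    using that
  proof (induction us)
    case Nil
    then show ?case by simp
  next
    case (Cons u us)
    have u: "u \<noteq> []" "distinct u" "set u \<inter> set (concat us) = {}" using Cons.prems by auto
    have lasts: "last ` set us \<subseteq> set (concat us)" using Cons.prems(1) by (intro lasts_subset) simp
    have Cu: "C \<inter> set u = {last u}"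
    proof -
      have "C \<inter> set u = last ` set (u # us) \<inter> set u" using Cons.prems(3) by auto
      also have "\<dots> = {last u}" using lasts u by auto
      finally show ?thesis .
    qed
    have Cus: "C \<inter> set (concat us) = last ` set us"
    proof -
      have "C \<inter> set (concat us) = last ` set (u # us) \<inter> set (concat us)" using Cons.prems(3) by auto
      also have "\<dots> = last ` set us"
      proof -
        have "last u \<notin> set (concat us)" using u last_in_set[of u] by blast
        then show ?thesis using lasts by auto
      qed
      finally show ?thesis .
    qed
    have "R C (last u) f" for f using Cu by (auto simp: R_def)
    then have "successively (R C) (u @ concat us) \<longleftrightarrow> successively (R C) u \<and> successively (R C) (concat us)"
      by (auto simp: successively_append_iff)
    then show ?case using word[OF u(2) Cu u(1)] Cons.IH Cons.prems Cus by simp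
  qed
  have lasts: "last ` set us \<subseteq> set (concat us)" by (rule lasts_subset[OF assms(1)])
  have "concat us \<noteq> []" using assms(1,3) by (cases us) auto
  moreover have "last (concat us) \<in> last ` set us"
  proof -
    obtain vs v where us: "us = vs @ [v]" using assms(3) by (metis rev_exhaust)
    then have "last (concat us) = last v" using assms(1) by auto
    then show ?thesis using us by auto
  qed
  ultimately have "cyclically_antitone a (concat us) (last ` set us) \<longleftrightarrow> successively (R (last ` set us)) (concat us)"
    by (rule cyc)
  also have "\<dots> \<longleftrightarrow> (\<forall>u\<in>set us. antitone_along a u)"
    using lasts by (intro main[OF assms(1,2)]) (rule Int_absorb2)
  finally show ?thesis .
qed

lemma word_system_lists:
  assumes "finite E"
  shows "{us. [] \<notin> set us \<and> concat us \<in> permutations_of_set E \<and> length us = k} =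
    (\<Union>U\<in>word_systems E k. permutations_of_set U)"
proof (intro equalityI subsetI)
  fix us assume us: "us \<in> {us. [] \<notin> set us \<and> concat us \<in> permutations_of_set E \<and> length us = k}"
  then have d: "distinct (concat us)" and s: "set (concat us) = E" and ne: "[] \<notin> set us" and l: "length us = k"
    by (auto simp: permutations_of_set_def)
  have dus: "distinct us" using d ne by (simp add: distinct_concat_iff)
  have dis: "u = v" if "u \<in> set us" "v \<in> set us" "e \<in> set u" "e \<in> set v" for u v e
    using d that unfolding distinct_concat_iff by blast
  have "set us \<in> word_systems E k"
    unfolding word_systems_def
  proof (intro CollectI conjI ballI)
    show "partition_on E (set ` set us)"
    proof (rule partition_onI)
      show "\<Union>(set ` set us) = E" using s by simp
      show "{} \<notin> set ` set us" using ne by auto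
      show "disjnt p q" if "p \<in> set ` set us" "q \<in> set ` set us" "p \<noteq> q" for p q
        using that dis unfolding disjnt_def by blast
    qed
    show "inj_on set (set us)"
    proof (rule inj_onI)
      fix u v assume uv: "u \<in> set us" "v \<in> set us" "set u = set v"
      then have "hd u \<in> set u" using ne by (metis hd_in_set)
      then show "u = v" using dis[OF uv(1,2), of "hd u"] uv(3) by simp
    qed
    show "distinct u" if "u \<in> set us" for u using d that by (simp add: distinct_concat_iff)
    show "card (set us) = k" using dus l by (simp add: distinct_card)
  qed
  then show "us \<in> (\<Union>U\<in>word_systems E k. permutations_of_set U)"
    using dus by (auto simp: permutations_of_set_def)
next
  fix us assume "us \<in> (\<Union>U\<in>word_systems E k. permutations_of_set U)"
  then obtain U where U: "U \<in> word_systems E k" "set us = U" "distinct us" by (auto simp: permutations_of_set_def)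
  note Us = word_systemsD[OF U(1)]
  have "[] \<notin> set us" using Us(7) U(2) by blast
  moreover have "distinct (concat us)"
    unfolding distinct_concat_iff
  proof (intro conjI allI impI)
    show "distinct (removeAll [] us)" using U(3) by (simp add: distinct_removeAll)
    show "distinct ys" if "ys \<in> set us" for ys using Us(3) U(2) that by blast
    show "set ys \<inter> set zs = {}" if "ys \<in> set us \<and> zs \<in> set us \<and> ys \<noteq> zs" for ys zs
      using Us(8)[of ys zs] U(2) that by blast
  qed
  moreover have "set (concat us) = E" using Us(1) U(2) by (auto simp: partition_on_def)
  moreover have "length us = k" using U Us(4) by (metis distinct_card)
  ultimately show "us \<in> {us. [] \<notin> set us \<and> concat us \<in> permutations_of_set E \<and> length us = k}"
    by (auto simp: permutations_of_set_def)
qed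

text \<open>Both the normalisation that a distinguished letter is first and the one that the last letter is
  a cut select representatives of cyclic words, in the ratio \<open>1 : (j + 1)\<close> for \<open>j + 1\<close> cuts. In
  the second one the cut words are the lists of the words of a word system, in any of \<open>(j + 1)!\<close>
  orders. The quotient is \<open>j!\<close>.\<close>

theorem sum_cuts_of_permutations:
  fixes P :: "('e \<Rightarrow> real) set \<Rightarrow> bool"
  assumes E: "finite E" and e0: "e0 \<in> E"
  shows "(\<Sum>q\<in>{q \<in> permutations_of_set E. q ! 0 = e0}.
      card {C. C \<subseteq> E \<and> card C = Suc j \<and> P {a. cyclically_antitone a q C}}) =
    fact j * card {U \<in> word_systems E (Suc j). P {a. \<forall>u\<in>U. antitone_along a u}}"
proof -
  let ?P = "permutations_of_set E" and ?N = "card E"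
  let ?\<C> = "{C. C \<subseteq> E \<and> card C = Suc j}"
  define F :: "'e set \<Rightarrow> 'e list \<Rightarrow> nat" where "F C q = of_bool (P {a. cyclically_antitone a q C})" for C q
  define H :: "'e list set \<Rightarrow> nat" where "H U = of_bool (P {a. \<forall>u\<in>U. antitone_along a u})" for U
  define LU where "LU = {us. [] \<notin> set us \<and> concat us \<in> ?P \<and> length us = Suc j}"
  have fC: "finite ?\<C>" using E by (rule rev_finite_subset[OF iffD2[OF finite_Pow_iff]]) auto
  have N: "0 < ?N" using E e0 by (auto simp: card_gt_0_iff)
  have rot: "F C (rotate r q) = F C q" for C r q by (simp add: F_def cyclically_antitone_rotate)
  have lastq: "last q = q ! (?N - 1)" "q \<noteq> []" if "q \<in> ?P" for q
  proof -
    have "length q = ?N" using that by (auto simp: permutations_of_set_def distinct_card)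
    moreover from this show "q \<noteq> []" using N by auto
    ultimately show "last q = q ! (?N - 1)" by (simp add: last_conv_nth)
  qed
  have lhs: "(\<Sum>q\<in>{q \<in> ?P. q ! 0 = e0}. card {C. C \<subseteq> E \<and> card C = Suc j \<and> P {a. cyclically_antitone a q C}})
      = (\<Sum>C\<in>?\<C>. \<Sum>q\<in>?P. of_bool (q ! 0 = e0) * F C q)" (is "?L = _")
  proof -
    have "card {C. C \<subseteq> E \<and> card C = Suc j \<and> P {a. cyclically_antitone a q C}} = (\<Sum>C\<in>?\<C>. F C q)" for q
      using fC by (simp add: F_def of_bool_def sum.If_cases Int_def conj_assoc)
    then have "?L = (\<Sum>q\<in>{q \<in> ?P. q ! 0 = e0}. \<Sum>C\<in>?\<C>. F C q)" by simp
    also have "\<dots> = (\<Sum>q\<in>?P. of_bool (q ! 0 = e0) * (\<Sum>C\<in>?\<C>. F C q))"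
      by (rule sum.mono_neutral_cong_left) auto
    also have "\<dots> = (\<Sum>C\<in>?\<C>. \<Sum>q\<in>?P. of_bool (q ! 0 = e0) * F C q)"
      unfolding sum_distrib_left by (rule sum.swap)
    finally show ?thesis .
  qed
  \<comment> \<open>fixing \<open>e0\<close> at the front or \<open>e\<close> at the end gives the same sum, by rotation\<close>
  have move: "(\<Sum>q\<in>?P. of_bool (q ! 0 = e0) * F C q) = (\<Sum>q\<in>?P. of_bool (last q = e) * F C q)"
    if "e \<in> E" for C e
  proof -
    have "?N * (\<Sum>q\<in>?P. of_bool (q ! 0 = e0) * F C q) = ?N * (\<Sum>q\<in>?P. of_bool (q ! (?N - 1) = e) * F C q)"
      using sum_fixed_position[where F = "F C", OF E e0 N rot]
        sum_fixed_position[where F = "F C" and i = "?N - 1", OF E that _ rot] N by simp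
    then have "(\<Sum>q\<in>?P. of_bool (q ! 0 = e0) * F C q) = (\<Sum>q\<in>?P. of_bool (q ! (?N - 1) = e) * F C q)"
      using N by simp
    then show ?thesis using lastq(1) by simp
  qed
  have "Suc j * ?L = (\<Sum>C\<in>?\<C>. Suc j * (\<Sum>q\<in>?P. of_bool (q ! 0 = e0) * F C q))"
    unfolding lhs by (rule sum_distrib_left)
  also have "\<dots> = (\<Sum>C\<in>?\<C>. \<Sum>q\<in>?P. of_bool (last q \<in> C) * F C q)"
  proof (rule sum.cong[OF refl])
    fix C assume C: "C \<in> ?\<C>"
    then have fin: "finite C" using E by (auto intro: finite_subset)
    have "Suc j * (\<Sum>q\<in>?P. of_bool (q ! 0 = e0) * F C q) = (\<Sum>e\<in>C. \<Sum>q\<in>?P. of_bool (q ! 0 = e0) * F C q)"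
      using C by simp
    also have "\<dots> = (\<Sum>e\<in>C. \<Sum>q\<in>?P. of_bool (last q = e) * F C q)"
      by (rule sum.cong[OF refl], rule move) (use C in auto)
    also have "\<dots> = (\<Sum>q\<in>?P. (\<Sum>e\<in>C. of_bool (last q = e)) * F C q)"
      unfolding sum_distrib_right by (rule sum.swap)
    also have "\<dots> = (\<Sum>q\<in>?P. of_bool (last q \<in> C) * F C q)"
      using fin by (intro sum.cong refl) (simp add: of_bool_def)
    finally show "Suc j * (\<Sum>q\<in>?P. of_bool (q ! 0 = e0) * F C q) = (\<Sum>q\<in>?P. of_bool (last q \<in> C) * F C q)" .
  qed
  also have "\<dots> = (\<Sum>(C, q)\<in>?\<C> \<times> ?P. of_bool (last q \<in> C) * F C q)"
    by (rule sum.cartesian_product)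
  also have "\<dots> = (\<Sum>(C, q)\<in>{(C, q). C \<in> ?\<C> \<and> q \<in> ?P \<and> last q \<in> C}. F C q)"
    using fC by (intro sum.mono_neutral_cong_right) auto
  also have "\<dots> = (\<Sum>us\<in>LU. H (set us))"
  proof (rule sum.reindex_bij_witness[of _ "\<lambda>us. (last ` set us, concat us)" "\<lambda>(C, q). cut_after C q"])
    fix p assume p: "p \<in> {(C, q). C \<in> ?\<C> \<and> q \<in> ?P \<and> last q \<in> C}"
    then obtain C q where pq: "p = (C, q)" "C \<subseteq> E" "card C = Suc j" "q \<in> ?P" "last q \<in> C" by auto
    have lc: "last ` set (cut_after C q) = C" using last_cut[of q C] pq by (auto simp: permutations_of_set_def)
    have dc: "distinct (concat (cut_after C q))" using pq(4) by (simp add: concat_cut permutations_of_set_def)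
    show "(\<lambda>us. (last ` set us, concat us)) ((\<lambda>(C, q). cut_after C q) p) = p"
      using pq(1) lc concat_cut[of C q] by simp
    have inj: "inj_on last (set (cut_after C q))"
    proof (rule inj_onI)
      fix u v assume uv: "u \<in> set (cut_after C q)" "v \<in> set (cut_after C q)" "last u = last v"
      then have "u \<noteq> []" "v \<noteq> []" using Nil_notin_cut[of C q] by auto
      then have "last u \<in> set u" "last u \<in> set v" using uv(3) by (metis last_in_set)+
      then show "u = v" using dc uv(1,2) unfolding distinct_concat_iff by blast
    qed
    have "distinct (cut_after C q)" using dc Nil_notin_cut[of C q] by (simp add: distinct_concat_iff)
    then have "length (cut_after C q) = Suc j" using card_image[OF inj] lc pq(3) by (simp add: distinct_card)
    then show "(\<lambda>(C, q). cut_after C q) p \<in> LU"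
      using pq(1,4) concat_cut[of C q] Nil_notin_cut[of C q] by (simp add: LU_def)
    have "cut_after C q \<noteq> []" using concat_cut[of C q] lastq(2)[OF pq(4)] by auto
    then show "H (set ((\<lambda>(C, q). cut_after C q) p)) = (\<lambda>(C, q). F C q) p"
      using antitone_along_concat[OF Nil_notin_cut dc] pq(1) lc concat_cut[of C q] by (simp add: H_def F_def)
  next
    fix us assume us: "us \<in> LU"
    then have u: "[] \<notin> set us" "concat us \<in> ?P" "length us = Suc j" "distinct (concat us)" "us \<noteq> []"
      by (auto simp: LU_def permutations_of_set_def)
    show "(\<lambda>(C, q). cut_after C q) (last ` set us, concat us) = us" using cut_concat[OF u(1,4)] by simp
    have inj: "inj_on last (set us)"
    proof (rule inj_onI)
      fix v w assume vw: "v \<in> set us" "w \<in> set us" "last v = last w"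
      then have "v \<noteq> []" "w \<noteq> []" using u(1) by auto
      then have "last v \<in> set v" "last v \<in> set w" using vw(3) by (metis last_in_set)+
      then show "v = w" using u(4) vw(1,2) unfolding distinct_concat_iff by blast
    qed
    have "distinct us" using u(1,4) by (simp add: distinct_concat_iff)
    then have "card (last ` set us) = Suc j" using card_image[OF inj] u(3) by (simp add: distinct_card)
    moreover have "last ` set us \<subseteq> E"
    proof -
      have "last v \<in> set v" if "v \<in> set us" for v using that u(1) by (metis last_in_set)
      then have "last ` set us \<subseteq> set (concat us)" by auto
      then show ?thesis using u(2) by (simp add: permutations_of_set_def)
    qed
    moreover have "last (concat us) \<in> last ` set us"
    proof -
      obtain vs v where vs: "us = vs @ [v]" using u(5) by (metis rev_exhaust)
      then have "last (concat us) = last v" using u(1) by auto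
      then show ?thesis using vs by auto
    qed
    ultimately show "(last ` set us, concat us) \<in> {(C, q). C \<in> ?\<C> \<and> q \<in> ?P \<and> last q \<in> C}"
      using u(2) by simp
  qed
  also have "\<dots> = (\<Sum>U\<in>word_systems E (Suc j). \<Sum>us\<in>permutations_of_set U. H (set us))"
    unfolding LU_def word_system_lists[OF E]
  proof (rule sum.UNION_disjoint[OF finite_word_systems[OF E]])
    show "\<forall>U\<in>word_systems E (Suc j). finite (permutations_of_set U)" by simp
    show "\<forall>U\<in>word_systems E (Suc j). \<forall>V\<in>word_systems E (Suc j).
        U \<noteq> V \<longrightarrow> permutations_of_set U \<inter> permutations_of_set V = {}"
      by (auto simp: permutations_of_set_def)
  qed
  also have "\<dots> = (\<Sum>U\<in>word_systems E (Suc j). fact (Suc j) * H U)"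
  proof (rule sum.cong[OF refl])
    fix U assume U: "U \<in> word_systems E (Suc j)"
    have "(\<Sum>us\<in>permutations_of_set U. H (set us)) = (\<Sum>us\<in>permutations_of_set U. H U)"
      by (rule sum.cong) (auto simp: permutations_of_set_def)
    then show "(\<Sum>us\<in>permutations_of_set U. H (set us)) = fact (Suc j) * H U"
      using finite_word_system[OF E U] word_systemsD(4)[OF U] by simp
  qed
  also have "\<dots> = Suc j * (fact j * (\<Sum>U\<in>word_systems E (Suc j). H U))"
    by (simp add: sum_distrib_left algebra_simps)
  also have "(\<Sum>U\<in>word_systems E (Suc j). H U) = card {U \<in> word_systems E (Suc j). P {a. \<forall>u\<in>U. antitone_along a u}}"
    using finite_word_systems[OF E] by (simp add: H_def of_bool_def sum.If_cases Int_def)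
  finally show ?thesis by (rule Suc_mult_cancel1[THEN iffD1])
qed

section \<open>Faces and tangent cones of convex hulls of finite families\<close>

lemma convex_hull_image_finite:
  fixes S :: "'i \<Rightarrow> 'a::real_vector"
  assumes "finite A"
  shows "convex hull (S ` A) = {\<Sum>k\<in>A. u k *\<^sub>R S k | u. (\<forall>k\<in>A. 0 \<le> u k) \<and> sum u A = 1}" (is "_ = ?R")
proof
  show "convex hull (S ` A) \<subseteq> ?R"
  proof (rule hull_minimal)
    show "S ` A \<subseteq> ?R"
    proof
      fix y assume "y \<in> S ` A"
      then obtain k where k: "k \<in> A" "y = S k" by blast
      have "(\<Sum>l\<in>A. indicat_real {k} l *\<^sub>R S l) = S k"
        using assms k by (simp add: indicator_def of_bool_def if_distrib[of "\<lambda>t. t *\<^sub>R _"] cong: if_cong)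
      moreover have "sum (indicat_real {k}) A = 1" using assms k by (simp add: indicator_def of_bool_def)
      ultimately show "y \<in> ?R"
        using k by (intro CollectI exI[of _ "indicat_real {k}"]) auto
    qed
    show "convex ?R"
    proof (rule convexI)
      fix y z and s t :: real assume yz: "y \<in> ?R" "z \<in> ?R" "0 \<le> s" "0 \<le> t" "s + t = 1"
      obtain u v where u: "y = (\<Sum>k\<in>A. u k *\<^sub>R S k)" "\<forall>k\<in>A. 0 \<le> u k" "sum u A = 1"
        and v: "z = (\<Sum>k\<in>A. v k *\<^sub>R S k)" "\<forall>k\<in>A. 0 \<le> v k" "sum v A = 1"
        using yz(1,2) by blast
      let ?w = "\<lambda>k. s * u k + t * v k"
      have "s *\<^sub>R y + t *\<^sub>R z = (\<Sum>k\<in>A. ?w k *\<^sub>R S k)"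
        by (simp add: u(1) v(1) scaleR_sum_right scaleR_add_left sum.distrib)
      moreover have "sum ?w A = 1" using u(3) v(3) yz(5) by (simp add: sum.distrib flip: sum_distrib_left)
      moreover have "\<forall>k\<in>A. 0 \<le> ?w k" using u(2) v(2) yz(3,4) by simp
      ultimately show "s *\<^sub>R y + t *\<^sub>R z \<in> ?R" by (intro CollectI exI[of _ ?w]) auto
    qed
  qed
  show "?R \<subseteq> convex hull (S ` A)"
  proof
    fix y assume "y \<in> ?R"
    then obtain u where u: "y = (\<Sum>k\<in>A. u k *\<^sub>R S k)" "\<forall>k\<in>A. 0 \<le> u k" "sum u A = 1" by blast
    show "y \<in> convex hull (S ` A)"
      unfolding u(1) by (rule convex_sum[OF assms convex_convex_hull u(3)]) (use u(2) in \<open>auto intro: hull_inc\<close>)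
  qed
qed

text \<open>Faces are described by index sets rather than by point sets, because points of the family may
  coincide. The directions from the points with indices in \<open>I\<close> to all points generate the cone; the
  coefficients on \<open>I\<close> may have either sign.\<close>

definition tcone :: "('i \<Rightarrow> 'a::real_vector) \<Rightarrow> 'i set \<Rightarrow> 'i set \<Rightarrow> 'a set" where
  "tcone S A I = {\<Sum>k\<in>A. b k *\<^sub>R S k | b. sum b A = 0 \<and> (\<forall>k\<in>A - I. 0 \<le> b k)}"

text \<open>The affine relations between the points that are nonnegative outside \<open>I\<close> involve only \<open>I\<close>.
  The nonempty index sets with this property correspond to the nonempty faces of the convex hull.\<close>

definition exposed :: "('i \<Rightarrow> 'a::real_vector) \<Rightarrow> 'i set \<Rightarrow> 'i set \<Rightarrow> bool" where
  "exposed S A I \<longleftrightarrow> (\<forall>b. sum b A = 0 \<longrightarrow> (\<forall>k\<in>A - I. 0 \<le> b k) \<longrightarrow> (\<Sum>k\<in>A. b k *\<^sub>R S k) = 0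
    \<longrightarrow> (\<forall>k\<in>A - I. b k = 0))"

lemma tconeI: "sum b A = 0 \<Longrightarrow> (\<And>k. k \<in> A - I \<Longrightarrow> 0 \<le> b k) \<Longrightarrow> v = (\<Sum>k\<in>A. b k *\<^sub>R S k) \<Longrightarrow> v \<in> tcone S A I"
  unfolding tcone_def by blast

definition uniform_weight :: "'i set \<Rightarrow> 'i \<Rightarrow> real" where
  "uniform_weight I k = (if k \<in> I then 1 / card I else 0)"

lemma uniform_weight:
  assumes "finite A" "I \<subseteq> A" "I \<noteq> {}"
  shows "sum (uniform_weight I) A = 1" "\<And>k. 0 \<le> uniform_weight I k"
    "\<And>k. k \<in> I \<Longrightarrow> 0 < uniform_weight I k" "\<And>k. k \<notin> I \<Longrightarrow> uniform_weight I k = 0"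
    "(\<Sum>k\<in>A. uniform_weight I k *\<^sub>R S k) = (\<Sum>k\<in>I. uniform_weight I k *\<^sub>R (S k :: 'a::real_vector))"
proof -
  have fI: "finite I" "card I > 0" using assms by (auto intro: finite_subset simp: card_gt_0_iff)
  show "sum (uniform_weight I) A = 1"
  proof -
    have "sum (uniform_weight I) A = sum (uniform_weight I) I"
      using assms by (intro sum.mono_neutral_right) (auto simp: uniform_weight_def)
    also have "\<dots> = (\<Sum>k\<in>I. 1 / card I)" by (rule sum.cong) (auto simp: uniform_weight_def)
    finally show ?thesis using fI assms(3) by simp
  qed
  show "0 \<le> uniform_weight I k" for k by (simp add: uniform_weight_def)
  show "k \<in> I \<Longrightarrow> 0 < uniform_weight I k" for k using fI by (simp add: uniform_weight_def)
  show "k \<notin> I \<Longrightarrow> uniform_weight I k = 0" for k by (simp add: uniform_weight_def)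
  show "(\<Sum>k\<in>A. uniform_weight I k *\<^sub>R S k) = (\<Sum>k\<in>I. uniform_weight I k *\<^sub>R (S k :: 'a::real_vector))"
    using assms by (intro sum.mono_neutral_right) (auto simp: uniform_weight_def)
qed

lemma small_perturbation:
  fixes b l :: "'i \<Rightarrow> real"
  assumes "finite A" "\<And>k. k \<in> A \<Longrightarrow> 0 \<le> l k" "\<And>k. k \<in> A \<Longrightarrow> b k < 0 \<Longrightarrow> 0 < l k"
  obtains \<epsilon> where "\<epsilon> > 0" "\<And>k. k \<in> A \<Longrightarrow> 0 \<le> l k + \<epsilon> * b k"
proof -
  have "\<exists>\<epsilon>>0. \<forall>k\<in>A. 0 \<le> l k + \<epsilon> * b k"
    using assms
  proof (induction A rule: finite_induct)
    case empty
    show ?case by (intro exI[of _ 1]) simp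
  next
    case (insert k A)
    then obtain \<epsilon> where e: "\<epsilon> > 0" "\<forall>k\<in>A. 0 \<le> l k + \<epsilon> * b k" by auto
    have shrink: "0 \<le> l i + \<delta> * b i" if "i \<in> A" "0 < \<delta>" "\<delta> \<le> \<epsilon>" for i \<delta>
    proof (cases "0 \<le> b i")
      case True
      then show ?thesis using insert.prems(1)[of i] that by simp
    next
      case False
      then have "\<epsilon> * b i \<le> \<delta> * b i" using that by (intro mult_right_mono_neg) auto
      then show ?thesis using e(2) that by (smt (verit))
    qed
    show ?case
    proof (cases "0 \<le> b k")
      case True
      then have "0 \<le> l k + \<epsilon> * b k" using insert.prems(1)[of k] e(1) by simp
      then show ?thesis using e by auto
    next
      case False
      then have lk: "0 < l k" "b k < 0" using insert.prems(2)[of k] by auto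
      define \<delta> where "\<delta> = min \<epsilon> (l k / (- b k))"
      have "0 < l k / (- b k)" using lk by (intro divide_pos_pos) auto
      then have d: "\<delta> > 0" "\<delta> \<le> \<epsilon>" "\<delta> \<le> l k / (- b k)"
        using e(1) unfolding \<delta>_def by (simp_all only: min_less_iff_conj min.cobounded1 min.cobounded2)
      have "\<delta> * (- b k) \<le> l k" using d(3) lk(2) pos_le_divide_eq[of "- b k" \<delta> "l k"] by linarith
      then show ?thesis using d shrink by (intro exI[of _ \<delta>]) auto
    qed
  qed
  then show ?thesis using that by blast
qed

text \<open>Two convex representations of a point of the smaller hull differ by a relation that is
  nonnegative outside \<open>I\<close>, so every representation of such a point is supported on \<open>I\<close>. This
  property passes to the end points of a segment through the point.\<close>

lemma exposed_face:
  fixes S :: "'i \<Rightarrow> 'a::euclidean_space"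
  assumes A: "finite A" and I: "I \<subseteq> A" "I \<noteq> {}" and ex: "exposed S A I"
  shows "convex hull (S ` I) face_of convex hull (S ` A)" "{k \<in> A. S k \<in> convex hull (S ` I)} = I"
proof -
  have fI: "finite I" using A I by (auto intro: finite_subset)
  have rep: "\<exists>u. y = (\<Sum>k\<in>A. u k *\<^sub>R S k) \<and> (\<forall>k\<in>A. 0 \<le> u k) \<and> sum u A = 1 \<and> (\<forall>k\<in>A - I. u k = 0)"
    if y: "y \<in> convex hull (S ` I)" for y
  proof -
    obtain u where u: "y = (\<Sum>k\<in>I. u k *\<^sub>R S k)" "\<forall>k\<in>I. 0 \<le> u k" "sum u I = 1"
      using y unfolding convex_hull_image_finite[OF fI] by blast
    let ?u = "\<lambda>k. if k \<in> I then u k else 0"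
    have "(\<Sum>k\<in>A. ?u k *\<^sub>R S k) = (\<Sum>k\<in>I. u k *\<^sub>R S k)"
      using A I(1) by (intro sum.mono_neutral_cong_right) auto
    moreover have "sum ?u A = sum u I" using A I(1) by (intro sum.mono_neutral_cong_right) auto
    ultimately show ?thesis using u by (intro exI[of _ ?u]) auto
  qed
  have zero: "\<forall>k\<in>A - I. u k = 0"
    if u: "(\<Sum>k\<in>A. u k *\<^sub>R S k) \<in> convex hull (S ` I)" "\<forall>k\<in>A. 0 \<le> u k" "sum u A = 1" for u
  proof -
    obtain l where l: "(\<Sum>k\<in>A. u k *\<^sub>R S k) = (\<Sum>k\<in>A. l k *\<^sub>R S k)" "sum l A = 1" "\<forall>k\<in>A - I. l k = 0"
      using rep[OF u(1)] by blast
    have "sum (\<lambda>k. u k - l k) A = 0" using u(3) l(2) by (simp add: sum_subtractf)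
    moreover have "\<forall>k\<in>A - I. 0 \<le> u k - l k" using u(2) l(3) by simp
    moreover have "(\<Sum>k\<in>A. (u k - l k) *\<^sub>R S k) = 0" using l(1) by (simp add: scaleR_diff_left sum_subtractf)
    ultimately have "\<forall>k\<in>A - I. u k - l k = 0" using ex unfolding exposed_def by blast
    then show ?thesis using l(3) by simp
  qed
  have mem: "(\<Sum>k\<in>A. u k *\<^sub>R S k) \<in> convex hull (S ` I)"
    if u: "\<forall>k\<in>A. 0 \<le> u k" "sum u A = 1" "\<forall>k\<in>A - I. u k = 0" for u
  proof -
    have "(\<Sum>k\<in>A. u k *\<^sub>R S k) = (\<Sum>k\<in>I. u k *\<^sub>R S k)" "sum u A = sum u I"
      using A I(1) u(3) by (auto intro!: sum.mono_neutral_right)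
    then show ?thesis unfolding convex_hull_image_finite[OF fI] using u I(1) by auto
  qed
  show "convex hull (S ` I) face_of convex hull (S ` A)"
    unfolding face_of_def
  proof (intro conjI ballI impI)
    show "convex hull (S ` I) \<subseteq> convex hull (S ` A)" using I(1) by (intro hull_mono image_mono)
    show "convex (convex hull (S ` I))" by simp
    fix y z x assume y: "y \<in> convex hull (S ` A)" and z: "z \<in> convex hull (S ` A)"
      and x: "x \<in> convex hull (S ` I)" "x \<in> open_segment y z"
    obtain u v where u: "y = (\<Sum>k\<in>A. u k *\<^sub>R S k)" "\<forall>k\<in>A. 0 \<le> u k" "sum u A = 1"
      and v: "z = (\<Sum>k\<in>A. v k *\<^sub>R S k)" "\<forall>k\<in>A. 0 \<le> v k" "sum v A = 1"
      using y z unfolding convex_hull_image_finite[OF A] by blast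
    obtain t where t: "0 < t" "t < 1" "x = (1 - t) *\<^sub>R y + t *\<^sub>R z" using x(2) by (auto simp: in_segment)
    let ?w = "\<lambda>k. (1 - t) * u k + t * v k"
    have "x = (\<Sum>k\<in>A. ?w k *\<^sub>R S k)"
      by (simp add: t(3) u(1) v(1) scaleR_sum_right scaleR_add_left sum.distrib)
    moreover have "sum ?w A = 1" using u(3) v(3) by (simp add: sum.distrib flip: sum_distrib_left)
    moreover have "\<forall>k\<in>A. 0 \<le> ?w k" using u(2) v(2) t by simp
    ultimately have w0: "\<forall>k\<in>A - I. ?w k = 0" using zero[of ?w] x(1) by simp
    have "u k = 0 \<and> v k = 0" if k: "k \<in> A - I" for k
    proof -
      have "0 \<le> (1 - t) * u k" "0 \<le> t * v k" "(1 - t) * u k + t * v k = 0" using w0 u(2) v(2) t k by auto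
      then have "(1 - t) * u k = 0" "t * v k = 0" by linarith+
      then show ?thesis using t by simp
    qed
    then show "y \<in> convex hull (S ` I)" "z \<in> convex hull (S ` I)"
      unfolding u(1) v(1) using u(2,3) v(2,3) by (auto intro!: mem)
  qed
  show "{k \<in> A. S k \<in> convex hull (S ` I)} = I"
  proof (intro equalityI subsetI)
    fix k assume k: "k \<in> {k \<in> A. S k \<in> convex hull (S ` I)}"
    have "(\<Sum>l\<in>A. indicat_real {k} l *\<^sub>R S l) = S k"
      using A k by (simp add: indicator_def of_bool_def if_distrib[of "\<lambda>t. t *\<^sub>R _"] cong: if_cong)
    moreover have "sum (indicat_real {k}) A = 1" using A k by (simp add: indicator_def of_bool_def)
    ultimately have "\<forall>l\<in>A - I. indicat_real {k} l = 0" using zero[of "indicat_real {k}"] k by simp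
    then show "k \<in> I" using k by (auto simp: indicator_def)
  next
    fix k assume "k \<in> I"
    then show "k \<in> {k \<in> A. S k \<in> convex hull (S ` I)}" using I(1) by (auto intro: hull_inc)
  qed
qed

text \<open>A relation that is positive at an index \<open>k\<close> outside \<open>I\<close>, added with a small factor to the
  barycentre of the points in the face, represents this barycentre with a positive weight on
  \<open>S k\<close>. Then \<open>S k\<close> is in the face as well.\<close>

lemma face_exposed:
  fixes S :: "'i \<Rightarrow> 'a::euclidean_space"
  assumes A: "finite A" and F: "F face_of convex hull (S ` A)" "F \<noteq> {}"
  defines "I \<equiv> {k \<in> A. S k \<in> F}"
  shows "I \<noteq> {}" "exposed S A I" "F = convex hull (S ` I)"
proof -
  have cF: "convex F" by (rule face_of_imp_convex[OF F(1)])
  obtain S' where S': "S' \<subseteq> S ` A" "F = convex hull S'"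
    using face_of_convex_hull_subset[OF finite_imp_compact[OF finite_imageI[OF A]] F(1)] by blast
  have "S' \<subseteq> S ` I"
  proof
    fix y assume y: "y \<in> S'"
    then have "y \<in> S ` A" using S'(1) by blast
    moreover have "y \<in> F" unfolding S'(2) using y by (rule hull_inc)
    ultimately show "y \<in> S ` I" by (auto simp: I_def)
  qed
  then have "F \<subseteq> convex hull (S ` I)" unfolding S'(2) by (rule hull_mono)
  moreover have "convex hull (S ` I) \<subseteq> F" using cF by (intro hull_minimal) (auto simp: I_def)
  ultimately show Fe: "F = convex hull (S ` I)" by blast
  then show I0: "I \<noteq> {}" using F(2) by auto
  have IA: "I \<subseteq> A" by (auto simp: I_def)
  note w = uniform_weight[OF A IA I0]
  show "exposed S A I"
    unfolding exposed_def
  proof (intro allI impI ballI)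
    fix b k assume b: "sum b A = 0" "\<forall>k\<in>A - I. 0 \<le> b k" "(\<Sum>k\<in>A. b k *\<^sub>R S k) = 0" and k: "k \<in> A - I"
    show "b k = 0"
    proof (rule ccontr)
      assume "b k \<noteq> 0"
      then have bk: "b k > 0" using b(2) k by force
      obtain \<epsilon> where e: "\<epsilon> > 0" "\<And>i. i \<in> A \<Longrightarrow> 0 \<le> uniform_weight I i + \<epsilon> * b i"
      proof (rule small_perturbation[OF A, of "uniform_weight I" b])
        show "0 < uniform_weight I i" if "i \<in> A" "b i < 0" for i
          using that b(2) w(3)[of i] by force
      qed (use w(2) in auto)
      define u where "u i = uniform_weight I i + \<epsilon> * b i" for i
      have u: "sum u A = 1" "\<And>i. i \<in> A \<Longrightarrow> 0 \<le> u i"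
        using e(2) w(1) b(1) by (simp_all add: u_def sum.distrib flip: sum_distrib_left)
      define f0 where "f0 = (\<Sum>i\<in>A. u i *\<^sub>R S i)"
      have "f0 = (\<Sum>i\<in>A. uniform_weight I i *\<^sub>R S i) + \<epsilon> *\<^sub>R (\<Sum>i\<in>A. b i *\<^sub>R S i)"
        by (simp add: f0_def u_def scaleR_add_left sum.distrib scaleR_sum_right)
      also have "\<dots> = (\<Sum>i\<in>I. uniform_weight I i *\<^sub>R S i)" using b(3) w(5)[of S] by simp
      also have "\<dots> \<in> F"
      proof (rule convex_sum[OF finite_subset[OF IA A] cF])
        show "sum (uniform_weight I) I = 1"
          unfolding w(1)[symmetric] using w(4) A IA by (intro sum.mono_neutral_left) auto
      qed (use w(2) in \<open>auto simp: I_def\<close>)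
      finally have f0F: "f0 \<in> F" .
      have uk: "0 < u k" using bk e(1) k w(4) by (simp add: u_def)
      have split: "f0 = u k *\<^sub>R S k + (\<Sum>i\<in>A - {k}. u i *\<^sub>R S i)" "u k + sum u (A - {k}) = 1"
        using A k u(1) by (simp_all add: f0_def sum.remove[of A k])
      have SkQ: "S k \<in> convex hull (S ` A)" using k by (intro hull_inc) auto
      have "S k \<in> F"
      proof (cases "u k = 1")
        case True
        then have "sum u (A - {k}) = 0" using split(2) by simp
        then have "\<forall>i\<in>A - {k}. u i = 0" using A u(2) by (subst (asm) sum_nonneg_eq_0_iff) auto
        then have "f0 = S k" using split(1) True by simp
        then show ?thesis using f0F by simp
      next
        case False
        have s0: "0 \<le> sum u (A - {k})" using u(2) by (intro sum_nonneg) auto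
        define r where "r = 1 - u k"
        have r: "0 < r" "r = sum u (A - {k})" using split(2) s0 False by (auto simp: r_def)
        define z where "z = (\<Sum>i\<in>A - {k}. (u i / r) *\<^sub>R S i)"
        have zQ: "z \<in> convex hull (S ` A)"
          unfolding z_def using A u(2) r
          by (intro convex_sum) (auto intro: hull_inc simp flip: sum_divide_distrib)
        have f0z: "f0 = u k *\<^sub>R S k + r *\<^sub>R z"
          using r by (simp add: split(1) z_def scaleR_sum_right)
        show ?thesis
        proof (cases "z = S k")
          case True
          then have "f0 = S k" using f0z by (simp add: r_def flip: scaleR_add_left)
          then show ?thesis using f0F by simp
        next
          case False
          have "f0 \<in> open_segment z (S k)"
            unfolding in_segment using False uk r f0z by (intro conjI exI[of _ "u k"]) (auto simp: r_def algebra_simps)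
          then show ?thesis using face_ofD[OF F(1) _ zQ SkQ f0F] by blast
        qed
      qed
      then show False using k by (auto simp: I_def)
    qed
  qed
qed

text \<open>Taking all indices of points in the face makes the index set unique, even when points
  coincide.\<close>

lemma faces_of_dim_convex_hull:
  fixes S :: "'i \<Rightarrow> 'a::euclidean_space" and j :: nat
  assumes A: "finite A"
  defines "\<J> \<equiv> {I. I \<subseteq> A \<and> I \<noteq> {} \<and> exposed S A I \<and> aff_dim (S ` I) = int j}"
  shows "bij_betw (\<lambda>I. convex hull (S ` I)) \<J> (faces_of_dim j (convex hull (S ` A)))"
proof (rule bij_betwI[where g = "\<lambda>F. {k \<in> A. S k \<in> F}"])
  show "(\<lambda>I. convex hull (S ` I)) \<in> \<J> \<rightarrow> faces_of_dim j (convex hull (S ` A))"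
    using exposed_face(1)[OF A] by (auto simp: \<J>_def faces_of_dim_def aff_dim_convex_hull)
  show "(\<lambda>F. {k \<in> A. S k \<in> F}) \<in> faces_of_dim j (convex hull (S ` A)) \<rightarrow> \<J>"
  proof
    fix F assume "F \<in> faces_of_dim j (convex hull (S ` A))"
    then have F: "F face_of convex hull (S ` A)" "aff_dim F = int j" by (auto simp: faces_of_dim_def)
    then have ne: "F \<noteq> {}" by auto
    note f = face_exposed[OF A F(1) ne]
    have "aff_dim (S ` {k \<in> A. S k \<in> F}) = int j" using F(2) f(3) aff_dim_convex_hull by metis
    then show "{k \<in> A. S k \<in> F} \<in> \<J>" using f(1,2) by (auto simp: \<J>_def)
  qed
  show "{k \<in> A. S k \<in> convex hull (S ` I)} = I" if "I \<in> \<J>" for I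
    using exposed_face(2)[OF A] that by (auto simp: \<J>_def)
  show "convex hull (S ` {k \<in> A. S k \<in> F}) = F" if "F \<in> faces_of_dim j (convex hull (S ` A))" for F
  proof -
    have F: "F face_of convex hull (S ` A)" "F \<noteq> {}" using that by (auto simp: faces_of_dim_def)
    show ?thesis by (rule face_exposed(3)[OF A F, symmetric])
  qed
qed

text \<open>The tangent cone can be computed at the barycentre of the points with indices in \<open>I\<close>, whose
  weights on \<open>I\<close> are positive and leave room for coefficients of either sign.\<close>

lemma tangent_cone_convex_hull:
  fixes S :: "'i \<Rightarrow> 'a::euclidean_space"
  assumes A: "finite A" and I: "I \<subseteq> A" "I \<noteq> {}" and ex: "exposed S A I"
  shows "tangent_cone (convex hull (S ` A)) (convex hull (S ` I)) = tcone S A I"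
proof -
  have fI: "finite I" "card I > 0" using A I by (auto intro: finite_subset simp: card_gt_0_iff)
  note w = uniform_weight[OF A I]
  define f0 where "f0 = (\<Sum>i\<in>A. uniform_weight I i *\<^sub>R S i)"
  \<comment> \<open>coinciding points are collected, so that all points of the image get a positive weight\<close>
  have "f0 \<in> rel_interior (convex hull (S ` I))"
  proof -
    let ?u = "\<lambda>y. real (card {i \<in> I. S i = y}) / card I"
    have "f0 = (\<Sum>i\<in>I. (1 / card I) *\<^sub>R S i)"
      unfolding f0_def w(5)[of S] by (rule sum.cong) (auto simp: uniform_weight_def)
    also have "\<dots> = (\<Sum>y\<in>S ` I. \<Sum>i\<in>{i \<in> I. S i = y}. (1 / card I) *\<^sub>R S i)"
      by (rule sum.image_gen[OF fI(1)])
    also have "\<dots> = (\<Sum>y\<in>S ` I. ?u y *\<^sub>R y)"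
    proof (rule sum.cong[OF refl])
      fix y
      have "(\<Sum>i\<in>{i \<in> I. S i = y}. (1 / card I) *\<^sub>R S i) = (\<Sum>i\<in>{i \<in> I. S i = y}. (1 / card I) *\<^sub>R y)"
        by (rule sum.cong) auto
      also have "\<dots> = ?u y *\<^sub>R y" by (simp add: sum_constant_scaleR)
      finally show "(\<Sum>i\<in>{i \<in> I. S i = y}. (1 / card I) *\<^sub>R S i) = ?u y *\<^sub>R y" .
    qed
    finally have "(\<Sum>y\<in>S ` I. ?u y *\<^sub>R y) = f0" ..
    moreover have "sum ?u (S ` I) = 1"
    proof -
      have "(\<Sum>i\<in>I. 1::real) = (\<Sum>y\<in>S ` I. \<Sum>i\<in>{i \<in> I. S i = y}. 1)" by (rule sum.image_gen[OF fI(1)])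
      then have "(\<Sum>y\<in>S ` I. real (card {i \<in> I. S i = y})) = card I" by simp
      then show ?thesis using fI(2) by (simp flip: sum_divide_distrib)
    qed
    moreover have "0 < ?u y" if "y \<in> S ` I" for y
    proof -
      have "{i \<in> I. S i = y} \<noteq> {}" using that by auto
      then have "0 < card {i \<in> I. S i = y}" using fI(1) by (simp add: card_gt_0_iff)
      then show ?thesis using fI(2) by (intro divide_pos_pos) simp_all
    qed
    ultimately have "(\<forall>y\<in>S ` I. 0 < ?u y) \<and> sum ?u (S ` I) = 1 \<and> (\<Sum>y\<in>S ` I. ?u y *\<^sub>R y) = f0"
      by (intro conjI ballI)
    then show ?thesis
      by (intro subsetD[OF explicit_subset_rel_interior_convex_hull_minimal[OF finite_imageI[OF fI(1)]]]
          CollectI exI[of _ ?u])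
  qed
  then have T: "tangent_cone (convex hull (S ` A)) (convex hull (S ` I)) =
      {v. \<exists>\<epsilon>>0. f0 + \<epsilon> *\<^sub>R v \<in> convex hull (S ` A)}"
    by (intro tangent_cone_eq exposed_face(1)[OF A I ex]) auto
  show ?thesis unfolding T
  proof (intro equalityI subsetI)
    fix v assume "v \<in> {v. \<exists>\<epsilon>>0. f0 + \<epsilon> *\<^sub>R v \<in> convex hull (S ` A)}"
    then obtain \<epsilon> u where e: "\<epsilon> > 0" "f0 + \<epsilon> *\<^sub>R v = (\<Sum>k\<in>A. u k *\<^sub>R S k)" "\<forall>k\<in>A. 0 \<le> u k" "sum u A = 1"
      unfolding convex_hull_image_finite[OF A] by blast
    define b where "b k = (1 / \<epsilon>) * (u k - uniform_weight I k)" for k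
    have "\<epsilon> *\<^sub>R v = (\<Sum>k\<in>A. (u k - uniform_weight I k) *\<^sub>R S k)"
      using e(2) unfolding f0_def scaleR_diff_left sum_subtractf by (simp add: algebra_simps)
    then have "(1 / \<epsilon>) *\<^sub>R (\<epsilon> *\<^sub>R v) = (\<Sum>k\<in>A. b k *\<^sub>R S k)" by (simp add: b_def scaleR_sum_right)
    then have "v = (\<Sum>k\<in>A. b k *\<^sub>R S k)" using e(1) by simp
    moreover have "sum b A = 0"
      unfolding b_def sum_distrib_left[symmetric] sum_subtractf using e(4) w(1) by simp
    moreover have "0 \<le> b k" if "k \<in> A - I" for k using that e(1,3) w(4)[of k] by (simp add: b_def)
    ultimately show "v \<in> tcone S A I" by (intro tconeI)
  next
    fix v assume "v \<in> tcone S A I"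
    then obtain b where b: "v = (\<Sum>k\<in>A. b k *\<^sub>R S k)" "sum b A = 0" "\<forall>k\<in>A - I. 0 \<le> b k"
      unfolding tcone_def by blast
    obtain \<epsilon> where e: "\<epsilon> > 0" "\<And>i. i \<in> A \<Longrightarrow> 0 \<le> uniform_weight I i + \<epsilon> * b i"
    proof (rule small_perturbation[OF A, of "uniform_weight I" b])
      show "0 < uniform_weight I i" if "i \<in> A" "b i < 0" for i
        using that b(3) w(3)[of i] by force
    qed (use w(2) in auto)
    have "f0 + \<epsilon> *\<^sub>R v = (\<Sum>k\<in>A. (uniform_weight I k + \<epsilon> * b k) *\<^sub>R S k)"
      by (simp add: f0_def b(1) scaleR_sum_right scaleR_add_left sum.distrib)
    moreover have "sum (\<lambda>k. uniform_weight I k + \<epsilon> * b k) A = 1"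
      using w(1) b(2) by (simp add: sum.distrib flip: sum_distrib_left)
    ultimately have "f0 + \<epsilon> *\<^sub>R v \<in> convex hull (S ` A)"
      unfolding convex_hull_image_finite[OF A] using e(2)
      by (intro CollectI exI[of _ "\<lambda>k. uniform_weight I k + \<epsilon> * b k"]) auto
    then show "v \<in> {v. \<exists>\<epsilon>>0. f0 + \<epsilon> *\<^sub>R v \<in> convex hull (S ` A)}" using e(1) by blast
  qed
qed

section \<open>Solid angles and measurability\<close>

text \<open>Eliminating the coefficient of a point of the face removes the constraint on the sum of the
  coefficients, so that the rest can be approximated by rational ones.\<close>

lemma tcone_alt:
  fixes S :: "'i \<Rightarrow> 'a::real_vector"
  assumes A: "finite A" and i: "i \<in> I" "I \<subseteq> A"
  shows "tcone S A I = {\<Sum>k\<in>A - {i}. b k *\<^sub>R (S k - S i) | b. \<forall>k\<in>A - I. 0 \<le> b k}" (is "_ = ?R")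
proof (intro equalityI subsetI)
  have iA: "i \<in> A" using i by blast
  fix v assume "v \<in> tcone S A I"
  then obtain b where b: "v = (\<Sum>k\<in>A. b k *\<^sub>R S k)" "sum b A = 0" "\<forall>k\<in>A - I. 0 \<le> b k"
    unfolding tcone_def by blast
  have "sum b (A - {i}) = - b i" using b(2) sum.remove[OF A iA, of b] by simp
  then have "(\<Sum>k\<in>A - {i}. b k *\<^sub>R (S k - S i)) = (\<Sum>k\<in>A - {i}. b k *\<^sub>R S k) + b i *\<^sub>R S i"
    by (simp add: scaleR_diff_right sum_subtractf flip: scaleR_sum_left)
  also have "\<dots> = v" using b(1) sum.remove[OF A iA, of "\<lambda>k. b k *\<^sub>R S k"] by simp
  finally show "v \<in> ?R" using b(3) by blast
next
  have iA: "i \<in> A" using i by blast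
  fix v assume "v \<in> ?R"
  then obtain b where b: "v = (\<Sum>k\<in>A - {i}. b k *\<^sub>R (S k - S i))" "\<forall>k\<in>A - I. 0 \<le> b k" by blast
  let ?b = "b(i := - sum b (A - {i}))"
  have "(\<Sum>k\<in>A. ?b k *\<^sub>R S k) = ?b i *\<^sub>R S i + (\<Sum>k\<in>A - {i}. b k *\<^sub>R S k)"
    unfolding sum.remove[OF A iA] by (auto intro!: sum.cong)
  also have "\<dots> = v" unfolding b(1)
    by (simp add: scaleR_diff_right sum_subtractf flip: scaleR_sum_left)
  finally have "v = (\<Sum>k\<in>A. ?b k *\<^sub>R S k)" ..
  moreover have "sum ?b A = 0"
  proof -
    have "sum ?b (A - {i}) = sum b (A - {i})" by (rule sum.cong) auto
    then show ?thesis by (simp add: sum.remove[OF A iA])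
  qed
  moreover have "0 \<le> ?b k" if "k \<in> A - I" for k using that b(2) i(1) by auto
  ultimately show "v \<in> tcone S A I" by (intro tconeI)
qed

lemma convex_cone_tcone: "convex_cone (tcone S A I)"
proof -
  have 0: "0 \<in> tcone S A I" by (rule tconeI[of "\<lambda>_. 0"]) auto
  have add: "v + w \<in> tcone S A I" if vw: "v \<in> tcone S A I" "w \<in> tcone S A I" for v w
  proof -
    obtain b c where b: "v = (\<Sum>k\<in>A. b k *\<^sub>R S k)" "sum b A = 0" "\<forall>k\<in>A - I. 0 \<le> b k"
      and c: "w = (\<Sum>k\<in>A. c k *\<^sub>R S k)" "sum c A = 0" "\<forall>k\<in>A - I. 0 \<le> c k"
      using vw unfolding tcone_def by blast
    show ?thesis
      by (rule tconeI[of "\<lambda>k. b k + c k"]) (use b c in \<open>auto simp: sum.distrib scaleR_add_left\<close>)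
  qed
  have scale: "t *\<^sub>R v \<in> tcone S A I" if v: "v \<in> tcone S A I" "0 \<le> t" for t v
  proof -
    obtain b where b: "v = (\<Sum>k\<in>A. b k *\<^sub>R S k)" "sum b A = 0" "\<forall>k\<in>A - I. 0 \<le> b k"
      using v(1) unfolding tcone_def by blast
    show ?thesis
      by (rule tconeI[of "\<lambda>k. t * b k"]) (use b v(2) in \<open>auto simp: scaleR_sum_right simp flip: sum_distrib_left\<close>)
  qed
  show ?thesis using 0 add scale by (auto simp: convex_cone_def conic_def intro!: convexI)
qed

lemma difference_in_tcone:
  assumes "finite A" "i \<in> I" "I \<subseteq> A" "k \<in> A"
  shows "S k - S i \<in> tcone S A I" "k \<in> I \<Longrightarrow> S i - S k \<in> tcone S A I"
proof -
  have *: "r *\<^sub>R (S k - S i) \<in> tcone S A I" if r: "0 \<le> r \<or> k \<in> I" for r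
  proof (cases "k = i")
    case True
    then show ?thesis using convex_cone_contains_0[OF convex_cone_tcone] by auto
  next
    case False
    have "(\<Sum>l\<in>A - {i}. (if l = k then r else 0) *\<^sub>R (S l - S i)) = r *\<^sub>R (S k - S i)"
      using assms False by (simp add: if_distrib[of "\<lambda>t. t *\<^sub>R _"] cong: if_cong)
    then show ?thesis unfolding tcone_alt[OF assms(1-3)] using r by (intro CollectI exI[of _ "\<lambda>l. if l = k then r else 0"]) auto
  qed
  show "S k - S i \<in> tcone S A I" using *[of 1] by simp
  show "k \<in> I \<Longrightarrow> S i - S k \<in> tcone S A I" using *[of "-1"] by simp
qed

lemma closed_tcone:
  fixes S :: "'i \<Rightarrow> 'a::euclidean_space"
  assumes A: "finite A" and i: "i \<in> I" "I \<subseteq> A"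
  shows "closed (tcone S A I)"
proof -
  define G where "G = (\<lambda>k. S k - S i) ` A \<union> (\<lambda>k. S i - S k) ` I"
  have fin: "finite G" using A i(2) by (auto simp: G_def intro: finite_subset)
  have "tcone S A I = convex_cone hull G"
  proof
    show "convex_cone hull G \<subseteq> tcone S A I"
    proof (rule hull_minimal)
      show "convex_cone (tcone S A I)" by (rule convex_cone_tcone)
      show "G \<subseteq> tcone S A I" using difference_in_tcone[OF A i, of _ S] i(2) by (auto simp: G_def)
    qed
    show "tcone S A I \<subseteq> convex_cone hull G"
    proof
      fix v assume "v \<in> tcone S A I"
      then obtain b where b: "v = (\<Sum>k\<in>A - {i}. b k *\<^sub>R (S k - S i))" "\<forall>k\<in>A - I. 0 \<le> b k"
        unfolding tcone_alt[OF A i] by blast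
      have term_in: "b k *\<^sub>R (S k - S i) \<in> convex_cone hull G" if k: "k \<in> A" for k
      proof (cases "0 \<le> b k")
        case True
        have "S k - S i \<in> convex_cone hull G" using k by (intro hull_inc) (simp add: G_def)
        then show ?thesis using True by (rule convex_cone_hull_mul)
      next
        case False
        then have "k \<in> I" using b(2) k by auto
        then have "S i - S k \<in> convex_cone hull G" by (intro hull_inc) (simp add: G_def)
        then have "(- b k) *\<^sub>R (S i - S k) \<in> convex_cone hull G" using False by (intro convex_cone_hull_mul) auto
        then show ?thesis by (simp add: algebra_simps)
      qed
      have sums: "sum f B \<in> convex_cone hull G" if "finite B" "\<And>k. k \<in> B \<Longrightarrow> f k \<in> convex_cone hull G" for f and B :: "'i set"
        using that by (induction B rule: finite_induct) (simp_all add: convex_cone_hull_contains_0 convex_cone_hull_add)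
      show "v \<in> convex_cone hull G" unfolding b(1) by (rule sums) (use A term_in in auto)
    qed
  qed
  then show ?thesis using closed_convex_cone_hull[OF fin] by simp
qed

lemma tcone_linear_image:
  assumes "linear f"
  shows "f ` tcone S A I = tcone (\<lambda>k. f (S k)) A I"
proof -
  have f: "f (\<Sum>k\<in>A. b k *\<^sub>R S k) = (\<Sum>k\<in>A. b k *\<^sub>R f (S k))" for b
    using assms by (simp add: linear_sum linear_scale)
  show ?thesis unfolding tcone_def by (auto simp: f image_iff) (metis f)+
qed

text \<open>The cone is closed, and its elements are limits of combinations with rational coefficients.
  Membership thus becomes a countable condition in the points, whatever their position.\<close>

lemma tcone_approximation:
  fixes S :: "'i \<Rightarrow> 'a::euclidean_space"
  assumes A: "finite A" and i: "i \<in> I" "I \<subseteq> A"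
  defines "Q \<equiv> PiE (A - {i}) (\<lambda>k. if k \<in> I then \<rat> else {q \<in> \<rat>. 0 \<le> q})"
  shows "v \<in> tcone S A I \<longleftrightarrow> (\<forall>m::nat. \<exists>q\<in>Q. norm (v - (\<Sum>k\<in>A - {i}. q k *\<^sub>R (S k - S i))) < 1 / Suc m)"
    and "countable Q"
proof -
  have "countable {q \<in> \<rat>. 0 \<le> (q::real)}" by (rule countable_subset[OF _ countable_rat]) auto
  then show "countable Q" unfolding Q_def using A countable_rat by (intro countable_PiE) auto
  have Qin: "(\<Sum>k\<in>A - {i}. q k *\<^sub>R (S k - S i)) \<in> tcone S A I" if "q \<in> Q" for q
  proof -
    have "0 \<le> q k" if k: "k \<in> A - I" for k
    proof -
      have "k \<in> A - {i}" using k i(1) by auto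
      from PiE_mem[OF \<open>q \<in> Q\<close>[unfolded Q_def] this] show ?thesis using k by simp
    qed
    then show ?thesis unfolding tcone_alt[OF A i] by blast
  qed
  show "v \<in> tcone S A I \<longleftrightarrow> (\<forall>m::nat. \<exists>q\<in>Q. norm (v - (\<Sum>k\<in>A - {i}. q k *\<^sub>R (S k - S i))) < 1 / Suc m)"
  proof
    assume "v \<in> tcone S A I"
    then obtain b where b: "v = (\<Sum>k\<in>A - {i}. b k *\<^sub>R (S k - S i))" "\<forall>k\<in>A - I. 0 \<le> b k"
      unfolding tcone_alt[OF A i] by blast
    show "\<forall>m::nat. \<exists>q\<in>Q. norm (v - (\<Sum>k\<in>A - {i}. q k *\<^sub>R (S k - S i))) < 1 / Suc m"
    proof
      fix m :: nat
      define N where "N = (\<Sum>k\<in>A - {i}. norm (S k - S i))"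
      have N: "0 \<le> N" unfolding N_def by (rule sum_nonneg) simp
      define \<delta> where "\<delta> = 1 / (Suc m * (N + 1))"
      have \<delta>: "\<delta> > 0" using N by (simp add: \<delta>_def)
      \<comment> \<open>approximating from above keeps nonnegative coefficients nonnegative\<close>
      have "\<exists>r\<in>\<rat>. b k < r \<and> r < b k + \<delta>" for k using Rats_dense_in_real[of "b k" "b k + \<delta>"] \<delta> by auto
      then obtain r where r: "\<And>k. r k \<in> \<rat>" "\<And>k. b k < r k" "\<And>k. r k < b k + \<delta>" by metis
      let ?q = "restrict r (A - {i})"
      have "?q \<in> Q" unfolding Q_def
      proof (rule restrict_PiE_iff[THEN iffD2], rule ballI)
        fix k assume k: "k \<in> A - {i}"
        show "r k \<in> (if k \<in> I then \<rat> else {q \<in> \<rat>. 0 \<le> q})"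
          using r(1)[of k] r(2)[of k] b(2) k by (auto intro: order_trans less_imp_le)
      qed
      moreover have "norm (v - (\<Sum>k\<in>A - {i}. ?q k *\<^sub>R (S k - S i))) < 1 / Suc m"
      proof -
        have "v - (\<Sum>k\<in>A - {i}. ?q k *\<^sub>R (S k - S i)) = (\<Sum>k\<in>A - {i}. (b k - r k) *\<^sub>R (S k - S i))"
          by (simp add: b(1) scaleR_diff_left flip: sum_subtractf)
        also have "norm \<dots> \<le> (\<Sum>k\<in>A - {i}. norm ((b k - r k) *\<^sub>R (S k - S i)))" by (rule norm_sum)
        also have "\<dots> \<le> (\<Sum>k\<in>A - {i}. \<delta> * norm (S k - S i))"
        proof (rule sum_mono)
          fix k
          have "\<bar>b k - r k\<bar> \<le> \<delta>" using r(2)[of k] r(3)[of k] by simp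
          then show "norm ((b k - r k) *\<^sub>R (S k - S i)) \<le> \<delta> * norm (S k - S i)"
            by (simp add: mult_right_mono)
        qed
        also have "\<dots> = \<delta> * N" by (simp add: N_def sum_distrib_left)
        also have "\<dots> < \<delta> * (N + 1)" using \<delta> by simp
        also have "\<dots> = 1 / Suc m" using N by (simp add: \<delta>_def)
        finally show ?thesis .
      qed
      ultimately show "\<exists>q\<in>Q. norm (v - (\<Sum>k\<in>A - {i}. q k *\<^sub>R (S k - S i))) < 1 / Suc m" by blast
    qed
  next
    assume *: "\<forall>m::nat. \<exists>q\<in>Q. norm (v - (\<Sum>k\<in>A - {i}. q k *\<^sub>R (S k - S i))) < 1 / Suc m"
    have "v \<in> closure (tcone S A I)"
      unfolding closure_approachable
    proof (intro allI impI)
      fix e :: real assume "e > 0"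
      then obtain m where m: "1 / Suc m < e" using nat_approx_posE by blast
      obtain q where q: "q \<in> Q" "norm (v - (\<Sum>k\<in>A - {i}. q k *\<^sub>R (S k - S i))) < 1 / Suc m" using * by blast
      then have "dist (\<Sum>k\<in>A - {i}. q k *\<^sub>R (S k - S i)) v < e" using m by (simp add: dist_norm norm_minus_commute)
      then show "\<exists>y\<in>tcone S A I. dist y v < e" using Qin[OF q(1)] by blast
    qed
    then show "v \<in> tcone S A I" using closure_closed[OF closed_tcone[OF A i, of S]] by blast
  qed
qed

lemma measurable_in_tcone:
  fixes S :: "'i \<Rightarrow> 'w \<Rightarrow> 'a::euclidean_space"
  assumes A: "finite A" and I: "I \<subseteq> A" "I \<noteq> {}"
    and [measurable]: "v \<in> borel_measurable M" and S: "\<And>k. k \<in> A \<Longrightarrow> S k \<in> borel_measurable M"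
  shows "Measurable.pred M (\<lambda>\<omega>. v \<omega> \<in> tcone (\<lambda>k. S k \<omega>) A I)"
proof -
  obtain i where i: "i \<in> I" using I by blast
  then have [measurable]: "S i \<in> borel_measurable M" using S I(1) by blast
  let ?Q = "PiE (A - {i}) (\<lambda>k. if k \<in> I then \<rat> else {q \<in> \<rat>. 0 \<le> (q::real)})"
  have [measurable]: "(\<lambda>\<omega>. \<Sum>k\<in>A - {i}. q k *\<^sub>R (S k \<omega> - S i \<omega>)) \<in> borel_measurable M" for q
    using S by (intro borel_measurable_sum borel_measurable_scaleR borel_measurable_diff) auto
  note Q = tcone_approximation[OF A i I(1)]
  let ?P = "\<lambda>m q \<omega>. norm (v \<omega> - (\<Sum>k\<in>A - {i}. q k *\<^sub>R (S k \<omega> - S i \<omega>))) < 1 / Suc m"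
  have "Measurable.pred M (\<lambda>\<omega>. \<exists>q\<in>?Q. ?P m q \<omega>)" for m :: nat
  proof -
    have "{\<omega> \<in> space M. ?P m q \<omega>} \<in> sets M" for q by measurable
    then have "{\<omega> \<in> space M. \<exists>q\<in>?Q. ?P m q \<omega>} \<in> sets M"
      using Q(2) by (intro sets.sets_Collect_countable_Ex')
    then show ?thesis by (simp add: pred_def)
  qed
  then have "Measurable.pred M (\<lambda>\<omega>. \<forall>m::nat. \<exists>q\<in>?Q. ?P m q \<omega>)"
    by (rule pred_intros_countable(1))
  then show ?thesis unfolding Q(1) .
qed

text \<open>A relation with a positive coefficient at \<open>k\<close> can be solved for \<open>S i - S k\<close>. In this form
  exposedness is a statement about membership in cones, hence measurable.\<close>

lemma exposed_iff:
  assumes A: "finite A" and i: "i \<in> I" "I \<subseteq> A"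
  shows "exposed S A I \<longleftrightarrow> (\<forall>k\<in>A - I. S i - S k \<notin> tcone S A I)"
proof
  assume ex: "exposed S A I"
  show "\<forall>k\<in>A - I. S i - S k \<notin> tcone S A I"
  proof
    fix k assume k: "k \<in> A - I"
    show "S i - S k \<notin> tcone S A I"
    proof
      assume "S i - S k \<in> tcone S A I"
      then obtain b where b: "S i - S k = (\<Sum>l\<in>A. b l *\<^sub>R S l)" "sum b A = 0" "\<forall>l\<in>A - I. 0 \<le> b l"
        unfolding tcone_def by blast
      let ?c = "\<lambda>l. b l + (if l = k then 1 else 0) + (if l = i then - 1 else 0)"
      have iA: "i \<in> A" using i by blast
      have "sum ?c A = 0" using A b(2) iA k by (simp add: sum.distrib)
      moreover have "\<forall>l\<in>A - I. 0 \<le> ?c l" using b(3) i(1) by auto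
      moreover have "(\<Sum>l\<in>A. ?c l *\<^sub>R S l) = 0"
      proof -
        have "(\<Sum>l\<in>A. ?c l *\<^sub>R S l) = (\<Sum>l\<in>A. b l *\<^sub>R S l) + (\<Sum>l\<in>A. if l = k then S l else 0) + (\<Sum>l\<in>A. if l = i then - S l else 0)"
          unfolding sum.distrib[symmetric] by (rule sum.cong) (auto simp: scaleR_add_left)
        also have "\<dots> = 0" using A iA k by (simp flip: b(1))
        finally show ?thesis .
      qed
      ultimately have "?c k = 0" using ex k unfolding exposed_def by blast
      moreover have "k \<noteq> i" using k i(1) by auto
      ultimately show False using b(3) k by force
    qed
  qed
next
  assume *: "\<forall>k\<in>A - I. S i - S k \<notin> tcone S A I"
  show "exposed S A I"
    unfolding exposed_def
  proof (intro allI impI ballI)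
    fix b k assume b: "sum b A = 0" "\<forall>k\<in>A - I. 0 \<le> b k" "(\<Sum>k\<in>A. b k *\<^sub>R S k) = 0" and k: "k \<in> A - I"
    show "b k = 0"
    proof (rule ccontr)
      assume "b k \<noteq> 0"
      then have bk: "b k > 0" using b(2) k by force
      let ?c = "\<lambda>l. b l / b k + (if l = k then - 1 else 0) + (if l = i then 1 else 0)"
      have iA: "i \<in> A" using i by blast
      have "S i - S k \<in> tcone S A I"
      proof (rule tconeI[of ?c])
        show "sum ?c A = 0" using A b(1) iA k by (simp add: sum.distrib flip: sum_divide_distrib)
        show "0 \<le> ?c l" if "l \<in> A - I" for l using b(2) that bk i(1) by auto
        have "(\<Sum>l\<in>A. ?c l *\<^sub>R S l) = (\<Sum>l\<in>A. (1 / b k) *\<^sub>R (b l *\<^sub>R S l)) + (\<Sum>l\<in>A. if l = k then - S l else 0) + (\<Sum>l\<in>A. if l = i then S l else 0)"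
          unfolding sum.distrib[symmetric] by (rule sum.cong) (auto simp: scaleR_add_left)
        also have "(\<Sum>l\<in>A. (1 / b k) *\<^sub>R (b l *\<^sub>R S l)) = 0" unfolding scaleR_sum_right[symmetric] b(3) by simp
        finally show "S i - S k = (\<Sum>l\<in>A. ?c l *\<^sub>R S l)" using A iA k by simp
      qed
      then show False using * k by blast
    qed
  qed
qed

lemma measurable_exposed:
  fixes S :: "'i \<Rightarrow> 'w \<Rightarrow> 'a::euclidean_space"
  assumes A: "finite A" and I: "I \<subseteq> A" "I \<noteq> {}" and S: "\<And>k. k \<in> A \<Longrightarrow> S k \<in> borel_measurable M"
  shows "Measurable.pred M (\<lambda>\<omega>. exposed (\<lambda>k. S k \<omega>) A I)"
proof -
  obtain i where i: "i \<in> I" using I by blast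
  have "Measurable.pred M (\<lambda>\<omega>. \<forall>k\<in>A - I. \<not> (S i \<omega> - S k \<omega> \<in> tcone (\<lambda>k. S k \<omega>) A I))"
  proof (rule pred_intros_finite(3))
    show "finite (A - I)" using A by simp
    fix k assume "k \<in> A - I"
    then have "Measurable.pred M (\<lambda>\<omega>. S i \<omega> - S k \<omega> \<in> tcone (\<lambda>k. S k \<omega>) A I)"
      using i I(1) by (intro measurable_in_tcone[OF A I] borel_measurable_diff S) auto
    then show "Measurable.pred M (\<lambda>\<omega>. \<not> (S i \<omega> - S k \<omega> \<in> tcone (\<lambda>k. S k \<omega>) A I))"
      by measurable
  qed
  then show ?thesis unfolding exposed_iff[OF A i I(1)] .
qed

text \<open>For \<open>I = A\<close> there are no sign constraints and the cone is the direction space. The dimension of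
  the affine hull can thus be determined by adding the points one by one.\<close>

lemma affine_hull_tcone:
  fixes S :: "'i \<Rightarrow> 'a::real_vector"
  assumes J: "finite J" and i: "i \<in> J"
  shows "y \<in> affine hull (S ` J) \<longleftrightarrow> y - S i \<in> tcone S J J"
proof -
  have "affine hull (S ` J) = (\<lambda>v. S i + v) ` span ((\<lambda>y. - S i + y) ` (S ` J))"
    by (rule affine_hull_span_gen[OF hull_inc]) (use i in simp)
  then have hull: "affine hull (S ` J) = (\<lambda>v. S i + v) ` span ((\<lambda>y. y - S i) ` (S ` J))" by simp
  have "span ((\<lambda>y. y - S i) ` (S ` J)) = tcone S J J"
  proof
    have "subspace (tcone S J J)"
    proof (rule subspaceI)
      show "0 \<in> tcone S J J" using convex_cone_contains_0[OF convex_cone_tcone] .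
      show "v + w \<in> tcone S J J" if "v \<in> tcone S J J" "w \<in> tcone S J J" for v w
        using that convex_cone_add[OF convex_cone_tcone] by blast
      show "t *\<^sub>R v \<in> tcone S J J" if v: "v \<in> tcone S J J" for t v
      proof -
        obtain b where "v = (\<Sum>k\<in>J. b k *\<^sub>R S k)" "sum b J = 0" using v unfolding tcone_def by blast
        then show ?thesis
          by (intro tconeI[of "\<lambda>k. t * b k"]) (auto simp: scaleR_sum_right simp flip: sum_distrib_left)
      qed
    qed
    then show "span ((\<lambda>y. y - S i) ` (S ` J)) \<subseteq> tcone S J J"
      using difference_in_tcone(1)[OF J i order_refl] by (intro span_minimal) auto
    show "tcone S J J \<subseteq> span ((\<lambda>y. y - S i) ` (S ` J))"
      unfolding tcone_alt[OF J i order_refl] by (auto intro!: span_sum span_scale intro: span_base)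
  qed
  then have "y \<in> affine hull (S ` J) \<longleftrightarrow> y \<in> (\<lambda>v. S i + v) ` tcone S J J" using hull by simp
  also have "\<dots> \<longleftrightarrow> y - S i \<in> tcone S J J"
  proof
    assume "y - S i \<in> tcone S J J"
    then show "y \<in> (\<lambda>v. S i + v) ` tcone S J J" by (intro image_eqI[of _ _ "y - S i"]) auto
  qed auto
  finally show ?thesis .
qed

lemma measurable_aff_dim:
  fixes S :: "'i \<Rightarrow> 'w \<Rightarrow> 'a::euclidean_space"
  assumes "finite J" and S: "\<And>k. k \<in> J \<Longrightarrow> S k \<in> borel_measurable M"
  shows "Measurable.pred M (\<lambda>\<omega>. aff_dim ((\<lambda>k. S k \<omega>) ` J) = r)"
  using assms
proof (induction J arbitrary: r rule: finite_induct)
  case empty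
  then show ?case by simp
next
  case (insert k J)
  show ?case
  proof (cases "J = {}")
    case True
    then show ?thesis by simp
  next
    case False
    then obtain i where i: "i \<in> J" by blast
    have IH: "Measurable.pred M (\<lambda>\<omega>. aff_dim ((\<lambda>k. S k \<omega>) ` J) = r)" for r using insert by simp
    have h: "Measurable.pred M (\<lambda>\<omega>. S k \<omega> - S i \<omega> \<in> tcone (\<lambda>k. S k \<omega>) J J)"
      using insert i by (intro measurable_in_tcone borel_measurable_diff) auto
    have eq: "aff_dim ((\<lambda>k. S k \<omega>) ` insert k J) = r \<longleftrightarrow>
        (S k \<omega> - S i \<omega> \<in> tcone (\<lambda>k. S k \<omega>) J J \<and> aff_dim ((\<lambda>k. S k \<omega>) ` J) = r) \<or>
        (\<not> (S k \<omega> - S i \<omega> \<in> tcone (\<lambda>k. S k \<omega>) J J) \<and> aff_dim ((\<lambda>k. S k \<omega>) ` J) = r - 1)" for \<omega>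
      using affine_hull_tcone[OF insert(1) i, of "S k \<omega>" "\<lambda>k. S k \<omega>"] by (auto simp: aff_dim_insert)
    show ?thesis unfolding eq
      by (intro pred_intros_logic IH h)
  qed
qed

text \<open>The frame operator of the differences, \<open>\<Sum> v v\<^sup>T\<close>. Its kernel is the orthogonal complement of
  their span, so it identifies a vector with its projection to the span and is injective there.
  This replaces the projection, whose dependence on the points is not continuous, by a polynomial
  expression in them.\<close>

definition frame :: "('i \<Rightarrow> 'a::euclidean_space) \<Rightarrow> 'i set \<Rightarrow> 'i \<Rightarrow> 'a \<Rightarrow> 'a" where
  "frame S A i x = (\<Sum>k\<in>A. ((S k - S i) \<bullet> x) *\<^sub>R (S k - S i))"

lemma linear_frame: "linear (frame S A i)"
  unfolding frame_def
  by (intro linearI) (simp_all add: inner_add_right scaleR_add_left sum.distrib scaleR_sum_right)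

lemma frame_kernel:
  assumes "finite A" "frame S A i x = 0" "k \<in> A"
  shows "(S k - S i) \<bullet> x = 0"
proof -
  have "(\<Sum>k\<in>A. ((S k - S i) \<bullet> x)\<^sup>2) = frame S A i x \<bullet> x"
    by (simp add: frame_def inner_sum_left power2_eq_square)
  then have "(\<Sum>k\<in>A. ((S k - S i) \<bullet> x)\<^sup>2) = 0" using assms(2) by simp
  then have "\<forall>k\<in>A. ((S k - S i) \<bullet> x)\<^sup>2 = 0" using assms(1) by (subst (asm) sum_nonneg_eq_0_iff) auto
  then show ?thesis using assms(3) by simp
qed

text \<open>A cone contains a nonzero vector together with its normalisation, so the uniform distribution on
  the sphere may be replaced by the projected Gaussian. The convention for subspaces agrees with
  this formula.\<close>

lemma solid_angle_convex_cone:
  fixes T :: "'a::euclidean_space set"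
  assumes T: "convex_cone T" "closed T"
  shows "solid_angle T = measure std_gaussian {x. closest_point (span T) x \<in> T}"
proof (cases "subspace T")
  case True
  have "closest_point (span T) x \<in> span T" for x
    by (rule closest_point_in_set[OF closed_subspace[OF subspace_span]]) (use span_zero in blast)
  moreover have "span T = T" using True by simp
  ultimately have "closest_point (span T) x \<in> T" for x by metis
  then show ?thesis
    using True prob_space.prob_space[OF prob_space_std_gaussian] by (simp add: solid_angle_def)
next
  case False
  have c: "conic T" "0 \<in> T" using T(1) by (auto simp: convex_cone_def convex_cone_contains_0 T(1))
  have iff: "sgn y \<in> T \<longleftrightarrow> y \<in> T" for y
  proof (cases "y = 0")
    case True
    then show ?thesis using c(2) by simp
  next
    case False
    then have "y = norm y *\<^sub>R sgn y" by (simp add: sgn_div_norm)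
    then show ?thesis using conic_mul[OF c(1)] by (metis norm_ge_zero inverse_nonnegative_iff_nonnegative sgn_div_norm)
  qed
  have "measure (uniform_sphere (span T)) T =
      measure std_gaussian ((\<lambda>x. sgn (closest_point (span T) x)) -` T \<inter> space std_gaussian)"
    unfolding uniform_sphere_def
    using measurable_sgn_closest_point[OF subspace_span, of T] T(2)
    by (intro measure_distr) (auto simp: borel_closed)
  also have "(\<lambda>x. sgn (closest_point (span T) x)) -` T \<inter> space std_gaussian = {x. closest_point (span T) x \<in> T}"
    using iff by auto
  finally show ?thesis using False by (simp add: solid_angle_def)
qed

lemma solid_angle_tcone:
  fixes S :: "'i \<Rightarrow> 'a::euclidean_space"
  assumes A: "finite A" and i: "i \<in> I" "I \<subseteq> A"
  shows "solid_angle (tcone S A I) =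
    measure std_gaussian {x. frame S A i x \<in> tcone (\<lambda>k. frame S A i (S k)) A I}"
proof -
  let ?T = "tcone S A I" and ?f = "frame S A i"
  have "closest_point (span ?T) x \<in> ?T \<longleftrightarrow> ?f x \<in> ?f ` ?T" for x
  proof -
    let ?p = "closest_point (span ?T) x"
    have pin: "?p \<in> span ?T"
      by (rule closest_point_in_set[OF closed_subspace[OF subspace_span]]) (use span_zero in blast)
    have gens: "S k - S i \<in> span ?T" if "k \<in> A" for k
      using difference_in_tcone(1)[OF A i that] by (rule span_base)
    have "(S k - S i) \<bullet> (x - ?p) = 0" if "k \<in> A" for k
      using closest_point_subspace_orthogonal[OF subspace_span gens[OF that], of x] by (simp add: inner_commute)
    then have "?f (x - ?p) = 0" by (simp add: frame_def)
    then have fx: "?f x = ?f ?p" using linear_diff[OF linear_frame] by (metis eq_iff_diff_eq_0)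
    have inj: "?p = t" if t: "t \<in> ?T" "?f ?p = ?f t" for t
    proof -
      have "?f (?p - t) = 0" using t(2) linear_diff[OF linear_frame] by (metis eq_iff_diff_eq_0)
      then have orth: "(S k - S i) \<bullet> (?p - t) = 0" if "k \<in> A" for k using frame_kernel[OF A] that by blast
      have "?T \<subseteq> {y. (?p - t) \<bullet> y = 0}"
      proof
        fix y assume "y \<in> ?T"
        then obtain b where "y = (\<Sum>k\<in>A - {i}. b k *\<^sub>R (S k - S i))" unfolding tcone_alt[OF A i] by blast
        then show "y \<in> {y. (?p - t) \<bullet> y = 0}"
          using orth by (simp add: inner_sum_right inner_commute)
      qed
      then have "span ?T \<subseteq> {y. (?p - t) \<bullet> y = 0}" by (intro span_minimal subspace_hyperplane)
      moreover have "?p - t \<in> span ?T" by (rule span_diff[OF pin span_base[OF t(1)]])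
      ultimately have "(?p - t) \<bullet> (?p - t) = 0" by blast
      then show ?thesis by simp
    qed
    show ?thesis unfolding fx using inj by auto
  qed
  then show ?thesis
    unfolding solid_angle_convex_cone[OF convex_cone_tcone closed_tcone[OF A i]]
    by (simp add: tcone_linear_image[OF linear_frame])
qed

text \<open>The angle is the Gaussian measure of a section of a measurable set in the product space.\<close>

lemma measurable_solid_angle_tcone:
  fixes S :: "'i \<Rightarrow> 'w \<Rightarrow> 'a::euclidean_space"
  assumes A: "finite A" and I: "I \<subseteq> A" "I \<noteq> {}" and S: "\<And>k. k \<in> A \<Longrightarrow> S k \<in> borel_measurable M"
  shows "(\<lambda>\<omega>. solid_angle (tcone (\<lambda>k. S k \<omega>) A I)) \<in> borel_measurable M"
proof -
  obtain i where i: "i \<in> I" using I by blast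
  interpret G: prob_space "std_gaussian :: 'a measure" by (rule prob_space_std_gaussian)
  let ?N = "M \<Otimes>\<^sub>M (std_gaussian :: 'a measure)"
  have S': "(\<lambda>p. S k (fst p)) \<in> borel_measurable ?N" if "k \<in> A" for k
    by (rule measurable_compose[OF measurable_fst S[OF that]])
  have x: "(\<lambda>p. snd p) \<in> borel_measurable ?N"
    using measurable_snd[of M "std_gaussian :: 'a measure"] by (simp cong: measurable_cong_sets)
  have frame_meas: "(\<lambda>p. frame (\<lambda>k. S k (fst p)) A i (y p)) \<in> borel_measurable ?N"
    if "y \<in> borel_measurable ?N" for y
    unfolding frame_def using S' that i I(1)
    by (intro borel_measurable_sum borel_measurable_scaleR borel_measurable_inner borel_measurable_diff) auto
  let ?Q = "{p \<in> space ?N. frame (\<lambda>k. S k (fst p)) A i (snd p) \<in>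
    tcone (\<lambda>k. frame (\<lambda>k. S k (fst p)) A i (S k (fst p))) A I}"
  have "Measurable.pred ?N (\<lambda>p. frame (\<lambda>k. S k (fst p)) A i (snd p) \<in>
    tcone (\<lambda>k. frame (\<lambda>k. S k (fst p)) A i (S k (fst p))) A I)"
    by (rule measurable_in_tcone[OF A I]) (intro frame_meas x S')+
  then have Q: "?Q \<in> sets ?N" by (rule predE)
  have "(\<lambda>\<omega>. enn2real (emeasure std_gaussian (Pair \<omega> -` ?Q))) \<in> borel_measurable M"
    by (intro borel_measurable_enn2real G.measurable_emeasure_Pair[OF Q])
  moreover have "solid_angle (tcone (\<lambda>k. S k \<omega>) A I) = enn2real (emeasure std_gaussian (Pair \<omega> -` ?Q))"
    if "\<omega> \<in> space M" for \<omega>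
    using that by (simp add: solid_angle_tcone[OF A i I(1)] measure_def space_pair_measure vimage_def)
  ultimately show ?thesis by (simp cong: measurable_cong)
qed

lemma solid_angle_le_1: "solid_angle T \<le> 1" "0 \<le> solid_angle T"
  using prob_space.prob_le_1[OF prob_space_uniform_sphere[OF subspace_span]]
  by (auto simp: solid_angle_def)

section \<open>Closed walks\<close>

definition psum :: "(nat \<Rightarrow> 'a::real_vector) \<Rightarrow> nat \<Rightarrow> 'a" where
  "psum y k = (\<Sum>i=1..k. y i)"

definition face_angle_sum :: "nat \<Rightarrow> nat \<Rightarrow> (nat \<Rightarrow> 'a::euclidean_space) \<Rightarrow> real" where
  "face_angle_sum j n y = (\<Sum>F\<in>faces_of_dim j (convex hull (psum y ` {0..n})).
    solid_angle (tangent_cone (convex hull (psum y ` {0..n})) F))"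

lemma psum_cong: "(\<And>i. 1 \<le> i \<Longrightarrow> i \<le> n \<Longrightarrow> y i = z i) \<Longrightarrow> k \<le> n \<Longrightarrow> psum y k = psum z k"
  unfolding psum_def by (rule sum.cong) auto

lemma face_angle_sum_cong:
  assumes "\<And>i. 1 \<le> i \<Longrightarrow> i \<le> n \<Longrightarrow> y i = z i"
  shows "face_angle_sum j n y = face_angle_sum j n z"
proof -
  have "psum y ` {0..n} = psum z ` {0..n}" using psum_cong[OF assms] by (intro image_cong) auto
  then show ?thesis by (simp add: face_angle_sum_def)
qed

text \<open>A sum over all index sets with indicators, instead of one over a random set of faces, is a
  finite sum of measurable functions, and it is bounded.\<close>

lemma face_angle_sum_eq:
  "face_angle_sum j n y = (\<Sum>I\<in>Pow {0..n} - {{}}.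
    of_bool (exposed (psum y) {0..n} I \<and> aff_dim (psum y ` I) = int j) * solid_angle (tcone (psum y) {0..n} I))"
proof -
  let ?S = "psum y" and ?A = "{0..n}"
  let ?J = "{I. I \<subseteq> ?A \<and> I \<noteq> {} \<and> exposed ?S ?A I \<and> aff_dim (?S ` I) = int j}"
  have "face_angle_sum j n y = (\<Sum>I\<in>?J. solid_angle (tangent_cone (convex hull (?S ` ?A)) (convex hull (?S ` I))))"
    unfolding face_angle_sum_def
    by (rule sum.reindex_bij_betw[OF faces_of_dim_convex_hull, symmetric]) simp
  also have "\<dots> = (\<Sum>I\<in>?J. solid_angle (tcone ?S ?A I))"
    by (rule sum.cong[OF refl]) (simp add: tangent_cone_convex_hull)
  also have "\<dots> = (\<Sum>I\<in>Pow ?A - {{}}. of_bool (exposed ?S ?A I \<and> aff_dim (?S ` I) = int j) * solid_angle (tcone ?S ?A I))"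
    by (rule sum.mono_neutral_cong_left) auto
  finally show ?thesis .
qed

lemma measurable_path:
  fixes \<xi> :: "nat \<Rightarrow> 'w \<Rightarrow> 'a::euclidean_space"
  assumes "\<And>i. i \<in> {1..n} \<Longrightarrow> \<xi> i \<in> borel_measurable M" "k \<le> n"
  shows "(\<lambda>\<omega>. psum (\<lambda>i. \<xi> i \<omega>) k) \<in> borel_measurable M"
  unfolding psum_def by (rule borel_measurable_sum) (use assms in auto)

lemma measurable_face_angle_sum:
  fixes \<xi> :: "nat \<Rightarrow> 'w \<Rightarrow> 'a::euclidean_space"
  assumes \<xi>: "\<And>i. i \<in> {1..n} \<Longrightarrow> \<xi> i \<in> borel_measurable M"
  shows "(\<lambda>\<omega>. face_angle_sum j n (\<lambda>i. \<xi> i \<omega>)) \<in> borel_measurable M"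
  unfolding face_angle_sum_eq
proof (rule borel_measurable_sum)
  fix I assume "I \<in> Pow {0..n} - {{}}"
  then have I: "I \<subseteq> {0..n}" "I \<noteq> {}" by auto
  define S where "S = (\<lambda>k \<omega>. psum (\<lambda>i. \<xi> i \<omega>) k)"
  have S: "S k \<in> borel_measurable M" if "k \<in> {0..n}" for k
    using measurable_path[of n \<xi> M k] \<xi> that by (simp add: S_def)
  have S': "S k \<in> borel_measurable M" if "k \<in> I" for k using S I(1) that by blast
  have A: "finite {0..n}" "finite I" using I(1) by (auto intro: finite_subset)
  have [measurable]: "Measurable.pred M (\<lambda>\<omega>. exposed (\<lambda>k. S k \<omega>) {0..n} I)"
    "Measurable.pred M (\<lambda>\<omega>. aff_dim ((\<lambda>k. S k \<omega>) ` I) = int j)"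
    "(\<lambda>\<omega>. solid_angle (tcone (\<lambda>k. S k \<omega>) {0..n} I)) \<in> borel_measurable M"
    using measurable_exposed[where S = S, OF A(1) I S] measurable_aff_dim[where S = S, OF A(2) S']
      measurable_solid_angle_tcone[where S = S, OF A(1) I S] by blast+
  have "(\<lambda>\<omega>. of_bool (exposed (\<lambda>k. S k \<omega>) {0..n} I \<and> aff_dim ((\<lambda>k. S k \<omega>) ` I) = int j) *
      solid_angle (tcone (\<lambda>k. S k \<omega>) {0..n} I)) \<in> borel_measurable M"
    unfolding of_bool_def by measurable
  then show "(\<lambda>\<omega>. of_bool (exposed (psum (\<lambda>i. \<xi> i \<omega>)) {0..n} I \<and> aff_dim (psum (\<lambda>i. \<xi> i \<omega>) ` I) = int j) *
      solid_angle (tcone (psum (\<lambda>i. \<xi> i \<omega>)) {0..n} I)) \<in> borel_measurable M"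
    by (simp add: S_def)
qed

lemma face_angle_sum_bounded: "\<bar>face_angle_sum j n y\<bar> \<le> card (Pow {0..n} - {{}})"
proof -
  let ?f = "\<lambda>I. of_bool (exposed (psum y) {0..n} I \<and> aff_dim (psum y ` I) = int j) * solid_angle (tcone (psum y) {0..n} I)"
  have "\<bar>face_angle_sum j n y\<bar> \<le> (\<Sum>I\<in>Pow {0..n} - {{}}. \<bar>?f I\<bar>)" unfolding face_angle_sum_eq by (rule sum_abs)
  also have "\<dots> \<le> (\<Sum>I\<in>Pow {0..n} - {{}}. 1)"
    by (intro sum_mono) (auto simp: abs_mult of_bool_def abs_of_nonneg solid_angle_le_1)
  finally show ?thesis by simp
qed

text \<open>The steps of the closed walk: step \<open>0\<close> returns from the end of the walk to the origin.\<close>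

definition closing :: "nat \<Rightarrow> (nat \<Rightarrow> 'a::real_vector) \<Rightarrow> nat \<Rightarrow> 'a" where
  "closing n y k = (if k = 0 then - (\<Sum>i=1..n. y i) else y k)"

lemma step_system_closing: "step_system {0..n} (closing n y)"
proof
  have "sum (closing n y) {0..n} = closing n y 0 + sum (closing n y) {1..n}"
    by (simp add: sum.atLeast_Suc_atMost)
  also have "sum (closing n y) {1..n} = sum y {1..n}" by (rule sum.cong) (auto simp: closing_def)
  finally show "sum (closing n y) {0..n} = 0" by (simp add: closing_def)
qed auto

text \<open>The cyclic word of the permuted walk starts with the closing step. Its letter at position \<open>k\<close> is
  the step that ends at the vertex \<open>k\<close>; the closing step ends at the origin, which is vertex \<open>0\<close>.
  Cutting after these letters is cutting at the vertices.\<close>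

definition word_of :: "nat \<Rightarrow> (nat \<Rightarrow> nat) \<Rightarrow> nat list" where
  "word_of n \<pi> = map \<pi> [0..<Suc n]"

lemma word_of:
  assumes "\<pi> permutes {1..n}"
  shows "length (word_of n \<pi>) = Suc n" "k \<le> n \<Longrightarrow> word_of n \<pi> ! k = \<pi> k"
    "word_of n \<pi> \<in> permutations_of_set {0..n}" "\<pi> 0 = 0" "\<pi> permutes {0..n}"
proof -
  show l: "length (word_of n \<pi>) = Suc n" "k \<le> n \<Longrightarrow> word_of n \<pi> ! k = \<pi> k"
    by (auto simp: word_of_def nth_append simp del: upt_Suc)
  show "\<pi> 0 = 0" using assms by (rule permutes_not_in) simp
  show p: "\<pi> permutes {0..n}" using assms by (rule permutes_subset) auto
  have "inj_on \<pi> {0..<Suc n}" using permutes_inj[OF p] by (rule inj_on_subset) auto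
  moreover have "\<pi> ` {0..<Suc n} = {0..n}" using permutes_image[OF p] by (simp add: atLeastLessThanSuc_atLeastAtMost)
  ultimately show "word_of n \<pi> \<in> permutations_of_set {0..n}"
    by (simp add: word_of_def permutations_of_set_def distinct_map del: upt_Suc)
qed

lemma cyclically_antitone_word_of:
  assumes "\<pi> permutes {1..n}" "I \<subseteq> {0..n}"
  shows "cyclically_antitone a (word_of n \<pi>) (\<pi> ` I) \<longleftrightarrow>
    (\<forall>k\<in>{0..n} - I. a (\<pi> (Suc k mod Suc n)) \<le> a (\<pi> k))"
proof -
  note w = word_of[OF assms(1)]
  have mem: "\<pi> k \<in> \<pi> ` I \<longleftrightarrow> k \<in> I" for k using permutes_inj[OF assms(1)] by (auto dest: injD)
  have m: "Suc k mod Suc n \<le> n" for k using mod_less_divisor[of "Suc n" "Suc k"] by simp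
  show ?thesis unfolding cyclically_antitone_def w(1)
    using w(2) m mem by (auto simp: less_Suc_eq_le)
qed

text \<open>Abel summation along the closed walk: the coefficient of a vertex is the decrement of the
  coefficients from the step that ends there to the step that starts there.\<close>

lemma comb_closing_path:
  fixes y :: "nat \<Rightarrow> 'a::euclidean_space"
  assumes \<pi>: "\<pi> permutes {1..n}"
  shows "step_system.comb {0..n} (closing n y) a =
    (\<Sum>k\<in>{0..n}. (a (\<pi> k) - a (\<pi> (Suc k mod Suc n))) *\<^sub>R psum (y \<circ> \<pi>) k)"
proof -
  note w = word_of[OF \<pi>]
  define \<alpha> where "\<alpha> k = a (\<pi> (k mod Suc n))" for k
  have part: "(\<Sum>k\<in>{0..m}. (\<alpha> k - \<alpha> (Suc k)) *\<^sub>R psum (y \<circ> \<pi>) k) =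
      (\<Sum>k=1..m. \<alpha> k *\<^sub>R y (\<pi> k)) - \<alpha> (Suc m) *\<^sub>R psum (y \<circ> \<pi>) m" for m
    by (induction m) (simp_all add: psum_def algebra_simps)
  have "(\<Sum>k\<in>{0..n}. (a (\<pi> k) - a (\<pi> (Suc k mod Suc n))) *\<^sub>R psum (y \<circ> \<pi>) k) =
      (\<Sum>k\<in>{0..n}. (\<alpha> k - \<alpha> (Suc k)) *\<^sub>R psum (y \<circ> \<pi>) k)"
    by (rule sum.cong) (auto simp: \<alpha>_def)
  also have "\<dots> = (\<Sum>k=1..n. \<alpha> k *\<^sub>R y (\<pi> k)) - a 0 *\<^sub>R psum (y \<circ> \<pi>) n"
    unfolding part by (simp add: \<alpha>_def w(4))
  also have "(\<Sum>k=1..n. \<alpha> k *\<^sub>R y (\<pi> k)) = (\<Sum>k=1..n. a (\<pi> k) *\<^sub>R y (\<pi> k))"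
    by (rule sum.cong) (auto simp: \<alpha>_def)
  also have "\<dots> = (\<Sum>k=1..n. a k *\<^sub>R y k)"
    using sum.permute[OF \<pi>, of "\<lambda>k. a k *\<^sub>R y k"] by (simp add: comp_def)
  also have "psum (y \<circ> \<pi>) n = (\<Sum>k=1..n. y k)"
    using sum.permute[OF \<pi>, of y] by (simp add: psum_def comp_def)
  also have "(\<Sum>k=1..n. a k *\<^sub>R y k) - a 0 *\<^sub>R (\<Sum>k=1..n. y k) = step_system.comb {0..n} (closing n y) a"
  proof -
    have "(\<Sum>k=1..n. a k *\<^sub>R closing n y k) = (\<Sum>k=1..n. a k *\<^sub>R y k)"
      by (rule sum.cong) (auto simp: closing_def)
    then show ?thesis
      unfolding step_system.comb_def[OF step_system_closing]
      by (simp add: sum.atLeast_Suc_atMost) (simp add: closing_def)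
  qed
  finally show ?thesis ..
qed

text \<open>Cyclic differences are exactly the functions with sum \<open>0\<close>, so coefficients of steps, up to
  constants, correspond to coefficients of vertices with sum \<open>0\<close>.\<close>

lemma cyclic_differences:
  fixes a b :: "nat \<Rightarrow> real"
  assumes \<pi>: "\<pi> permutes {1..n}"
  shows "(\<Sum>k\<in>{0..n}. a (\<pi> k) - a (\<pi> (Suc k mod Suc n))) = 0"
    and "sum b {0..n} = 0 \<Longrightarrow> \<exists>a. \<forall>k\<in>{0..n}. b k = a (\<pi> k) - a (\<pi> (Suc k mod Suc n))"
proof -
  note w = word_of[OF \<pi>]
  define \<alpha> where "\<alpha> k = a (\<pi> (k mod Suc n))" for k
  have "(\<Sum>k\<in>{0..n}. a (\<pi> k) - a (\<pi> (Suc k mod Suc n))) = (\<Sum>k<Suc n. \<alpha> k - \<alpha> (Suc k))"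
    by (rule sum.cong) (auto simp: \<alpha>_def)
  also have "\<dots> = \<alpha> 0 - \<alpha> (Suc n)" by (rule sum_lessThan_telescope')
  finally show "(\<Sum>k\<in>{0..n}. a (\<pi> k) - a (\<pi> (Suc k mod Suc n))) = 0" by (simp add: \<alpha>_def)
  assume b: "sum b {0..n} = 0"
  \<comment> \<open>a discrete antiderivative; that it closes up after step \<open>n\<close> is the assumption on the sum\<close>
  define \<beta> where "\<beta> k = sum b {k..n}" for k
  define f where "f = \<beta> \<circ> inv \<pi>"
  have f: "f (\<pi> k) = \<beta> k" for k using permutes_inverses(2)[OF \<pi>] by (simp add: f_def)
  have "b k = f (\<pi> k) - f (\<pi> (Suc k mod Suc n))" if k: "k \<in> {0..n}" for k
  proof (cases "k = n")
    case True
    then show ?thesis using b by (simp add: f \<beta>_def)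
  next
    case False
    then have "Suc k mod Suc n = Suc k" using k by simp
    then show ?thesis using k by (simp add: f \<beta>_def sum.atLeast_Suc_atMost)
  qed
  then show "\<exists>a. \<forall>k\<in>{0..n}. b k = a (\<pi> k) - a (\<pi> (Suc k mod Suc n))" by blast
qed

text \<open>Following the cyclic word from any letter without a change of the value leads to a cut.\<close>

lemma values_at_cuts:
  assumes \<pi>: "\<pi> permutes {1..n}" and I: "I \<subseteq> {0..n}" "I \<noteq> {}"
    and a: "\<forall>k\<in>{0..n} - I. a (\<pi> k) = (a (\<pi> (Suc k mod Suc n)) :: real)"
  shows "card (a ` {0..n}) \<le> card I"
proof -
  note w = word_of[OF \<pi>]
  have step: "a (\<pi> k) \<in> (\<lambda>l. a (\<pi> l)) ` I" if "k \<le> n" "(k + m) mod Suc n \<in> I" for k m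
    using that
  proof (induction m arbitrary: k)
    case 0
    then show ?case by simp
  next
    case (Suc m)
    show ?case
    proof (cases "k \<in> I")
      case False
      have "Suc k mod Suc n \<le> n" using mod_less_divisor[of "Suc n" "Suc k"] by simp
      moreover have "(Suc k mod Suc n + m) mod Suc n \<in> I" using Suc.prems(2) by (simp add: mod_simps)
      ultimately have "a (\<pi> (Suc k mod Suc n)) \<in> (\<lambda>l. a (\<pi> l)) ` I" by (rule Suc.IH)
      then show ?thesis using a False Suc.prems(1) by simp
    qed simp
  qed
  obtain l where l: "l \<in> I" using I(2) by blast
  then have "l \<le> n" using I(1) by auto
  note l = l this
  have "a ` {0..n} \<subseteq> (\<lambda>l. a (\<pi> l)) ` I"
  proof
    fix t assume "t \<in> a ` {0..n}"
    then obtain e where e: "e \<in> {0..n}" "t = a e" by blast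
    then obtain k where k: "k \<in> {0..n}" "e = \<pi> k" using permutes_image[OF w(5)] by blast
    have "k + (l + Suc n - k) = l + Suc n" using k(1) by simp
    then have "(k + (l + Suc n - k)) mod Suc n = l" using l(2) by (metis mod_add_self2 mod_less le_imp_less_Suc)
    then show "t \<in> (\<lambda>l. a (\<pi> l)) ` I" using step[of k "l + Suc n - k"] k e(2) l(1) by simp
  qed
  then have "card (a ` {0..n}) \<le> card ((\<lambda>l. a (\<pi> l)) ` I)" using I(1) by (intro card_mono) (auto intro: finite_subset)
  also have "\<dots> \<le> card I" using I(1) by (intro card_image_le) (auto intro: finite_subset)
  finally show ?thesis .
qed

locale generic_steps =
  fixes n :: nat and y :: "nat \<Rightarrow> 'a::euclidean_space"
  assumes gen: "step_system.generic {0..n} (closing n y) {0} (DIM('a))" and n: "DIM('a) \<le> n"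
begin

sublocale step_system "{0..n}" "closing n y" by (rule step_system_closing)

lemma generic_constant: "card (a ` {0..n}) \<le> Suc (DIM('a)) \<Longrightarrow> comb a = 0 \<Longrightarrow> a constant_on {0..n}"
  using genericD(3)[OF gen, of a] by simp

text \<open>The nonnegativity of the coefficients outside \<open>I\<close> says that the coefficients of the steps
  decrease except when a vertex with index in \<open>I\<close> is passed.\<close>

lemma tcone_path:
  assumes \<pi>: "\<pi> permutes {1..n}" and I: "I \<subseteq> {0..n}"
  shows "tcone (psum (y \<circ> \<pi>)) {0..n} I = comb ` {a. cyclically_antitone a (word_of n \<pi>) (\<pi> ` I)}"
proof (intro equalityI subsetI)
  fix v assume "v \<in> tcone (psum (y \<circ> \<pi>)) {0..n} I"
  then obtain b where b: "v = (\<Sum>k\<in>{0..n}. b k *\<^sub>R psum (y \<circ> \<pi>) k)" "sum b {0..n} = 0" "\<forall>k\<in>{0..n} - I. 0 \<le> b k"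
    unfolding tcone_def by blast
  obtain a where a: "\<forall>k\<in>{0..n}. b k = a (\<pi> k) - a (\<pi> (Suc k mod Suc n))"
    using cyclic_differences(2)[OF \<pi> b(2)] by blast
  have "v = comb a" unfolding comb_closing_path[OF \<pi>] b(1) using a by (intro sum.cong) auto
  moreover have "cyclically_antitone a (word_of n \<pi>) (\<pi> ` I)"
    unfolding cyclically_antitone_word_of[OF \<pi> I] using a b(3) by force
  ultimately show "v \<in> comb ` {a. cyclically_antitone a (word_of n \<pi>) (\<pi> ` I)}" by blast
next
  fix v assume "v \<in> comb ` {a. cyclically_antitone a (word_of n \<pi>) (\<pi> ` I)}"
  then obtain a where a: "v = comb a" "\<forall>k\<in>{0..n} - I. a (\<pi> (Suc k mod Suc n)) \<le> a (\<pi> k)"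
    unfolding cyclically_antitone_word_of[OF \<pi> I, symmetric] by blast
  show "v \<in> tcone (psum (y \<circ> \<pi>)) {0..n} I"
    by (rule tconeI[of "\<lambda>k. a (\<pi> k) - a (\<pi> (Suc k mod Suc n))"])
      (use a cyclic_differences(1)[OF \<pi>] comb_closing_path[OF \<pi>] in auto)
qed

text \<open>An antitone combination that vanishes has coefficients that change only at the cuts if \<open>I\<close> is
  exposed. These are few values, so genericity makes the coefficients constant. This identifies
  faces of the walk with \<open>is_face\<close>.\<close>

lemma exposed_path:
  assumes \<pi>: "\<pi> permutes {1..n}" and I: "I \<subseteq> {0..n}" "I \<noteq> {}" "card I \<le> Suc (DIM('a))"
  shows "exposed (psum (y \<circ> \<pi>)) {0..n} I \<longleftrightarrow>
    (\<forall>a. cyclically_antitone a (word_of n \<pi>) (\<pi> ` I) \<longrightarrow> comb a = 0 \<longrightarrow> a constant_on {0..n})"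
proof
  assume ex: "exposed (psum (y \<circ> \<pi>)) {0..n} I"
  show "\<forall>a. cyclically_antitone a (word_of n \<pi>) (\<pi> ` I) \<longrightarrow> comb a = 0 \<longrightarrow> a constant_on {0..n}"
  proof (intro allI impI)
    fix a assume a: "cyclically_antitone a (word_of n \<pi>) (\<pi> ` I)" "comb a = 0"
    let ?b = "\<lambda>k. a (\<pi> k) - a (\<pi> (Suc k mod Suc n))"
    have nn: "\<forall>k\<in>{0..n} - I. 0 \<le> ?b k" using a(1) unfolding cyclically_antitone_word_of[OF \<pi> I(1)] by simp
    have c0: "(\<Sum>k\<in>{0..n}. ?b k *\<^sub>R psum (y \<circ> \<pi>) k) = 0"
      unfolding comb_closing_path[OF \<pi>, of y a, symmetric] by (rule a(2))
    have "\<forall>k\<in>{0..n} - I. ?b k = 0"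
      using ex[unfolded exposed_def, THEN spec[of _ ?b]] cyclic_differences(1)[OF \<pi>, of a] nn c0 by blast
    then have "card (a ` {0..n}) \<le> card I" by (intro values_at_cuts[OF \<pi> I(1,2)]) simp
    then show "a constant_on {0..n}" using I(3) a(2) by (intro generic_constant) auto
  qed
next
  assume c: "\<forall>a. cyclically_antitone a (word_of n \<pi>) (\<pi> ` I) \<longrightarrow> comb a = 0 \<longrightarrow> a constant_on {0..n}"
  show "exposed (psum (y \<circ> \<pi>)) {0..n} I"
    unfolding exposed_def
  proof (intro allI impI ballI)
    fix b k assume b: "sum b {0..n} = 0" "\<forall>k\<in>{0..n} - I. 0 \<le> b k"
      "(\<Sum>k\<in>{0..n}. b k *\<^sub>R psum (y \<circ> \<pi>) k) = 0" and k: "k \<in> {0..n} - I"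
    obtain a where a: "\<forall>k\<in>{0..n}. b k = a (\<pi> k) - a (\<pi> (Suc k mod Suc n))"
      using cyclic_differences(2)[OF \<pi> b(1)] by blast
    have "comb a = (\<Sum>k\<in>{0..n}. b k *\<^sub>R psum (y \<circ> \<pi>) k)"
      unfolding comb_closing_path[OF \<pi>] using a by (intro sum.cong) auto
    moreover have "cyclically_antitone a (word_of n \<pi>) (\<pi> ` I)"
      unfolding cyclically_antitone_word_of[OF \<pi> I(1)] using a b(2) by force
    ultimately have con: "a constant_on {0..n}" using c b(3) by simp
    have "\<pi> l \<in> {0..n}" if "l \<le> n" for l using that permutes_in_image[OF word_of(5)[OF \<pi>]] by simp
    moreover have "Suc k mod Suc n \<le> n" using mod_less_divisor[of "Suc n" "Suc k"] by simp
    ultimately have "a (\<pi> k) = a (\<pi> (Suc k mod Suc n))" using k by (intro constant_onD[OF con]) auto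
    then show "b k = 0" using a k by simp
  qed
qed

text \<open>An affine relation between few vertices has coefficients on the steps with few values.\<close>

lemma path_independent:
  assumes \<pi>: "\<pi> permutes {1..n}" and I: "I \<subseteq> {0..n}" "I \<noteq> {}" "card I \<le> Suc (DIM('a))"
    and b: "sum b I = 0" "(\<Sum>k\<in>I. b k *\<^sub>R psum (y \<circ> \<pi>) k) = 0" "k \<in> I"
  shows "b k = 0"
proof -
  define c where "c l = (if l \<in> I then b l else 0)" for l
  have "sum c {0..n} = sum b I" using I(1) unfolding c_def by (intro sum.mono_neutral_cong_right) auto
  moreover have "(\<Sum>k\<in>{0..n}. c k *\<^sub>R psum (y \<circ> \<pi>) k) = (\<Sum>k\<in>I. b k *\<^sub>R psum (y \<circ> \<pi>) k)"
    using I(1) unfolding c_def by (intro sum.mono_neutral_cong_right) auto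
  ultimately have c: "sum c {0..n} = 0" "(\<Sum>k\<in>{0..n}. c k *\<^sub>R psum (y \<circ> \<pi>) k) = 0" using b by simp_all
  obtain a where a: "\<forall>k\<in>{0..n}. c k = a (\<pi> k) - a (\<pi> (Suc k mod Suc n))"
    using cyclic_differences(2)[OF \<pi> c(1)] by blast
  have "comb a = (\<Sum>k\<in>{0..n}. c k *\<^sub>R psum (y \<circ> \<pi>) k)"
    unfolding comb_closing_path[OF \<pi>] using a by (intro sum.cong) auto
  then have "comb a = 0" using c(2) by simp
  moreover have "\<forall>k\<in>{0..n} - I. a (\<pi> k) = a (\<pi> (Suc k mod Suc n))"
    using a by (auto simp: c_def)
  then have "card (a ` {0..n}) \<le> Suc (DIM('a))" using values_at_cuts[OF \<pi> I(1,2)] I(3) by (meson le_trans)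
  ultimately have con: "a constant_on {0..n}" by (intro generic_constant)
  have "\<pi> l \<in> {0..n}" if "l \<le> n" for l using that permutes_in_image[OF word_of(5)[OF \<pi>]] by simp
  moreover have "Suc k mod Suc n \<le> n" using mod_less_divisor[of "Suc n" "Suc k"] by simp
  ultimately have "a (\<pi> k) = a (\<pi> (Suc k mod Suc n))" using b(3) I(1) by (intro constant_onD[OF con]) auto
  then have "c k = 0" using a b(3) I(1) by auto
  then show ?thesis using b(3) by (simp add: c_def)
qed

lemma aff_dim_path_small:
  assumes \<pi>: "\<pi> permutes {1..n}" and I: "I \<subseteq> {0..n}" "I \<noteq> {}" "card I \<le> Suc (DIM('a))"
  shows "aff_dim (psum (y \<circ> \<pi>) ` I) = int (card I) - 1"
proof -
  let ?S = "psum (y \<circ> \<pi>)"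
  have fI: "finite I" using I(1) by (rule finite_subset) simp
  have inj: "inj_on ?S I"
  proof (rule inj_onI, rule ccontr)
    fix k l assume kl: "k \<in> I" "l \<in> I" "?S k = ?S l" "k \<noteq> l"
    have "(\<Sum>i\<in>{k, l}. (if i = k then 1 else - 1) *\<^sub>R ?S i) = 0" "(\<Sum>i\<in>{k, l}. if i = k then 1 else - 1 :: real) = 0"
      using kl(3,4) by simp_all
    moreover have "card {k, l} \<le> Suc (DIM('a))" using kl(4) by simp
    ultimately have "(if k = k then 1 else - 1 :: real) = 0"
      using kl I(1) by (intro path_independent[OF \<pi>, of "{k, l}" "\<lambda>i. if i = k then 1 else - 1" k]) auto
    then show False by simp
  qed
  have "\<not> affine_dependent (?S ` I)"
  proof
    assume "affine_dependent (?S ` I)"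
    then obtain u v where u: "sum u (?S ` I) = 0" "v \<in> ?S ` I" "u v \<noteq> 0" "(\<Sum>v\<in>?S ` I. u v *\<^sub>R v) = 0"
      using affine_dependent_explicit_finite[of "?S ` I"] fI by blast
    obtain k where k: "k \<in> I" "v = ?S k" using u(2) by blast
    have "u (?S k) = 0"
      using path_independent[OF \<pi> I, of "\<lambda>k. u (?S k)" k] u(1,4) k(1) by (simp add: sum.reindex[OF inj])
    then show False using u(3) k(2) by simp
  qed
  then have "int (card (?S ` I)) = aff_dim (?S ` I) + 1" by (rule aff_dim_affine_independent)
  then show ?thesis using card_image[OF inj] by simp
qed

lemma aff_dim_path:
  assumes \<pi>: "\<pi> permutes {1..n}" and I: "I \<subseteq> {0..n}" "I \<noteq> {}" and j: "j < DIM('a)"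
  shows "aff_dim (psum (y \<circ> \<pi>) ` I) = int j \<longleftrightarrow> card I = Suc j"
proof (cases "card I \<le> Suc (DIM('a))")
  case True
  then show ?thesis using aff_dim_path_small[OF \<pi> I True] by auto
next
  case False
  then obtain I' where I': "I' \<subseteq> I" "card I' = Suc (DIM('a))" by (metis obtain_subset_with_card_n nat_le_linear)
  then have "I' \<noteq> {}" by auto
  then have "aff_dim (psum (y \<circ> \<pi>) ` I') = DIM('a)"
    using aff_dim_path_small[OF \<pi>, of I'] I' I(1) by simp
  moreover have "aff_dim (psum (y \<circ> \<pi>) ` I') \<le> aff_dim (psum (y \<circ> \<pi>) ` I)"
    using I'(1) by (intro aff_dim_subset image_mono)
  ultimately show ?thesis using j False by auto
qed

text \<open>In general position the polytope has full dimension, so its tangent cones span the whole space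
  and no projection is needed.\<close>

lemma solid_angle_path:
  assumes \<pi>: "\<pi> permutes {1..n}" and I: "I \<subseteq> {0..n}" "I \<noteq> {}"
  shows "solid_angle (tcone (psum (y \<circ> \<pi>)) {0..n} I) = measure std_gaussian (tcone (psum (y \<circ> \<pi>)) {0..n} I)"
proof -
  let ?S = "psum (y \<circ> \<pi>)" and ?A = "{0..n}"
  let ?T = "tcone ?S ?A I"
  obtain i where i: "i \<in> I" using I by blast
  have "UNIV \<subseteq> tcone ?S ?A ?A"
  proof
    fix v :: 'a
    have "v \<in> flat {0} (levels (\<lambda>k. real k))"
    proof -
      have "card (levels (\<lambda>k. real k)) = Suc n" unfolding levels(2) by (simp add: card_image inj_on_def)
      then have "flat {0} (levels (\<lambda>k. real k)) = UNIV" using n by (intro flat_UNIV[OF gen levels(1)]) simp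
      then show ?thesis by blast
    qed
    then obtain a where "v = comb a" unfolding flat_def by auto
    then show "v \<in> tcone ?S ?A ?A"
      unfolding tcone_path[OF \<pi> order_refl] cyclically_antitone_word_of[OF \<pi> order_refl] by blast
  qed
  moreover have "tcone ?S ?A ?A \<subseteq> span ?T"
  proof
    fix v assume "v \<in> tcone ?S ?A ?A"
    then obtain b where b: "v = (\<Sum>k\<in>?A - {i}. b k *\<^sub>R (?S k - ?S i))"
      unfolding tcone_alt[OF finite_atLeastAtMost subsetD[OF I(1) i] order_refl] by blast
    have "?S k - ?S i \<in> ?T" if "k \<in> ?A" for k using difference_in_tcone(1)[OF _ i I(1) that] by simp
    then show "v \<in> span ?T" unfolding b by (intro span_sum span_scale) (auto intro: span_base)
  qed
  ultimately have "span ?T = UNIV" by blast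
  moreover have "closest_point UNIV x = x" for x :: 'a by (rule closest_point_self) simp
  ultimately show ?thesis
    using solid_angle_convex_cone[OF convex_cone_tcone closed_tcone[OF finite_atLeastAtMost i I(1)], of ?S] by simp
qed

text \<open>Writing each angle as an integral over Gaussian directions \<open>g\<close>, the sum over permutations and
  faces becomes the integral of a count. For almost every \<open>g\<close> this count is the constant provided
  by \<open>sum_cuts_of_permutations\<close> and \<open>card_faces_containing\<close>.\<close>

theorem sum_permutations_face_angle_sum:
  assumes j: "j < DIM('a)"
  shows "(\<Sum>\<pi> | \<pi> permutes {1..n}. face_angle_sum j n (y \<circ> \<pi>)) =
    fact j * (\<Sum>s\<le>DIM('a). (- 1) ^ s * real (stirling (n + 1) (DIM('a) - s)) * real (Stirling (DIM('a) - s) (j + 1)))"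
proof -
  let ?A = "{0..n}" and ?\<Pi> = "{\<pi>. \<pi> permutes {1..n}}" and ?E = "std_gaussian :: 'a measure"
  let ?\<C> = "{C. C \<subseteq> {0..n} \<and> card C = Suc j}"
  interpret G: prob_space ?E by (rule prob_space_std_gaussian)
  \<comment> \<open>a face with \<open>g\<close> in its tangent cone, expressed through the set \<open>D\<close> of admissible coefficients,
    which is all that the cyclic word with its cuts and the word system have in common\<close>
  define P where "P g D \<longleftrightarrow> (\<forall>a\<in>D. comb a = 0 \<longrightarrow> a constant_on ?A) \<and> g \<in> comb ` D" for g D
  define D where "D \<pi> C = {a. cyclically_antitone a (word_of n \<pi>) C}" for \<pi> C
  define R where "R = fact j * (\<Sum>s\<le>DIM('a). (- 1) ^ s * real (stirling (n + 1) (DIM('a) - s)) * real (Stirling (DIM('a) - s) (j + 1)))"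
  have finC: "finite ?\<C>" by (rule finite_subset[of _ "Pow {0..n}"]) auto
  have fin\<Pi>: "finite ?\<Pi>" by (rule finite_permutations) simp
  have meas: "{g. P g (D \<pi> (\<pi> ` I))} \<in> sets ?E"
    and summand: "of_bool (exposed (psum (y \<circ> \<pi>)) ?A I) * solid_angle (tcone (psum (y \<circ> \<pi>)) ?A I)
      = measure ?E {g. P g (D \<pi> (\<pi> ` I))}" if \<pi>: "\<pi> permutes {1..n}" and I: "I \<in> ?\<C>" for \<pi> I
  proof -
    have I': "I \<subseteq> ?A" "I \<noteq> {}" "card I \<le> Suc (DIM('a))" using I j by auto
    obtain i where i: "i \<in> I" using I' by blast
    have eq: "{g. P g (D \<pi> (\<pi> ` I))} =
        (if exposed (psum (y \<circ> \<pi>)) ?A I then tcone (psum (y \<circ> \<pi>)) ?A I else {})"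
      unfolding P_def D_def exposed_path[OF \<pi> I'] tcone_path[OF \<pi> I'(1)] by auto
    have "closed (tcone (psum (y \<circ> \<pi>)) ?A I)" by (rule closed_tcone[OF _ i I'(1)]) simp
    then show "{g. P g (D \<pi> (\<pi> ` I))} \<in> sets ?E" unfolding eq by (simp add: borel_closed)
    show "of_bool (exposed (psum (y \<circ> \<pi>)) ?A I) * solid_angle (tcone (psum (y \<circ> \<pi>)) ?A I)
      = measure ?E {g. P g (D \<pi> (\<pi> ` I))}" unfolding eq using solid_angle_path[OF \<pi> I'(1,2)] by simp
  qed
  have angle: "face_angle_sum j n (y \<circ> \<pi>) = (\<Sum>I\<in>?\<C>. measure ?E {g. P g (D \<pi> (\<pi> ` I))})"
    if \<pi>: "\<pi> permutes {1..n}" for \<pi>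
  proof -
    have "face_angle_sum j n (y \<circ> \<pi>) = (\<Sum>I\<in>?\<C>. of_bool (exposed (psum (y \<circ> \<pi>)) ?A I) * solid_angle (tcone (psum (y \<circ> \<pi>)) ?A I))"
      unfolding face_angle_sum_eq
    proof (rule sum.mono_neutral_cong_right)
      show "?\<C> \<subseteq> Pow {0..n} - {{}}" by auto
      have dim: "aff_dim (psum (y \<circ> \<pi>) ` I) = int j \<longleftrightarrow> card I = Suc j" if "I \<in> Pow {0..n} - {{}}" for I
        using that by (intro aff_dim_path[OF \<pi> _ _ j]) auto
      show "\<forall>I\<in>Pow {0..n} - {{}} - ?\<C>. of_bool (exposed (psum (y \<circ> \<pi>)) ?A I \<and> aff_dim (psum (y \<circ> \<pi>) ` I) = int j) *
          solid_angle (tcone (psum (y \<circ> \<pi>)) ?A I) = 0"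
        using dim by auto
      show "of_bool (exposed (psum (y \<circ> \<pi>)) ?A I \<and> aff_dim (psum (y \<circ> \<pi>) ` I) = int j) *
          solid_angle (tcone (psum (y \<circ> \<pi>)) ?A I) =
          of_bool (exposed (psum (y \<circ> \<pi>)) ?A I) * solid_angle (tcone (psum (y \<circ> \<pi>)) ?A I)" if "I \<in> ?\<C>" for I
      proof -
        have "I \<in> Pow {0..n} - {{}}" using that by auto
        from dim[OF this] show ?thesis using that by simp
      qed
    qed simp
    then show ?thesis using summand[OF \<pi>] by simp
  qed
  have count: "(\<Sum>\<pi>\<in>?\<Pi>. \<Sum>I\<in>?\<C>. of_bool (P g (D \<pi> (\<pi> ` I)))) = R"
    if g: "generic (span (insert g {0})) (DIM('a) - 1)" for g
  proof -
    have inner: "(\<Sum>I\<in>?\<C>. of_bool (P g (D \<pi> (\<pi> ` I)))) = card {C. C \<subseteq> ?A \<and> card C = Suc j \<and> P g (D \<pi> C)}"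
      if \<pi>: "\<pi> \<in> ?\<Pi>" for \<pi>
    proof -
      have p: "\<pi> permutes ?A" using word_of(5) \<pi> by blast
      have inj: "inj \<pi>" by (rule permutes_inj[OF p])
      have "(\<Sum>I\<in>?\<C>. of_bool (P g (D \<pi> (\<pi> ` I)))) = (\<Sum>C\<in>?\<C>. of_bool (P g (D \<pi> C)) :: nat)"
      proof (rule sum.reindex_bij_witness[of _ "\<lambda>C. inv \<pi> ` C" "\<lambda>I. \<pi> ` I"])
        fix C assume C: "C \<in> ?\<C>"
        have "inv \<pi> ` C \<subseteq> ?A" using permutes_image[OF permutes_inv[OF p]] C by blast
        moreover have "card (inv \<pi> ` C) = card C"
          using permutes_inj[OF permutes_inv[OF p]] by (intro card_image) (auto intro: inj_on_subset)
        ultimately show "inv \<pi> ` C \<in> ?\<C>" using C by simp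
        show "\<pi> ` inv \<pi> ` C = C" using permutes_inverses(1)[OF p] by (simp add: image_image)
      next
        fix I assume I: "I \<in> ?\<C>"
        have "\<pi> ` I \<subseteq> ?A" using permutes_image[OF p] I by blast
        moreover have "card (\<pi> ` I) = card I" using inj by (intro card_image) (auto intro: inj_on_subset)
        ultimately show "\<pi> ` I \<in> ?\<C>" using I by simp
        show "inv \<pi> ` \<pi> ` I = I" using permutes_inverses(2)[OF p] by (simp add: image_image)
      qed simp
      also have "\<dots> = card {C. C \<subseteq> ?A \<and> card C = Suc j \<and> P g (D \<pi> C)}"
        using finC by (simp add: of_bool_def sum.If_cases Int_def conj_assoc)
      finally show ?thesis .
    qed
    let ?Q = "{q \<in> permutations_of_set ?A. q ! 0 = 0}"
    have "(\<Sum>\<pi>\<in>?\<Pi>. card {C. C \<subseteq> ?A \<and> card C = Suc j \<and> P g (D \<pi> C)}) =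
      (\<Sum>q\<in>?Q. card {C. C \<subseteq> ?A \<and> card C = Suc j \<and> P g {a. cyclically_antitone a q C}})"
    proof (rule sum.reindex_bij_witness[of _ "\<lambda>q k. if k \<le> n then q ! k else k" "word_of n"])
      fix \<pi> assume "\<pi> \<in> ?\<Pi>"
      then have \<pi>: "\<pi> permutes {1..n}" by simp
      note w = word_of[OF \<pi>]
      show "(\<lambda>k. if k \<le> n then word_of n \<pi> ! k else k) = \<pi>"
        using w(2) permutes_not_in[OF \<pi>] by auto
      show "word_of n \<pi> \<in> ?Q" using w by simp
      show "card {C. C \<subseteq> ?A \<and> card C = Suc j \<and> P g {a. cyclically_antitone a (word_of n \<pi>) C}} =
        card {C. C \<subseteq> ?A \<and> card C = Suc j \<and> P g (D \<pi> C)}" by (simp add: D_def)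
    next
      fix q assume q: "q \<in> ?Q"
      then have l: "length q = Suc n" "distinct q" "set q = {0..n}" "q ! 0 = 0"
        by (auto simp: permutations_of_set_def dest: distinct_card)
      let ?p = "\<lambda>k. if k \<le> n then q ! k else k"
      have bij: "bij_betw ?p {1..n} {1..n}"
      proof (rule bij_betwI')
        show "(?p k = ?p m) = (k = m)" if "k \<in> {1..n}" "m \<in> {1..n}" for k m
          using that l(1,2) by (simp add: nth_eq_iff_index_eq)
        show "?p k \<in> {1..n}" if k: "k \<in> {1..n}" for k
        proof -
          have "q ! k \<in> {0..n}" using k l(1,3) by (metis atLeastAtMost_iff less_Suc_eq_le nth_mem)
          moreover have "q ! k \<noteq> q ! 0" using k l(1,2) by (simp add: nth_eq_iff_index_eq)
          ultimately show ?thesis using k l(4) by auto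
        qed
        show "\<exists>k\<in>{1..n}. m = ?p k" if m: "m \<in> {1..n}" for m
        proof -
          have "m \<in> set q" using m l(3) by simp
          then obtain k where k: "k < Suc n" "m = q ! k" using l(1) by (metis in_set_conv_nth)
          have "k \<noteq> 0"
          proof
            assume "k = 0"
            then show False using k(2) m l(4) by simp
          qed
          then show ?thesis using k by (intro bexI[of _ k]) auto
        qed
      qed
      have outside: "?p k = k" if "k \<notin> {1..n}" for k using that l(4) by (cases k) auto
      show "?p \<in> ?\<Pi>" unfolding mem_Collect_eq by (rule bij_imp_permutes[OF bij outside])
      have "word_of n ?p = map (\<lambda>k. q ! k) [0..<Suc n]"
        unfolding word_of_def by (rule map_cong) auto
      then show "word_of n ?p = q" using l(1) by (metis map_nth)
    qed
    also have "\<dots> = fact j * card {U \<in> word_systems ?A (Suc j). P g {a. \<forall>u\<in>U. antitone_along a u}}"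
      by (rule sum_cuts_of_permutations) auto
    also have "{U \<in> word_systems ?A (Suc j). P g {a. \<forall>u\<in>U. antitone_along a u}} =
      {U \<in> word_systems ?A (Suc j). is_face {0} U \<and> g \<in> cone {0} U}"
      unfolding P_def is_face_def cone_def by auto
    finally have "(\<Sum>\<pi>\<in>?\<Pi>. \<Sum>I\<in>?\<C>. of_bool (P g (D \<pi> (\<pi> ` I)))) =
        fact j * card {U \<in> word_systems ?A (Suc j). is_face {0} U \<and> g \<in> cone {0} U}"
      using inner by simp
    from arg_cong[OF this, of real]
    have "(\<Sum>\<pi>\<in>?\<Pi>. \<Sum>I\<in>?\<C>. of_bool (P g (D \<pi> (\<pi> ` I)))) =
        fact j * real (card {U \<in> word_systems ?A (Suc j). is_face {0} U \<and> g \<in> cone {0} U})"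
      by simp
    also have "real (card {U \<in> word_systems ?A (Suc j). is_face {0} U \<and> g \<in> cone {0} U}) =
      (\<Sum>s\<le>DIM('a). (- 1) ^ s * real (stirling (card ?A) (DIM('a) - s)) * real (Stirling (DIM('a) - s) (Suc j)))"
      by (rule card_faces_containing) (use j n gen g in auto)
    finally show ?thesis by (simp add: R_def)
  qed
  have ind: "(\<lambda>g. of_bool (P g (D \<pi> (\<pi> ` I))) :: real) = indicator {g. P g (D \<pi> (\<pi> ` I))}" for \<pi> I
    by (auto simp: indicator_def)
  have int: "integrable ?E (\<lambda>g. of_bool (P g (D \<pi> (\<pi> ` I))) :: real)" if "\<pi> \<in> ?\<Pi>" "I \<in> ?\<C>" for \<pi> I
    unfolding ind using meas that by (intro integrable_real_indicator) (auto simp: G.emeasure_eq_measure)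
  have "AE g in ?E. (\<Sum>\<pi>\<in>?\<Pi>. \<Sum>I\<in>?\<C>. of_bool (P g (D \<pi> (\<pi> ` I)))) = R"
  proof -
    obtain X where X: "negligible X" "\<And>g. g \<notin> X \<Longrightarrow> generic (span (insert g {0})) (DIM('a) - 1)"
      using generic_insert_negligible[of "{0}" "DIM('a) - 1"] gen by auto
    have "X \<in> null_sets lebesgue" using X(1) by (simp add: negligible_iff_null_sets)
    then have "AE g in lebesgue. g \<notin> X" by (rule AE_not_in)
    then have "AE g in lborel. g \<notin> X" by (simp add: AE_completion_iff)
    then have "AE g in ?E. g \<notin> X" unfolding std_gaussian_def
      by (subst AE_density) (auto elim: eventually_mono)
    then show ?thesis by (rule eventually_mono) (use count X(2) in blast)
  qed
  then have "(\<integral>g. (\<Sum>\<pi>\<in>?\<Pi>. \<Sum>I\<in>?\<C>. of_bool (P g (D \<pi> (\<pi> ` I)))) \<partial>?E) = (\<integral>g. R \<partial>?E)"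
  proof (rule integral_cong_AE[rotated 2])
    show "(\<lambda>g. \<Sum>\<pi>\<in>?\<Pi>. \<Sum>I\<in>?\<C>. of_bool (P g (D \<pi> (\<pi> ` I))) :: real) \<in> borel_measurable ?E"
      by (intro borel_measurable_sum borel_measurable_integrable int)
  qed simp
  also have "\<dots> = R" using G.prob_space by simp
  finally have "(\<integral>g. (\<Sum>\<pi>\<in>?\<Pi>. \<Sum>I\<in>?\<C>. of_bool (P g (D \<pi> (\<pi> ` I)))) \<partial>?E) = R" .
  moreover have "(\<integral>g. (\<Sum>\<pi>\<in>?\<Pi>. \<Sum>I\<in>?\<C>. of_bool (P g (D \<pi> (\<pi> ` I)))) \<partial>?E) =
    (\<Sum>\<pi>\<in>?\<Pi>. \<Sum>I\<in>?\<C>. measure ?E {g. P g (D \<pi> (\<pi> ` I))})"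
  proof -
    have "(\<integral>g. (\<Sum>\<pi>\<in>?\<Pi>. \<Sum>I\<in>?\<C>. of_bool (P g (D \<pi> (\<pi> ` I)))) \<partial>?E) =
      (\<Sum>\<pi>\<in>?\<Pi>. \<integral>g. (\<Sum>I\<in>?\<C>. of_bool (P g (D \<pi> (\<pi> ` I))) :: real) \<partial>?E)"
      by (intro Bochner_Integration.integral_sum Bochner_Integration.integrable_sum int)
    also have "\<dots> = (\<Sum>\<pi>\<in>?\<Pi>. \<Sum>I\<in>?\<C>. \<integral>g. (of_bool (P g (D \<pi> (\<pi> ` I))) :: real) \<partial>?E)"
      by (intro sum.cong refl Bochner_Integration.integral_sum int)
    also have "\<dots> = (\<Sum>\<pi>\<in>?\<Pi>. \<Sum>I\<in>?\<C>. measure ?E {g. P g (D \<pi> (\<pi> ` I))})"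
      unfolding ind by simp
    finally show ?thesis .
  qed
  ultimately show ?thesis using angle by (simp add: R_def)
qed

end

section \<open>General position from linear independence\<close>

lemma psum_0: "psum v 0 = 0" by (simp add: psum_def)

text \<open>One vector is a combination of the others; adding the origin as a point of the family makes this
  an affine combination. In this form dependence is measurable.\<close>

lemma family_dependent_iff_tcone:
  fixes S :: "nat \<Rightarrow> 'a::real_vector"
  assumes I: "finite I" "0 \<notin> I" and S: "S 0 = 0"
  shows "family_dependent I S \<longleftrightarrow> (\<exists>i\<in>I. S i \<in> tcone S (insert 0 I - {i}) (insert 0 I - {i}))"
proof
  assume "family_dependent I S"
  then obtain c i where c: "i \<in> I" "c i \<noteq> 0" "(\<Sum>k\<in>I. c k *\<^sub>R S k) = 0" unfolding family_dependent_def by blast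
  have i0: "i \<noteq> 0" using c(1) I(2) by metis
  have A: "insert 0 I - {i} = insert 0 (I - {i})" using i0 by auto
  define b where "b k = (if k = 0 then sum c (I - {i}) / c i else - c k / c i)" for k
  have b: "b k = - c k / c i" if "k \<in> I - {i}" for k using that I(2) by (auto simp: b_def)
  have "sum b (insert 0 (I - {i})) = 0"
  proof -
    have "sum b (I - {i}) = (\<Sum>k\<in>I - {i}. - (c k / c i))" using b by (intro sum.cong) auto
    then show ?thesis using I by (simp add: b_def sum_negf flip: sum_divide_distrib)
  qed
  moreover have "S i = (\<Sum>k\<in>insert 0 (I - {i}). b k *\<^sub>R S k)"
  proof -
    have "c i *\<^sub>R S i + (\<Sum>k\<in>I - {i}. c k *\<^sub>R S k) = 0" using c(3) sum.remove[OF I(1) c(1), of "\<lambda>k. c k *\<^sub>R S k"] by simp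
    then have e: "(\<Sum>k\<in>I - {i}. c k *\<^sub>R S k) = - (c i *\<^sub>R S i)" by (simp add: eq_neg_iff_add_eq_0 add.commute)
    have "(\<Sum>k\<in>insert 0 (I - {i}). b k *\<^sub>R S k) = (\<Sum>k\<in>I - {i}. b k *\<^sub>R S k)" using I S by simp
    also have "\<dots> = (\<Sum>k\<in>I - {i}. (- 1 / c i) *\<^sub>R (c k *\<^sub>R S k))" using b by (intro sum.cong) auto
    also have "\<dots> = (- 1 / c i) *\<^sub>R (- (c i *\<^sub>R S i))" unfolding scaleR_sum_right[symmetric] e ..
    also have "\<dots> = S i" using c(2) by simp
    finally show ?thesis ..
  qed
  ultimately have "S i \<in> tcone S (insert 0 I - {i}) (insert 0 I - {i})" unfolding A by (intro tconeI) auto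
  then show "\<exists>i\<in>I. S i \<in> tcone S (insert 0 I - {i}) (insert 0 I - {i})" using c(1) by blast
next
  assume "\<exists>i\<in>I. S i \<in> tcone S (insert 0 I - {i}) (insert 0 I - {i})"
  then obtain i b where i: "i \<in> I" "S i = (\<Sum>k\<in>insert 0 I - {i}. b k *\<^sub>R S k)" unfolding tcone_def by blast
  have "i \<noteq> 0" using i(1) I(2) by metis
  then have "insert 0 I - {i} = insert 0 (I - {i})" by auto
  then have e: "S i = (\<Sum>k\<in>I - {i}. b k *\<^sub>R S k)" using i(2) I S by simp
  define c where "c k = (if k = i then - 1 else b k)" for k
  have "(\<Sum>k\<in>I. c k *\<^sub>R S k) = c i *\<^sub>R S i + (\<Sum>k\<in>I - {i}. c k *\<^sub>R S k)" by (rule sum.remove[OF I(1) i(1)])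
  also have "(\<Sum>k\<in>I - {i}. c k *\<^sub>R S k) = S i" unfolding e by (rule sum.cong) (auto simp: c_def)
  also have "c i *\<^sub>R S i + S i = 0" by (simp add: c_def)
  finally have "(\<Sum>k\<in>I. c k *\<^sub>R S k) = 0" .
  then show "family_dependent I S" unfolding family_dependent_def
    using i(1) by (intro exI[of _ c]) (auto simp: c_def)
qed

lemma measurable_family_dependent:
  fixes \<xi> :: "nat \<Rightarrow> 'w \<Rightarrow> 'a::euclidean_space"
  assumes \<xi>: "\<And>i. i \<in> {1..n} \<Longrightarrow> \<xi> i \<in> borel_measurable M" and I: "I \<subseteq> {1..n}"
  shows "Measurable.pred M (\<lambda>\<omega>. family_dependent I (psum (\<lambda>i. \<xi> i \<omega>)))"
proof -
  have fI: "finite I" "0 \<notin> I" using I by (auto intro: finite_subset)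
  define S where "S = (\<lambda>k \<omega>. psum (\<lambda>i. \<xi> i \<omega>) k)"
  have S: "S k \<in> borel_measurable M" if "k \<in> insert 0 I" for k
    using measurable_path[of n \<xi> M k] \<xi> that I by (auto simp: S_def)
  have "Measurable.pred M (\<lambda>\<omega>. \<exists>i\<in>I. S i \<omega> \<in> tcone (\<lambda>k. S k \<omega>) (insert 0 I - {i}) (insert 0 I - {i}))"
  proof (rule pred_intros_finite(4)[OF fI(1)])
    fix i assume i: "i \<in> I"
    then have "i \<noteq> 0" using fI(2) by metis
    then show "Measurable.pred M (\<lambda>\<omega>. S i \<omega> \<in> tcone (\<lambda>k. S k \<omega>) (insert 0 I - {i}) (insert 0 I - {i}))"
      using fI(1) i S by (intro measurable_in_tcone) auto
  qed
  moreover have "family_dependent I (psum (\<lambda>i. \<xi> i \<omega>)) \<longleftrightarrow>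
      (\<exists>i\<in>I. S i \<omega> \<in> tcone (\<lambda>k. S k \<omega>) (insert 0 I - {i}) (insert 0 I - {i}))" for \<omega>
    unfolding S_def by (rule family_dependent_iff_tcone[OF fI]) (rule psum_0)
  ultimately show ?thesis by simp
qed

lemma sorting_permutation:
  fixes key :: "nat \<Rightarrow> real"
  obtains \<pi> where "\<pi> permutes {1..n}" "\<And>i k. 1 \<le> i \<Longrightarrow> i \<le> k \<Longrightarrow> k \<le> n \<Longrightarrow> key (\<pi> i) \<le> key (\<pi> k)"
proof -
  define l where "l = sort_key key [1..<Suc n]"
  have l: "length l = n" "distinct l" "set l = {1..n}" "sorted (map key l)"
    by (auto simp: l_def atLeastLessThanSuc_atLeastAtMost simp del: upt_Suc)
  define \<pi> where "\<pi> i = (if i \<in> {1..n} then l ! (i - 1) else i)" for i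
  have "bij_betw \<pi> {1..n} {1..n}"
  proof (rule bij_betwI')
    show "(\<pi> i = \<pi> k) = (i = k)" if "i \<in> {1..n}" "k \<in> {1..n}" for i k
    proof -
      have "i - 1 < length l" "k - 1 < length l" using that l(1) by auto
      then have "(l ! (i - 1) = l ! (k - 1)) = (i - 1 = k - 1)" using l(2) by (intro nth_eq_iff_index_eq)
      then show ?thesis using that by (auto simp: \<pi>_def)
    qed
    show "\<pi> i \<in> {1..n}" if "i \<in> {1..n}" for i
    proof -
      have "i - 1 < length l" using that l(1) by auto
      then have "l ! (i - 1) \<in> set l" by (rule nth_mem)
      then show ?thesis using that l(3) by (simp add: \<pi>_def)
    qed
    show "\<exists>i\<in>{1..n}. m = \<pi> i" if "m \<in> {1..n}" for m
    proof -
      have "m \<in> set l" using that l(3) by simp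
      then obtain k where "k < n" "l ! k = m" using l(1) by (metis in_set_conv_nth)
      then show ?thesis by (intro bexI[of _ "Suc k"]) (auto simp: \<pi>_def)
    qed
  qed
  then have "\<pi> permutes {1..n}" by (rule bij_imp_permutes) (auto simp: \<pi>_def)
  moreover have "key (\<pi> i) \<le> key (\<pi> k)" if "1 \<le> i" "i \<le> k" "k \<le> n" for i k
  proof -
    have "map key l ! (i - 1) \<le> map key l ! (k - 1)" using l(1,4) that by (intro sorted_nth_mono) auto
    then show ?thesis using that l(1) by (simp add: \<pi>_def)
  qed
  ultimately show ?thesis using that by blast
qed

text \<open>Suppose \<open>\<Sum> a e x e = 0\<close> for coefficients with at most \<open>d + 1\<close> values, normalised to be \<open>0\<close> at
  the closing step. Arrange the other steps such that equal coefficients are adjacent and the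
  zeros come last. Abel summation turns the relation into one between the partial sums at the
  places where the coefficient changes. There are at most \<open>d\<close> such places, one for each nonzero
  value, so the relation contradicts the independence of \<open>d\<close> partial sums of the rearranged
  walk.\<close>

lemma generic_steps_of_independence:
  fixes y :: "nat \<Rightarrow> 'a::euclidean_space"
  assumes n: "DIM('a) \<le> n"
    and ind: "\<And>\<pi> I. \<pi> permutes {1..n} \<Longrightarrow> I \<subseteq> {1..n} \<Longrightarrow> card I = DIM('a) \<Longrightarrow>
      \<not> family_dependent I (psum (y \<circ> \<pi>))"
  shows "generic_steps n y"
proof
  interpret step_system "{0..n}" "closing n y" by (rule step_system_closing)
  have "a constant_on {0..n}" if a: "card (a ` {0..n}) \<le> Suc (DIM('a))" "comb a = 0" for a
  proof (rule ccontr)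
    assume nc: "\<not> a constant_on {0..n}"
    define c where "c e = a e - a 0" for e
    define M where "M = 1 + Max (c ` {0..n})"
    have M: "c e < M" if "e \<in> {0..n}" for e
    proof -
      have "c e \<le> Max (c ` {0..n})" using that by (intro Max_ge) auto
      then show ?thesis by (simp add: M_def)
    qed
    \<comment> \<open>\<open>M\<close> exceeds all coefficients, so that sorting by this key puts the zeros at the end\<close>
    define key where "key e = (if c e = 0 then M else c e)" for e
    obtain \<pi> where \<pi>: "\<pi> permutes {1..n}"
      and mono: "\<And>i k. 1 \<le> i \<Longrightarrow> i \<le> k \<Longrightarrow> k \<le> n \<Longrightarrow> key (\<pi> i) \<le> key (\<pi> k)"
      using sorting_permutation[of n key] by blast
    have \<pi>in: "\<pi> i \<in> {1..n}" if "1 \<le> i" "i \<le> n" for i using permutes_in_image[OF \<pi>] that by simp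
    define v where "v i = (if i \<le> n then c (\<pi> i) else 0)" for i
    define J where "J = {i \<in> {1..n}. v i \<noteq> v (Suc i)}"
    have same: "v i = v k" if "1 \<le> i" "i \<le> k" "k \<le> n" "key (\<pi> i) = key (\<pi> k)" for i k
    proof -
      have "c (\<pi> i) < M" "c (\<pi> k) < M" using M \<pi>in that by auto
      then show ?thesis using that by (auto simp: v_def key_def split: if_splits)
    qed
    have zero_end: "v k = 0" if "1 \<le> i" "i \<le> k" "v i = 0" for i k
    proof (cases "k \<le> n")
      case True
      then have z: "c (\<pi> i) = 0" using that by (simp add: v_def)
      have "key (\<pi> i) \<le> key (\<pi> k)" using mono that True by simp
      then have "M \<le> key (\<pi> k)" using z by (simp add: key_def)
      moreover have "c (\<pi> k) < M" using M \<pi>in that True by auto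
      ultimately have "c (\<pi> k) = 0" by (auto simp: key_def split: if_splits)
      then show ?thesis using True by (simp add: v_def)
    qed (simp add: v_def)
    have inj: "inj_on v J"
    proof -
      have "v i \<noteq> v k" if ik: "i \<in> J" "k \<in> J" "i < k" for i k
      proof
        assume eq: "v i = v k"
        have b: "1 \<le> i" "k \<le> n" using ik by (auto simp: J_def)
        have cc: "c (\<pi> i) = c (\<pi> k)" using eq b ik(3) by (simp add: v_def)
        have "key (\<pi> i) \<le> key (\<pi> (Suc i))" "key (\<pi> (Suc i)) \<le> key (\<pi> k)" using mono b ik(3) by auto
        moreover have "key (\<pi> i) = key (\<pi> k)" using cc by (simp add: key_def)
        ultimately have "key (\<pi> i) = key (\<pi> (Suc i))" by simp
        then have "v i = v (Suc i)" using b ik(3) by (intro same) auto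
        then show False using ik(1) by (simp add: J_def)
      qed
      then show ?thesis by (intro inj_onI) (metis linorder_neqE_nat)
    qed
    have nz: "v i \<noteq> 0" if "i \<in> J" for i
    proof
      assume "v i = 0"
      then have "v (Suc i) = 0" using zero_end[of i "Suc i"] that by (auto simp: J_def)
      then show False using that \<open>v i = 0\<close> by (simp add: J_def)
    qed
    have sub: "v ` J \<subseteq> c ` {0..n} - {0}"
    proof
      fix t assume "t \<in> v ` J"
      then obtain i where i: "i \<in> J" "t = v i" by blast
      then have "t = c (\<pi> i)" "\<pi> i \<in> {1..n}" using \<pi>in[of i] by (auto simp: J_def v_def)
      then show "t \<in> c ` {0..n} - {0}" using nz[OF i(1)] i(2) by auto
    qed
    have "card J \<le> DIM('a)"
    proof -
      have "c ` {0..n} = (\<lambda>t. t - a 0) ` a ` {0..n}" by (simp add: c_def image_image)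
      then have "card (c ` {0..n}) \<le> card (a ` {0..n})" by (metis card_image_le finite_atLeastAtMost finite_imageI)
      moreover have "0 \<in> c ` {0..n}" by (rule image_eqI[of _ _ 0]) (auto simp: c_def)
      ultimately have "card (c ` {0..n} - {0}) \<le> DIM('a)" using a(1) by simp
      moreover have "card (v ` J) \<le> card (c ` {0..n} - {0})" using sub by (intro card_mono) auto
      ultimately show ?thesis using card_image[OF inj] by simp
    qed
    moreover have "J \<subseteq> {1..n}" by (auto simp: J_def)
    ultimately obtain I where I: "J \<subseteq> I" "I \<subseteq> {1..n}" "card I = DIM('a)"
      using exists_subset_between[of J "DIM('a)" "{1..n}"] n by auto
    have "J \<noteq> {}"
    proof
      assume "J = {}"
      then have step: "v i = v (Suc i)" if "1 \<le> i" "i \<le> n" for i using that by (auto simp: J_def)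
      have back_zero: "v (Suc n - m) = 0" if "m \<le> n" for m
        using that
      proof (induction m)
        case 0
        then show ?case by (simp add: v_def)
      next
        case (Suc m)
        have "v (n - m) = v (Suc (n - m))" using Suc.prems by (intro step) auto
        moreover have "Suc (n - m) = Suc n - m" using Suc.prems by simp
        ultimately show ?case using Suc by simp
      qed
      have v0: "v i = 0" if "1 \<le> i" "i \<le> n" for i using back_zero[of "Suc n - i"] that by simp
      have "a e = a 0" if e: "e \<in> {0..n}" for e
      proof (cases "e = 0")
        case False
        then have "e \<in> {1..n}" using e by auto
        then obtain i where i: "i \<in> {1..n}" "e = \<pi> i" using permutes_image[OF \<pi>] by blast
        then have "c e = v i" by (simp add: v_def)
        also have "\<dots> = 0" using v0 i(1) by simp
        finally show ?thesis by (simp add: c_def)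
      qed simp
      then have "a constant_on {0..n}" by (rule constant_onI)
      then show False using nc by blast
    qed
    have "(\<Sum>i\<in>I. (v i - v (Suc i)) *\<^sub>R psum (y \<circ> \<pi>) i) = (\<Sum>i=1..n. (v i - v (Suc i)) *\<^sub>R psum (y \<circ> \<pi>) i)"
      using I by (intro sum.mono_neutral_left) (auto simp: J_def)
    also have "\<dots> = (\<Sum>i=1..n. v i *\<^sub>R y (\<pi> i))"
    proof -
      have abel: "(\<Sum>i=1..m. (v i - v (Suc i)) *\<^sub>R psum (y \<circ> \<pi>) i) = (\<Sum>i=1..m. v i *\<^sub>R y (\<pi> i)) - v (Suc m) *\<^sub>R psum (y \<circ> \<pi>) m" for m
        by (induction m) (simp_all add: psum_def algebra_simps)
      have "v (Suc n) = 0" by (simp add: v_def)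
      then show ?thesis using abel[of n] by simp
    qed
    also have "\<dots> = (\<Sum>i=1..n. c (\<pi> i) *\<^sub>R y (\<pi> i))" by (rule sum.cong) (auto simp: v_def)
    also have "\<dots> = (\<Sum>e=1..n. c e *\<^sub>R y e)" using sum.permute[OF \<pi>, of "\<lambda>e. c e *\<^sub>R y e"] by (simp add: comp_def)
    also have "\<dots> = comb c"
    proof -
      have "(\<Sum>e=1..n. c e *\<^sub>R y e) = (\<Sum>e=1..n. c e *\<^sub>R closing n y e)"
        by (rule sum.cong) (auto simp: closing_def)
      then show ?thesis unfolding comb_def by (simp add: sum.atLeast_Suc_atMost c_def)
    qed
    also have "comb c = 0"
      unfolding c_def using comb_diff[of a "\<lambda>_. a 0"] a(2) comb_const[of "\<lambda>_. a 0" "a 0"] by simp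
    finally have rel: "(\<Sum>i\<in>I. (v i - v (Suc i)) *\<^sub>R psum (y \<circ> \<pi>) i) = 0" .
    obtain i where "i \<in> J" using \<open>J \<noteq> {}\<close> by blast
    then have "i \<in> I" "v i - v (Suc i) \<noteq> 0" using I(1) by (auto simp: J_def)
    then have "family_dependent I (psum (y \<circ> \<pi>))"
      unfolding family_dependent_def using rel by (intro exI[of _ "\<lambda>i. v i - v (Suc i)"] conjI bexI[of _ i])
    then show False using ind[OF \<pi> I(2,3)] by blast
  qed
  then show "generic {0} DIM('a)" by (simp add: generic_def)
  show "DIM('a) \<le> n" by (rule n)
qed

section \<open>Averaging over the orders of the steps\<close>

lemma walk_eq_psum: "walk \<xi> k \<omega> = psum (\<lambda>i. \<xi> i \<omega>) k"
  by (simp add: walk_def psum_def)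

lemma walk_hull_eq_psum: "walk_hull \<xi> n \<omega> = convex hull (psum (\<lambda>i. \<xi> i \<omega>) ` {0..n})"
  by (simp add: walk_hull_def walk_eq_psum)

lemma measurable_permuted:
  assumes "\<And>i. i \<in> {1..n} \<Longrightarrow> \<xi> i \<in> borel_measurable M" "\<pi> permutes {1..n::nat}"
  shows "(\<lambda>\<omega>. \<lambda>i\<in>{1..n}. \<xi> (\<pi> i) \<omega>) \<in> M \<rightarrow>\<^sub>M PiM {1..n} (\<lambda>_. borel)"
  using assms permutes_in_image[OF assms(2)] by (intro measurable_restrict) auto

text \<open>Every permuted walk has the same expected angle sum, and it is also almost surely in general
  position. Hence \<open>n!\<close> times the expectation is the expectation of a sum over permutations that is
  almost surely constant.\<close>

theorem expected_face_angle_sum: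
  fixes M :: "'w measure" and \<xi> :: "nat \<Rightarrow> 'w \<Rightarrow> 'a::euclidean_space"
  assumes M: "prob_space M" and n: "DIM('a) \<le> n"
    and \<xi>: "\<And>i. i \<in> {1..n} \<Longrightarrow> \<xi> i \<in> borel_measurable M"
    and Ex: "\<And>\<pi>. \<pi> permutes {1..n} \<Longrightarrow>
      distr M (PiM {1..n} (\<lambda>_. borel)) (\<lambda>\<omega>. \<lambda>i\<in>{1..n}. \<xi> (\<pi> i) \<omega>)
        = distr M (PiM {1..n} (\<lambda>_. borel)) (\<lambda>\<omega>. \<lambda>i\<in>{1..n}. \<xi> i \<omega>)"
    and GP: "\<And>I. I \<subseteq> {1..n} \<Longrightarrow> card I = DIM('a) \<Longrightarrow> AE \<omega> in M. \<not> family_dependent I (\<lambda>i. walk \<xi> i \<omega>)"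
    and j: "j < DIM('a)"
  shows "integrable M (\<lambda>\<omega>. face_angle_sum j n (\<lambda>i. \<xi> i \<omega>))"
    and "fact n * (\<integral>\<omega>. face_angle_sum j n (\<lambda>i. \<xi> i \<omega>) \<partial>M) = fact j *
      (\<Sum>s\<le>DIM('a). (- 1) ^ s * real (stirling (n + 1) (DIM('a) - s)) * real (Stirling (DIM('a) - s) (j + 1)))"
proof -
  interpret prob_space M by (rule M)
  let ?V = "PiM {1..n} (\<lambda>_. borel :: 'a measure)" and ?\<Pi> = "{\<pi>. \<pi> permutes {1..n}}"
  let ?X = "\<lambda>\<pi> \<omega>. \<lambda>i\<in>{1..n}. \<xi> (\<pi> i) \<omega>"
  let ?\<Psi> = "face_angle_sum j n :: (nat \<Rightarrow> 'a) \<Rightarrow> real"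
  define R where "R = fact j * (\<Sum>s\<le>DIM('a). (- 1) ^ s * real (stirling (n + 1) (DIM('a) - s)) * real (Stirling (DIM('a) - s) (j + 1)))"
  have X: "?X \<pi> \<in> M \<rightarrow>\<^sub>M ?V" if "\<pi> permutes {1..n}" for \<pi> using measurable_permuted[of n \<xi> M \<pi>] \<xi> that by blast
  have X1: "(\<lambda>\<omega>. \<lambda>i\<in>{1..n}. \<xi> i \<omega>) \<in> M \<rightarrow>\<^sub>M ?V" using X[OF permutes_id] by simp
  have coord: "(\<lambda>v. v i) \<in> borel_measurable ?V" if "i \<in> {1..n}" for i using that by measurable
  have \<Psi>: "?\<Psi> \<in> borel_measurable ?V"
    using measurable_face_angle_sum[of n "\<lambda>i v. v i" ?V j] coord by simp
  have \<Psi>X: "?\<Psi> (?X \<pi> \<omega>) = ?\<Psi> ((\<lambda>i. \<xi> i \<omega>) \<circ> \<pi>)" for \<pi> \<omega> by (rule face_angle_sum_cong) simp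
  have int: "integrable M (\<lambda>\<omega>. ?\<Psi> ((\<lambda>i. \<xi> i \<omega>) \<circ> \<pi>))" if \<pi>: "\<pi> permutes {1..n}" for \<pi>
  proof (rule integrable_const_bound[of _ "card (Pow {0..n} - {{}})"])
    show "AE \<omega> in M. norm (?\<Psi> ((\<lambda>i. \<xi> i \<omega>) \<circ> \<pi>)) \<le> card (Pow {0..n} - {{}})"
      unfolding real_norm_def by (rule AE_I2) (rule face_angle_sum_bounded)
    show "(\<lambda>\<omega>. ?\<Psi> ((\<lambda>i. \<xi> i \<omega>) \<circ> \<pi>)) \<in> borel_measurable M"
      using measurable_compose[OF X[OF \<pi>] \<Psi>] unfolding \<Psi>X .
  qed
  show "integrable M (\<lambda>\<omega>. ?\<Psi> (\<lambda>i. \<xi> i \<omega>))" using int[OF permutes_id] by simp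
  have same: "(\<integral>\<omega>. ?\<Psi> ((\<lambda>i. \<xi> i \<omega>) \<circ> \<pi>) \<partial>M) = (\<integral>\<omega>. ?\<Psi> (\<lambda>i. \<xi> i \<omega>) \<partial>M)" if \<pi>: "\<pi> permutes {1..n}" for \<pi>
  proof -
    have "(\<integral>\<omega>. ?\<Psi> ((\<lambda>i. \<xi> i \<omega>) \<circ> \<pi>) \<partial>M) = (\<integral>v. ?\<Psi> v \<partial>distr M ?V (?X \<pi>))"
      unfolding \<Psi>X[symmetric] by (rule integral_distr[OF X[OF \<pi>] \<Psi>, symmetric])
    also have "\<dots> = (\<integral>\<omega>. ?\<Psi> (\<lambda>i\<in>{1..n}. \<xi> i \<omega>) \<partial>M)"
      unfolding Ex[OF \<pi>] by (rule integral_distr[OF X1 \<Psi>])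
    also have "\<dots> = (\<integral>\<omega>. ?\<Psi> (\<lambda>i. \<xi> i \<omega>) \<partial>M)"
      by (rule Bochner_Integration.integral_cong[OF refl]) (rule face_angle_sum_cong, simp)
    finally show ?thesis .
  qed
  have gp: "AE \<omega> in M. \<not> family_dependent I (psum ((\<lambda>i. \<xi> i \<omega>) \<circ> \<pi>))"
    if \<pi>: "\<pi> permutes {1..n}" and I: "I \<subseteq> {1..n}" "card I = DIM('a)" for \<pi> I
  proof -
    have fd_cong: "family_dependent I (psum v) = family_dependent I (psum w)"
      if vw: "\<And>i. i \<in> {1..n} \<Longrightarrow> v i = w i" for v w :: "nat \<Rightarrow> 'a"
    proof -
      have "psum v i = psum w i" if "i \<in> I" for i using psum_cong[of n v w i] vw that I(1) by auto
      then show ?thesis unfolding family_dependent_def by simp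
    qed
    have P: "Measurable.pred ?V (\<lambda>v. \<not> family_dependent I (psum v))"
      using measurable_family_dependent[of n "\<lambda>i v. v i" ?V I] coord I(1) by simp
    have "AE v in distr M ?V (\<lambda>\<omega>. \<lambda>i\<in>{1..n}. \<xi> i \<omega>). \<not> family_dependent I (psum v)"
    proof (subst AE_distr_iff[OF X1])
      show "{v \<in> space ?V. \<not> family_dependent I (psum v)} \<in> sets ?V" using P by (rule predE)
      have "family_dependent I (psum (\<lambda>i\<in>{1..n}. \<xi> i \<omega>)) = family_dependent I (\<lambda>i. walk \<xi> i \<omega>)" for \<omega>
        unfolding walk_eq_psum using fd_cong[of "\<lambda>i\<in>{1..n}. \<xi> i \<omega>" "\<lambda>i. \<xi> i \<omega>"] by simp
      then show "AE \<omega> in M. \<not> family_dependent I (psum (\<lambda>i\<in>{1..n}. \<xi> i \<omega>))" using GP[OF I] by simp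
    qed
    then have "AE v in distr M ?V (?X \<pi>). \<not> family_dependent I (psum v)" unfolding Ex[OF \<pi>] .
    then have "AE \<omega> in M. \<not> family_dependent I (psum (?X \<pi> \<omega>))"
      using P by (subst (asm) AE_distr_iff[OF X[OF \<pi>]]) (auto intro: predE)
    moreover have "family_dependent I (psum (?X \<pi> \<omega>)) = family_dependent I (psum ((\<lambda>i. \<xi> i \<omega>) \<circ> \<pi>))" for \<omega>
      by (rule fd_cong) simp
    ultimately show ?thesis by simp
  qed
  have "AE \<omega> in M. \<forall>\<pi>\<in>?\<Pi>. \<forall>I\<in>{I \<in> Pow {1..n}. card I = DIM('a)}. \<not> family_dependent I (psum ((\<lambda>i. \<xi> i \<omega>) \<circ> \<pi>))"
    using gp by (intro AE_finite_allI) (auto intro: finite_permutations)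
  then have gen: "AE \<omega> in M. generic_steps n (\<lambda>i. \<xi> i \<omega>)"
    by (rule eventually_mono) (intro generic_steps_of_independence[OF n], blast)
  have "(\<integral>\<omega>. (\<Sum>\<pi>\<in>?\<Pi>. ?\<Psi> ((\<lambda>i. \<xi> i \<omega>) \<circ> \<pi>)) \<partial>M) = (\<integral>\<omega>. R \<partial>M)"
  proof (rule integral_cong_AE)
    show "(\<lambda>\<omega>. \<Sum>\<pi>\<in>?\<Pi>. ?\<Psi> ((\<lambda>i. \<xi> i \<omega>) \<circ> \<pi>)) \<in> borel_measurable M"
      by (rule borel_measurable_sum) (use int in auto)
    show "AE \<omega> in M. (\<Sum>\<pi>\<in>?\<Pi>. ?\<Psi> ((\<lambda>i. \<xi> i \<omega>) \<circ> \<pi>)) = R"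
      using gen by (rule eventually_mono) (simp only: R_def generic_steps.sum_permutations_face_angle_sum[OF _ j])
  qed simp
  also have "\<dots> = R" by (simp add: prob_space)
  finally have "R = (\<Sum>\<pi>\<in>?\<Pi>. \<integral>\<omega>. ?\<Psi> ((\<lambda>i. \<xi> i \<omega>) \<circ> \<pi>) \<partial>M)"
    using int by (subst (asm) Bochner_Integration.integral_sum) auto
  also have "\<dots> = (\<Sum>\<pi>\<in>?\<Pi>. \<integral>\<omega>. ?\<Psi> (\<lambda>i. \<xi> i \<omega>) \<partial>M)" using same by (intro sum.cong) auto
  also have "\<dots> = fact n * (\<integral>\<omega>. ?\<Psi> (\<lambda>i. \<xi> i \<omega>) \<partial>M)"
  proof -
    have "card ?\<Pi> = fact n" by (rule card_permutations) auto
    then show ?thesis by (simp del: One_nat_def)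
  qed
  finally show "fact n * (\<integral>\<omega>. ?\<Psi> (\<lambda>i. \<xi> i \<omega>) \<partial>M) = fact j *
      (\<Sum>s\<le>DIM('a). (- 1) ^ s * real (stirling (n + 1) (DIM('a) - s)) * real (Stirling (DIM('a) - s) (j + 1)))"
    by (simp add: R_def)
qed

theorem corollary4p4:
  fixes M :: "'w measure" and \<xi> :: "nat \<Rightarrow> 'w \<Rightarrow> real ^ 'd" and n j :: nat
  assumes "prob_space M"
    and "n \<ge> CARD('d)"
    and "\<And>i. i \<in> {1..n} \<Longrightarrow> \<xi> i \<in> borel_measurable M"
    and Ex: "\<And>\<pi>. \<pi> permutes {1..n} \<Longrightarrow>
      distr M (PiM {1..n} (\<lambda>_. borel)) (\<lambda>\<omega>. \<lambda>i\<in>{1..n}. \<xi> (\<pi> i) \<omega>)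
        = distr M (PiM {1..n} (\<lambda>_. borel)) (\<lambda>\<omega>. \<lambda>i\<in>{1..n}. \<xi> i \<omega>)"
    and GP: "\<And>I. I \<subseteq> {1..n} \<Longrightarrow> card I = CARD('d) \<Longrightarrow>
      AE \<omega> in M. \<not> family_dependent I (\<lambda>i. walk \<xi> i \<omega>)"
    and "j < CARD('d)"
  shows "integrable M (\<lambda>\<omega>. \<Sum>F\<in>faces_of_dim j (walk_hull \<xi> n \<omega>).
            solid_angle (tangent_cone (walk_hull \<xi> n \<omega>) F)) \<and>
         (\<integral>\<omega>. (\<Sum>F\<in>faces_of_dim j (walk_hull \<xi> n \<omega>).
            solid_angle (tangent_cone (walk_hull \<xi> n \<omega>) F)) \<partial>M)
          = fact j / fact n * (\<Sum>s. (-1) ^ s * real (stirling (n + 1) (CARD('d) - s))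
                                       * real (Stirling (CARD('d) - s) (j + 1)))"
proof -
  have d: "DIM(real ^ 'd) = CARD('d)" by simp
  have eq: "(\<Sum>F\<in>faces_of_dim j (walk_hull \<xi> n \<omega>). solid_angle (tangent_cone (walk_hull \<xi> n \<omega>) F)) =
      face_angle_sum j n (\<lambda>i. \<xi> i \<omega>)" for \<omega>
    by (simp add: face_angle_sum_def walk_hull_eq_psum)
  \<comment> \<open>for \<open>s \<ge> d\<close> the lower index \<open>d - s\<close> is \<open>0\<close>, and the Stirling numbers vanish there\<close>
  have series: "(\<Sum>s. (-1) ^ s * real (stirling (n + 1) (CARD('d) - s)) * real (Stirling (CARD('d) - s) (j + 1))) =
      (\<Sum>s\<le>CARD('d). (-1) ^ s * real (stirling (n + 1) (CARD('d) - s)) * real (Stirling (CARD('d) - s) (j + 1)))"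
    by (rule suminf_finite) auto
  note result = expected_face_angle_sum[OF assms(1) assms(2)[folded d] assms(3) Ex GP[folded d] assms(6)[folded d]]
  let ?X = "\<integral>\<omega>. face_angle_sum j n (\<lambda>i. \<xi> i \<omega>) \<partial>M"
  let ?R = "\<Sum>s\<le>CARD('d). (-1) ^ s * real (stirling (n + 1) (CARD('d) - s)) * real (Stirling (CARD('d) - s) (j + 1))"
  have "fact n * ?X = fact j * ?R" using result(2) unfolding d .
  moreover have "x = b / a * r" if "a * x = b * r" "a \<noteq> 0" for a b r x :: real
    using that by (simp add: field_simps)
  ultimately have "?X = fact j / fact n * ?R" by simp
  then show ?thesis unfolding eq series by (intro conjI result(1))
qed

end
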